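(* Let $n\geqslant 1$ and let $q$ be a nonzero complex number which is not a root of unity. Let $L=L^+(L^-)^{-1}$ be the generator matrix with entries in $\mathrm U_q(\mathfrak{gl}_n)$ and let $$E(u)=\sum_{m=0}^n\mathrm{tr}_{q\,(1,\dots,m)}\,L_{\overline 1}\cdots L_{\overline m}\,\mathcal E_{(1^m)}\,(-u)^{-m},$$ a polynomial in $u^{-1}$ with central coefficients. Then the following identity of formal power series in $u^{-1}$ with coefficients in $\mathrm U_q(\mathfrak{gl}_n)$ holds: $$1+(1-q^{-2})\sum_{m=1}^\infty \mathrm{tr}_q\,L^m\,u^{-m}=\frac{E(uq^2)}{E(u)}.$$
   Context: $R$-matrices. Let $e_{ij}\in\mathrm{End}\,\mathbb C^n$ be the matrix units, $P=\sum_{i,j}e_{ij}\otimes e_{ji}$, $R=q\sum_i e_{ii}\otimes e_{ii}+\sum_{i\ne j}e_{ii}\otimes e_{jj}+(q-q^{-1})\sum_{i<j}e_{ij}\otimes e_{ji}$, $\check R=PR$, and let $\check R_k$ denote $\check R$ acting in the tensor factors $k,k+1$ of $(\mathbb C^n)^{\otimes m}$. The algebra. $\mathrm U_q(\mathfrak{gl}_n)$ is the associative algebra generated by the entries of an upper triangular matrix $L^+=[l^+_{ij}]$ ($l^+_{ij}=0$ for $i>j$) and a lower triangular matrix $L^-=[l^-_{ij}]$ ($l^-_{ij}=0$ for $i<j$) subject to $l^+_{ii}l^-_{ii}=l^-_{ii}l^+_{ii}=1$, $RL^\pm_1L^\pm_2=L^\pm_2L^\pm_1R$, $RL^+_1L^-_2=L^-_2L^+_1R$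 (the subscript of a matrix indicates the copy of $\mathrm{End}\,\mathbb C^n$ in which it is placed). Overlined subscripts and $q$-trace. In $(\mathrm{End}\,\mathbb C^n)^{\otimes m}\otimes\mathrm U_q(\mathfrak{gl}_n)$ set $L_{\overline 1}=L_1$ and $L_{\overline k}=\check R_{k-1}\cdots\check R_1L_1\check R_1^{-1}\cdots\check R_{k-1}^{-1}$ for $k\geqslant 2$. With $D=\mathrm{diag}[1,q^{-2},\dots,q^{-2n+2}]$, the $q$-trace of an $n\times n$ matrix $X$ is $\mathrm{tr}_q\,X=\mathrm{tr}\,DX$, and $\mathrm{tr}_{q\,(1,\dots,m)}Y=\mathrm{tr}_{1,\dots,m}\,D_1\cdots D_mY$, the trace being over all $m$ copies of $\mathrm{End}\,\mathbb C^n$. The $m=0$ term of $E(u)$ is $1$. Idempotent. $\mathcal H_m$ is the Hecke algebra over $\mathbb C$ with generators $T_1,\dots,T_{m-1}$ and relations $(T_i-q)(T_i+q^{-1})=0$, $T_iT_{i+1}T_i=T_{i+1}T_iT_{i+1}$, $T_iT_j=T_jT_i$ for $|i-j|>1$. It acts on $(\mathbb C^n)^{\otimes m}$ by $T_k\mapsto\check R_k$. $\mathcal E_{(1^m)}$ denotes the image under this action of the primitive idempotent of $\mathcal H_m$ associated with the unique standard tableau of the column shape $(1^m)$, i.e. of the nonzero idempotent $e$ with $T_ke=eT_k=-q^{-1}e$ for $k=1,\dots,m-1$ (the $q$-antisymmetrizer). *)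

theory Defs
  imports Complex_Main "HOL-Library.Poly_Mapping" "HOL-Algebra.QuotRing" "HOL-Algebra.Module"
begin

section \<open>Associative complex algebras by generators and relations\<close>

text \<open>
  A unital associative algebra over the complex numbers is represented by a record of type
  \<^typ>\<open>(complex, 'a) module\<close>: a ring record (in general noncommutative) together with the
  scalar multiplication \<open>\<odot>\<close>.
\<close>

definition complex_alg :: "(complex, complex) module" where
  "complex_alg = \<lparr>carrier = UNIV, mult = (*), one = 1, zero = 0, add = (+), smult = (*)\<rparr>"

definition list_prod :: "('a, 'm) monoid_scheme \<Rightarrow> 'a list \<Rightarrow> 'a" where
  "list_prod A xs = foldr (\<lambda>x y. x \<otimes>\<^bsub>A\<^esub> y) xs \<one>\<^bsub>A\<^esub>"

datatype 'g free_word = Free_Word (letters: "'g list")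

instantiation free_word :: (type) monoid_add
begin
definition zero_free_word :: "'a free_word" where "0 = Free_Word []"
definition plus_free_word :: "'a free_word \<Rightarrow> 'a free_word \<Rightarrow> 'a free_word" where
  "v + w = Free_Word (letters v @ letters w)"
instance
  by standard (auto simp: zero_free_word_def plus_free_word_def)
end

text \<open>
  Noncommutative polynomials are finitely supported functions on words; the product of
  \<^theory>\<open>HOL-Library.Poly_Mapping\<close> is the convolution with respect to concatenation.
\<close>

type_synonym 'g ncpoly = "'g free_word \<Rightarrow>\<^sub>0 complex"

definition nc_const :: "complex \<Rightarrow> 'g ncpoly" where
  "nc_const c = Poly_Mapping.single 0 c"

definition nc_gen :: "'g \<Rightarrow> 'g ncpoly" where
  "nc_gen g = Poly_Mapping.single (Free_Word [g]) 1"

definition free_alg :: "'g set \<Rightarrow> (complex, 'g ncpoly) module" where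
  "free_alg S =
     \<lparr>carrier = {f. \<forall>w \<in> Poly_Mapping.keys f. set (letters w) \<subseteq> S},
      mult = (*), one = 1, zero = 0, add = (+), smult = (\<lambda>c f. nc_const c * f)\<rparr>"

text \<open>
  The algebra generated by \<open>S\<close> subject to the relations \<open>r = 0\<close> for \<open>r \<in> \<rho>\<close>: the quotient of the
  free algebra by the two-sided ideal generated by \<open>\<rho>\<close>.  Its elements are cosets.
\<close>

definition pres_class :: "'g set \<Rightarrow> 'g ncpoly set \<Rightarrow> 'g ncpoly \<Rightarrow> 'g ncpoly set" where
  "pres_class S \<rho> x = (Idl\<^bsub>free_alg S\<^esub> \<rho>) +>\<^bsub>free_alg S\<^esub> x"

definition pres_alg :: "'g set \<Rightarrow> 'g ncpoly set \<Rightarrow> (complex, 'g ncpoly set) module" where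
  "pres_alg S \<rho> =
     ring.extend (free_alg S Quot (Idl\<^bsub>free_alg S\<^esub> \<rho>))
       (module.fields
          (\<lambda>c X. pres_class S \<rho> (nc_const c) \<otimes>\<^bsub>free_alg S Quot (Idl\<^bsub>free_alg S\<^esub> \<rho>)\<^esub> X))"

definition nc_eval :: "(complex, 'a) module \<Rightarrow> ('g \<Rightarrow> 'a) \<Rightarrow> 'g ncpoly \<Rightarrow> 'a" where
  "nc_eval A h f =
     (\<Oplus>\<^bsub>A\<^esub>w \<in> Poly_Mapping.keys f.
        Poly_Mapping.lookup f w \<odot>\<^bsub>A\<^esub> list_prod A (map h (letters w)))"

text \<open>
  The homomorphism from a presented algebra to \<open>A\<close> sending each generator \<open>g\<close> to \<open>h g\<close>.  It is
  well defined, i.e. the evaluation is constant on cosets, when the \<open>h g\<close> satisfy the relations.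
\<close>

definition pres_hom ::
  "(complex, 'a) module \<Rightarrow> ('g \<Rightarrow> 'a) \<Rightarrow> 'g ncpoly set \<Rightarrow> 'a" where
  "pres_hom A h X = the_elem (nc_eval A h ` X)"


section \<open>Tensor powers of matrix algebras\<close>

text \<open>
  Basis vectors \<open>e\<^bsub>i1\<^esub> \<otimes> \<dots> \<otimes> e\<^bsub>im\<^esub>\<close> of the \<open>m\<close>-th tensor power of \<open>\<complex>\<^sup>n\<close> are lists of length \<open>m\<close>
  with entries in \<open>{1..n}\<close>, and elements of \<open>(End \<complex>\<^sup>n)\<^sup>\<otimes>\<^sup>m \<otimes> A\<close> are matrices over \<open>A\<close> whose rows and
  columns are indexed by these lists.  Thus \<open>n \<times> n\<close> matrices have indices \<open>[i]\<close>.  They are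
  required to be \<^const>\<open>undefined\<close> outside the index range, so that equality is equality of entries.
\<close>

definition multi_idx :: "nat \<Rightarrow> nat \<Rightarrow> nat list set" where
  "multi_idx n m = {is. length is = m \<and> set is \<subseteq> {1..n}}"

type_synonym 'a tmat = "nat list \<times> nat list \<Rightarrow> 'a"

definition tens :: "nat \<Rightarrow> nat \<Rightarrow> (complex, 'a) module \<Rightarrow> (complex, 'a tmat) module" where
  "tens n m A = (let I = multi_idx n m in
     \<lparr>carrier = (I \<times> I) \<rightarrow>\<^sub>E carrier A,
      mult = (\<lambda>X Y. \<lambda>(i, j) \<in> I \<times> I. \<Oplus>\<^bsub>A\<^esub>k \<in> I. X (i, k) \<otimes>\<^bsub>A\<^esub> Y (k, j)),
      one = (\<lambda>(i, j) \<in> I \<times> I. if i = j then \<one>\<^bsub>A\<^esub> else \<zero>\<^bsub>A\<^esub>),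
      zero = (\<lambda>p \<in> I \<times> I. \<zero>\<^bsub>A\<^esub>),
      add = (\<lambda>X Y. \<lambda>p \<in> I \<times> I. X p \<oplus>\<^bsub>A\<^esub> Y p),
      smult = (\<lambda>c X. \<lambda>p \<in> I \<times> I. c \<odot>\<^bsub>A\<^esub> X p)\<rparr>)"

definition tens_trace :: "nat \<Rightarrow> nat \<Rightarrow> (complex, 'a) module \<Rightarrow> 'a tmat \<Rightarrow> 'a" where
  "tens_trace n m A X = (\<Oplus>\<^bsub>A\<^esub>i \<in> multi_idx n m. X (i, i))"

text \<open>The canonical map \<open>X \<mapsto> X \<otimes> 1\<close> from complex matrices to matrices over \<open>A\<close>.\<close>

definition extend_scalars ::
  "nat \<Rightarrow> nat \<Rightarrow> (complex, 'a) module \<Rightarrow> complex tmat \<Rightarrow> 'a tmat" where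
  "extend_scalars n m A X =
     (\<lambda>p \<in> multi_idx n m \<times> multi_idx n m. X p \<odot>\<^bsub>A\<^esub> \<one>\<^bsub>A\<^esub>)"

text \<open>
  \<open>at_copies n m A ps X\<close> is \<open>X\<close> placed in the copies \<open>ps\<close> (a list of distinct numbers between \<open>1\<close>
  and \<open>m\<close>) among the \<open>m\<close> copies of \<open>End \<complex>\<^sup>n\<close>, the other copies carrying the identity; e.g. \<open>X\<^sub>k\<close>
  for \<open>ps = [k]\<close>.
\<close>

definition at_copies ::
  "nat \<Rightarrow> nat \<Rightarrow> (complex, 'a) module \<Rightarrow> nat list \<Rightarrow> 'a tmat \<Rightarrow> 'a tmat" where
  "at_copies n m A ps X =
     (\<lambda>(i, j) \<in> multi_idx n m \<times> multi_idx n m.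
        if \<forall>l \<in> {1..m} - set ps. i ! (l - 1) = j ! (l - 1)
        then X (map (\<lambda>l. i ! (l - 1)) ps, map (\<lambda>l. j ! (l - 1)) ps)
        else \<zero>\<^bsub>A\<^esub>)"


section \<open>R-matrices\<close>

definition unit_tensor :: "nat \<Rightarrow> nat \<Rightarrow> nat \<Rightarrow> nat \<Rightarrow> complex tmat" \<comment> \<open>\<open>e\<^sub>i\<^sub>j \<otimes> e\<^sub>k\<^sub>l\<close>\<close> where
  "unit_tensor i j k l = (\<lambda>p. if p = ([i, k], [j, l]) then 1 else 0)"

definition P_mat :: "nat \<Rightarrow> complex tmat" where
  "P_mat n = (\<lambda>p \<in> multi_idx n 2 \<times> multi_idx n 2.
     \<Sum>i \<in> {1..n}. \<Sum>j \<in> {1..n}. unit_tensor i j j i p)"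

definition R_mat :: "nat \<Rightarrow> complex \<Rightarrow> complex tmat" where
  "R_mat n q = (\<lambda>p \<in> multi_idx n 2 \<times> multi_idx n 2.
     q * (\<Sum>i \<in> {1..n}. unit_tensor i i i i p)
     + (\<Sum>i \<in> {1..n}. \<Sum>j \<in> {1..n} - {i}. unit_tensor i i j j p)
     + (q - inverse q) * (\<Sum>i \<in> {1..n}. \<Sum>j \<in> {i<..n}. unit_tensor i j j i p))"

definition R_check :: "nat \<Rightarrow> complex \<Rightarrow> complex tmat" where
  "R_check n q = P_mat n \<otimes>\<^bsub>tens n 2 complex_alg\<^esub> R_mat n q"

definition R_check_at :: "nat \<Rightarrow> complex \<Rightarrow> nat \<Rightarrow> nat \<Rightarrow> complex tmat" where
  "R_check_at n q m k = at_copies n m complex_alg [k, k + 1] (R_check n q)"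

definition D_mat :: "nat \<Rightarrow> complex \<Rightarrow> complex tmat" where
  "D_mat n q = (\<lambda>(i, j) \<in> multi_idx n 1 \<times> multi_idx n 1.
     if i = j then q powi (2 - 2 * int (hd i)) else 0)"

definition q_trace ::
  "nat \<Rightarrow> complex \<Rightarrow> nat \<Rightarrow> (complex, 'a) module \<Rightarrow> 'a tmat \<Rightarrow> 'a" where
  "q_trace n q m A Y = tens_trace n m A
     (extend_scalars n m A
        (list_prod (tens n m complex_alg)
           (map (\<lambda>k. at_copies n m complex_alg [k] (D_mat n q)) [1..<m + 1]))
      \<otimes>\<^bsub>tens n m A\<^esub> Y)"


section \<open>The quantized enveloping algebra of \<open>gl\<^sub>n\<close>\<close>

datatype uq_gen = Lplus nat nat | Lminus nat nat

definition uq_gens :: "nat \<Rightarrow> uq_gen set" where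
  "uq_gens n = {Lplus i j | i j. i \<in> {1..n} \<and> j \<in> {1..n}}
             \<union> {Lminus i j | i j. i \<in> {1..n} \<and> j \<in> {1..n}}"

definition free_mat :: "nat \<Rightarrow> (nat \<Rightarrow> nat \<Rightarrow> uq_gen) \<Rightarrow> uq_gen ncpoly tmat" where
  "free_mat n G = (\<lambda>(i, j) \<in> multi_idx n 1 \<times> multi_idx n 1. nc_gen (G (hd i) (hd j)))"

text \<open>Differences of the entries of the matrix relation \<open>R X\<^sub>1 Y\<^sub>2 = Y\<^sub>2 X\<^sub>1 R\<close>, over the free algebra.\<close>

definition RLL_rels ::
  "nat \<Rightarrow> complex \<Rightarrow> uq_gen ncpoly tmat \<Rightarrow> uq_gen ncpoly tmat \<Rightarrow> uq_gen ncpoly set" where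
  "RLL_rels n q X Y =
     (let F = free_alg (uq_gens n);
          T = tens n 2 F;
          R = extend_scalars n 2 F (R_mat n q);
          X1 = at_copies n 2 F [1] X;
          Y2 = at_copies n 2 F [2] Y
      in {(R \<otimes>\<^bsub>T\<^esub> X1 \<otimes>\<^bsub>T\<^esub> Y2) p - (Y2 \<otimes>\<^bsub>T\<^esub> X1 \<otimes>\<^bsub>T\<^esub> R) p | p. p \<in> multi_idx n 2 \<times> multi_idx n 2})"

definition uq_rels :: "nat \<Rightarrow> complex \<Rightarrow> uq_gen ncpoly set" where
  "uq_rels n q =
     {nc_gen (Lplus i j) | i j. i \<in> {1..n} \<and> j \<in> {1..n} \<and> i > j}
   \<union> {nc_gen (Lminus i j) | i j. i \<in> {1..n} \<and> j \<in> {1..n} \<and> i < j}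
   \<union> {nc_gen (Lplus i i) * nc_gen (Lminus i i) - 1 | i. i \<in> {1..n}}
   \<union> {nc_gen (Lminus i i) * nc_gen (Lplus i i) - 1 | i. i \<in> {1..n}}
   \<union> RLL_rels n q (free_mat n Lplus) (free_mat n Lplus)
   \<union> RLL_rels n q (free_mat n Lminus) (free_mat n Lminus)
   \<union> RLL_rels n q (free_mat n Lplus) (free_mat n Lminus)"

definition Uq_gl :: "nat \<Rightarrow> complex \<Rightarrow> (complex, uq_gen ncpoly set) module" where
  "Uq_gl n q = pres_alg (uq_gens n) (uq_rels n q)"

definition uq_mat ::
  "nat \<Rightarrow> complex \<Rightarrow> (nat \<Rightarrow> nat \<Rightarrow> uq_gen) \<Rightarrow> uq_gen ncpoly set tmat" where
  "uq_mat n q G = (\<lambda>(i, j) \<in> multi_idx n 1 \<times> multi_idx n 1.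
     pres_class (uq_gens n) (uq_rels n q) (nc_gen (G (hd i) (hd j))))"

definition L_mat :: "nat \<Rightarrow> complex \<Rightarrow> uq_gen ncpoly set tmat" where
  "L_mat n q = uq_mat n q Lplus \<otimes>\<^bsub>tens n 1 (Uq_gl n q)\<^esub>
     inv\<^bsub>tens n 1 (Uq_gl n q)\<^esub> (uq_mat n q Lminus)"

text \<open>
  \<open>L_over n q m k\<close> is \<open>L\<close> with overlined subscript \<open>k + 1\<close> (subscripts start at 1), in
  \<open>(End \<complex>\<^sup>n)\<^sup>\<otimes>\<^sup>m \<otimes> U\<^sub>q(gl\<^sub>n)\<close>.
\<close>

primrec L_over :: "nat \<Rightarrow> complex \<Rightarrow> nat \<Rightarrow> nat \<Rightarrow> uq_gen ncpoly set tmat" where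
  "L_over n q m 0 = at_copies n m (Uq_gl n q) [1] (L_mat n q)"
| "L_over n q m (Suc k) =
     (let T = tens n m (Uq_gl n q);
          Rk = extend_scalars n m (Uq_gl n q) (R_check_at n q m (Suc k))
      in Rk \<otimes>\<^bsub>T\<^esub> L_over n q m k \<otimes>\<^bsub>T\<^esub> inv\<^bsub>T\<^esub> Rk)"


section \<open>Hecke algebras and the \<open>q\<close>-antisymmetrizer\<close>

text \<open>The generator \<open>T\<^sub>k\<close> is the natural number \<open>k\<close>, for \<open>k \<in> {1..<m}\<close>.\<close>

definition hecke_rels :: "nat \<Rightarrow> complex \<Rightarrow> nat ncpoly set" where
  "hecke_rels m q =
     {(nc_gen i - nc_const q) * (nc_gen i + nc_const (inverse q)) | i. i \<in> {1..<m}}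
   \<union> {nc_gen i * nc_gen (i + 1) * nc_gen i - nc_gen (i + 1) * nc_gen i * nc_gen (i + 1)
        | i. i \<in> {1..<m} \<and> i + 1 \<in> {1..<m}}
   \<union> {nc_gen i * nc_gen j - nc_gen j * nc_gen i
        | i j. i \<in> {1..<m} \<and> j \<in> {1..<m} \<and> \<bar>int i - int j\<bar> > 1}"

definition hecke_alg :: "nat \<Rightarrow> complex \<Rightarrow> (complex, nat ncpoly set) module" where
  "hecke_alg m q = pres_alg {1..<m} (hecke_rels m q)"

definition hecke_T :: "nat \<Rightarrow> complex \<Rightarrow> nat \<Rightarrow> nat ncpoly set" where
  "hecke_T m q k = pres_class {1..<m} (hecke_rels m q) (nc_gen k)"

definition column_idem :: "nat \<Rightarrow> complex \<Rightarrow> nat ncpoly set" where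
  "column_idem m q = (let H = hecke_alg m q in
     THE e. e \<in> carrier H \<and> e \<noteq> \<zero>\<^bsub>H\<^esub> \<and> e \<otimes>\<^bsub>H\<^esub> e = e \<and>
       (\<forall>k \<in> {1..<m}. hecke_T m q k \<otimes>\<^bsub>H\<^esub> e = (- inverse q) \<odot>\<^bsub>H\<^esub> e \<and>
                      e \<otimes>\<^bsub>H\<^esub> hecke_T m q k = (- inverse q) \<odot>\<^bsub>H\<^esub> e))"

definition antisymmetrizer :: "nat \<Rightarrow> complex \<Rightarrow> nat \<Rightarrow> complex tmat" where
  "antisymmetrizer n q m =
     pres_hom (tens n m complex_alg) (R_check_at n q m) (column_idem m q)"


section \<open>Power series in \<open>u\<^sup>-\<^sup>1\<close>\<close>

text \<open>
  A power series in \<open>u\<^sup>-\<^sup>1\<close> is the sequence of its coefficients, the \<open>m\<close>-th one being that of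
  \<open>u\<^sup>-\<^sup>m\<close>.  (The library type \<open>fps\<close> needs a type class for the coefficients, which are here
  elements of a ring record.)
\<close>

definition series_alg :: "(complex, 'a) module \<Rightarrow> (complex, nat \<Rightarrow> 'a) module" where
  "series_alg A =
     \<lparr>carrier = UNIV \<rightarrow> carrier A,
      mult = (\<lambda>f g m. \<Oplus>\<^bsub>A\<^esub>k \<in> {..m}. f k \<otimes>\<^bsub>A\<^esub> g (m - k)),
      one = (\<lambda>m. if m = 0 then \<one>\<^bsub>A\<^esub> else \<zero>\<^bsub>A\<^esub>),
      zero = (\<lambda>m. \<zero>\<^bsub>A\<^esub>),
      add = (\<lambda>f g m. f m \<oplus>\<^bsub>A\<^esub> g m),
      smult = (\<lambda>c f m. c \<odot>\<^bsub>A\<^esub> f m)\<rparr>"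

definition rescale :: "(complex, 'a) module \<Rightarrow> complex \<Rightarrow> (nat \<Rightarrow> 'a) \<Rightarrow> nat \<Rightarrow> 'a"
    \<comment> \<open>\<open>f(u) \<mapsto> f(u c)\<close>\<close> where
  "rescale A c f = (\<lambda>m. inverse c ^ m \<odot>\<^bsub>A\<^esub> f m)"

definition E_series :: "nat \<Rightarrow> complex \<Rightarrow> nat \<Rightarrow> uq_gen ncpoly set" where
  "E_series n q = (\<lambda>m. let U = Uq_gl n q; T = tens n m U in
     if m = 0 then \<one>\<^bsub>U\<^esub>
     else if m \<le> n then
       (- 1) ^ m \<odot>\<^bsub>U\<^esub> q_trace n q m U
         (list_prod T (map (L_over n q m) [0..<m])
          \<otimes>\<^bsub>T\<^esub> extend_scalars n m U (antisymmetrizer n q m))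
     else \<zero>\<^bsub>U\<^esub>)"

definition power_trace_series :: "nat \<Rightarrow> complex \<Rightarrow> nat \<Rightarrow> uq_gen ncpoly set" where
  "power_trace_series n q = (\<lambda>m. let U = Uq_gl n q in
     if m = 0 then \<one>\<^bsub>U\<^esub>
     else (1 - q powi (- 2)) \<odot>\<^bsub>U\<^esub> q_trace n q 1 U (L_mat n q [^]\<^bsub>tens n 1 U\<^esub> m))"

end

theory Submission
  imports Defs "HOL-Library.Function_Algebras" "HOL-Computational_Algebra.Formal_Power_Series"
begin

text \<open>
  Write \<open>A\<^sub>m\<close> for the \<open>q\<close>-antisymmetrizer, \<open>e\<^sub>m = tr\<^sub>q L\<^sub>1 \<dots> L\<^sub>m A\<^sub>m\<close> (subscripts overlined) and \<open>p\<^sub>j = tr\<^sub>q L\<^sup>j\<close>.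
  Inserting the recursion \<open>[m] A\<^sub>m = A\<^bsub>m-1\<^esub> (q\<^bsup>m-1\<^esup> - [m-1] T\<^bsub>m-1\<^esub>) A\<^bsub>m-1\<^esub>\<close> into the mixed traces
  \<open>x\<^bsub>m,j\<^esub> = tr\<^sub>q L\<^sub>1 \<dots> L\<^bsub>m-1\<^esub> L\<^sub>m\<^sup>j A\<^sub>m\<close> and taking the partial \<open>q\<close>-trace over the last copy gives
  \<open>[m] x\<^bsub>m,j\<^esub> = q\<^bsup>m-1\<^esup> e\<^bsub>m-1\<^esub> p\<^sub>j - q [m-1] x\<^bsub>m-1,j+1\<^esub>\<close>.  Iterating from \<open>j = 1\<close> yields the Newton identities
  \<open>[m] e\<^sub>m = q\<^bsup>m-1\<^esup> \<Sum>\<^sub>k (-1)\<^sup>k p\<^bsub>k+1\<^esub> e\<^bsub>m-1-k\<^esub>\<close>, which are the claim coefficient by coefficient; they need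
  \<open>e\<^sub>m = 0\<close> for \<open>m > n\<close>, where \<open>A\<^sub>m\<close> acts as zero by a pigeonhole argument.  The \<open>e\<^sub>m\<close> are central because
  conjugation by products of R-matrices moves all copies of \<open>L\<close> past \<open>L\<^sup>\<plusminus>\<close> in an extra copy while
  preserving the \<open>q\<close>-traces.

  All matrix algebras over \<open>U\<^sub>q(gl\<^sub>n)\<close> are represented by operators on one infinite tensor power, which
  makes the tensor factors uniform in \<open>m\<close> and turns the carrier-based algebras into a type class.
\<close>

subsection \<open>Algebras as subalgebras of endomorphism types\<close>

text \<open>One endomorphism type serves all algebras on a given carrier type, so the unit of a
  single algebra cannot become the class constant \<open>1\<close>: it becomes a projection
  \<open>e\<close>, and all operators are studied in the corner cut out by \<open>e\<close>. Hence
  evaluations, powers and Hecke families carry an explicit unit. Two constants shape the identity.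
  The partial q-trace of the braid operator over its second factor is q, which enters the recursion
  for the mixed traces. And (1 - q^(-2)) q^(-p) [p+1] = 1 - q^(-2(p+1)) turns the Newton identity of
  degree p+1 into the comparison of E(u) with E(u q^2). For centrality, the m copies are transported
  away from the first factor in two ways, by permutations and by braid operators or their inverses.
  Passing L^+ or L^- in that factor exchanges the two transports, and the q-trace does not
  distinguish them. The idempotent is given only by its characterization in the abstract Hecke
  algebra. It has to be replaced by an explicit noncommutative polynomial, whose class is nonzero
  because the character sending all generators to -1/q takes the value 1 on it.\<close>

class complex_module = ab_group_add +
  fixes cscale :: "complex \<Rightarrow> 'a \<Rightarrow> 'a"  (infixr "*\<^sub>C" 75)
  assumes cscale_add_right: "c *\<^sub>C (x + y) = c *\<^sub>C x + c *\<^sub>C y"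
    and cscale_add_left: "(c + d) *\<^sub>C x = c *\<^sub>C x + d *\<^sub>C x"
    and cscale_cscale [simp]: "c *\<^sub>C d *\<^sub>C x = (c * d) *\<^sub>C x"
    and cscale_one [simp]: "1 *\<^sub>C x = x"
begin

lemma cscale_zero_right [simp]: "c *\<^sub>C 0 = 0"
  using cscale_add_right[of c 0 0] by simp

lemma cscale_zero_left [simp]: "0 *\<^sub>C x = 0"
  using cscale_add_left[of 0 0 x] by simp

lemma cscale_minus_left [simp]: "(- c) *\<^sub>C x = - (c *\<^sub>C x)"
  using cscale_add_left[of c "- c" x] by (simp add: eq_neg_iff_add_eq_0 add.commute)

lemma cscale_minus_right [simp]: "c *\<^sub>C (- x) = - (c *\<^sub>C x)"
  using cscale_add_right[of c x "- x"] by (simp add: eq_neg_iff_add_eq_0 add.commute)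

lemma cscale_diff_right: "c *\<^sub>C (x - y) = c *\<^sub>C x - c *\<^sub>C y"
  using cscale_add_right[of c x "- y"] by simp

lemma cscale_diff_left: "(c - d) *\<^sub>C x = c *\<^sub>C x - d *\<^sub>C x"
  using cscale_add_left[of c "- d" x] by simp

lemma cscale_cancel:
  assumes "c *\<^sub>C x = c *\<^sub>C y" "c \<noteq> 0"
  shows "x = y"
proof -
  have "inverse c *\<^sub>C c *\<^sub>C x = inverse c *\<^sub>C c *\<^sub>C y" by (simp only: assms(1))
  then show ?thesis using assms(2) by simp
qed

lemma cscale_eq_0_iff: "c *\<^sub>C x = 0 \<longleftrightarrow> c = 0 \<or> x = 0"
  using cscale_cancel[of c x 0] by auto

end

lemma cscale_sum_right: "c *\<^sub>C (\<Sum>i\<in>I. f i) = (\<Sum>i\<in>I. c *\<^sub>C f i)"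
  for f :: "'i \<Rightarrow> 'a::complex_module"
  by (induction I rule: infinite_finite_induct) (simp_all add: cscale_add_right)

lemma cscale_sum_left: "(\<Sum>i\<in>I. f i) *\<^sub>C x = (\<Sum>i\<in>I. f i *\<^sub>C x)"
  for x :: "'a::complex_module"
  by (induction I rule: infinite_finite_induct) (simp_all add: cscale_add_left)

class calgebra = ring + complex_module +
  assumes mult_cscale_left [simp]: "(c *\<^sub>C x) * y = c *\<^sub>C (x * y)"
    and mult_cscale_right [simp]: "x * (c *\<^sub>C y) = c *\<^sub>C (x * y)"

lemmas cscale_distribs = cscale_add_right cscale_add_left cscale_diff_right cscale_diff_left

instantiation complex :: calgebra
begin
definition cscale_complex :: "complex \<Rightarrow> complex \<Rightarrow> complex" where "cscale_complex = (*)"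
instance by standard (simp_all add: cscale_complex_def algebra_simps)
end

instantiation "fun" :: (type, complex_module) complex_module
begin
definition cscale_fun :: "complex \<Rightarrow> ('a \<Rightarrow> 'b) \<Rightarrow> 'a \<Rightarrow> 'b" where
  "cscale_fun c f = (\<lambda>x. c *\<^sub>C f x)"
instance by standard (simp_all add: cscale_fun_def fun_eq_iff cscale_add_right cscale_add_left)
end

lemma cscale_fun_apply [simp]: "(c *\<^sub>C f) x = c *\<^sub>C f x"
  by (simp add: cscale_fun_def)

lemma sum_fun_apply: "(\<Sum>i\<in>I. f i) x = (\<Sum>i\<in>I. f i x)"
  for f :: "'i \<Rightarrow> 'b \<Rightarrow> 'a::comm_monoid_add"
  by (induction I rule: infinite_finite_induct) simp_all

typedef (overloaded) 'v endo =
  "{f :: 'v::complex_module \<Rightarrow> 'v. (\<forall>x y. f (x + y) = f x + f y) \<and> (\<forall>c x. f (c *\<^sub>C x) = c *\<^sub>C f x)}"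
  morphisms app Endo
  by (rule exI[of _ id]) simp

setup_lifting type_definition_endo

instantiation endo :: (complex_module) calgebra
begin

lift_definition zero_endo :: "'a endo" is "\<lambda>x. 0" by simp
lift_definition plus_endo :: "'a endo \<Rightarrow> 'a endo \<Rightarrow> 'a endo" is "\<lambda>f g x. f x + g x"
  by (simp add: cscale_add_right)
lift_definition minus_endo :: "'a endo \<Rightarrow> 'a endo \<Rightarrow> 'a endo" is "\<lambda>f g x. f x - g x"
  by (simp add: cscale_diff_right)
lift_definition uminus_endo :: "'a endo \<Rightarrow> 'a endo" is "\<lambda>f x. - f x" by simp
lift_definition times_endo :: "'a endo \<Rightarrow> 'a endo \<Rightarrow> 'a endo" is "\<lambda>f g x. f (g x)" by simp
lift_definition cscale_endo :: "complex \<Rightarrow> 'a endo \<Rightarrow> 'a endo" is "\<lambda>c f x. c *\<^sub>C f x"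
  by (simp add: cscale_add_right mult.commute)

instance
  by standard (transfer; simp add: fun_eq_iff cscale_add_right cscale_add_left algebra_simps)+

end

lemma app_zero [simp]: "app 0 x = 0" and app_plus [simp]: "app (f + g) x = app f x + app g x"
  and app_minus [simp]: "app (f - g) x = app f x - app g x"
  and app_uminus [simp]: "app (- f) x = - app f x"
  and app_times [simp]: "app (f * g) x = app f (app g x)"
  and app_cscale [simp]: "app (c *\<^sub>C f) x = c *\<^sub>C app f x"
  by (transfer; simp)+

lemma app_add_right: "app f (x + y) = app f x + app f y"
  and app_cscale_right [simp]: "app f (c *\<^sub>C x) = c *\<^sub>C app f x"
  using app[of f] by simp_all

lemma app_zero_right [simp]: "app f 0 = 0"
  using app_add_right[of f 0 0] by simp

lemma app_sum: "app (\<Sum>i\<in>I. f i) x = (\<Sum>i\<in>I. app (f i) x)"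
  by (induction I rule: infinite_finite_induct) simp_all

lemma app_sum_right: "app f (\<Sum>i\<in>I. x i) = (\<Sum>i\<in>I. app f (x i))"
  by (induction I rule: infinite_finite_induct) (simp_all add: app_add_right)

lemma endo_eqI: "(\<And>x. app f x = app g x) \<Longrightarrow> f = g"
  by (simp add: app_inject[symmetric] fun_eq_iff)

lemma app_Endo:
  assumes "\<And>x y. f (x + y) = f x + f y" "\<And>c x. f (c *\<^sub>C x) = c *\<^sub>C f x"
  shows "app (Endo f) = f"
  using assms by (intro Endo_inverse) auto

section \<open>Record algebras and their embedding into operators\<close>

locale calg = ring A for A :: "(complex, 'a) module" (structure) +
  assumes smult_closed [intro, simp]: "x \<in> carrier A \<Longrightarrow> c \<odot> x \<in> carrier A"
    and smult_add_right: "\<lbrakk>x \<in> carrier A; y \<in> carrier A\<rbrakk> \<Longrightarrow> c \<odot> (x \<oplus> y) = c \<odot> x \<oplus> c \<odot> y"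
    and smult_add_left: "x \<in> carrier A \<Longrightarrow> (c + d) \<odot> x = c \<odot> x \<oplus> d \<odot> x"
    and smult_smult: "x \<in> carrier A \<Longrightarrow> c \<odot> (d \<odot> x) = (c * d) \<odot> x"
    and smult_one [simp]: "x \<in> carrier A \<Longrightarrow> 1 \<odot> x = x"
    and smult_mult_left: "\<lbrakk>x \<in> carrier A; y \<in> carrier A\<rbrakk> \<Longrightarrow> (c \<odot> x) \<otimes> y = c \<odot> (x \<otimes> y)"
    and smult_mult_right: "\<lbrakk>x \<in> carrier A; y \<in> carrier A\<rbrakk> \<Longrightarrow> x \<otimes> (c \<odot> y) = c \<odot> (x \<otimes> y)"

text \<open>
  The product of all algebras with elements in a given type: a single type whose endomorphism
  algebra contains a (nonunital) copy of each of these algebras.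
\<close>

typedef 'a algprod = "{f :: (complex, 'a) module \<Rightarrow> 'a.
    (\<forall>A. calg A \<longrightarrow> f A \<in> carrier A) \<and> (\<forall>A. \<not> calg A \<longrightarrow> f A = undefined)}"
  morphisms component Algprod
proof (rule exI, rule CollectI, intro conjI allI impI)
  let ?z = "\<lambda>A :: (complex, 'a) module. if calg A then \<zero>\<^bsub>A\<^esub> else undefined"
  show "?z A \<in> carrier A" if "calg A" for A
    using that calg.axioms(1) ring.ring_simprules(2) by fastforce
qed simp

setup_lifting type_definition_algprod

instantiation algprod :: (type) complex_module
begin

lift_definition zero_algprod :: "'a algprod" is "\<lambda>A. if calg A then \<zero>\<^bsub>A\<^esub> else undefined"
  by (auto simp: calg.axioms(1) ring.ring_simprules)
lift_definition plus_algprod :: "'a algprod \<Rightarrow> 'a algprod \<Rightarrow> 'a algprod"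
  is "\<lambda>f g A. if calg A then f A \<oplus>\<^bsub>A\<^esub> g A else undefined"
  by (auto simp: calg.axioms(1) ring.ring_simprules)
lift_definition uminus_algprod :: "'a algprod \<Rightarrow> 'a algprod"
  is "\<lambda>f A. if calg A then \<ominus>\<^bsub>A\<^esub> f A else undefined"
  by (auto simp: calg.axioms(1) ring.ring_simprules)
lift_definition minus_algprod :: "'a algprod \<Rightarrow> 'a algprod \<Rightarrow> 'a algprod"
  is "\<lambda>f g A. if calg A then f A \<ominus>\<^bsub>A\<^esub> g A else undefined"
  by (auto simp: calg.axioms(1) ring.ring_simprules)
lift_definition cscale_algprod :: "complex \<Rightarrow> 'a algprod \<Rightarrow> 'a algprod"
  is "\<lambda>c f A. if calg A then c \<odot>\<^bsub>A\<^esub> f A else undefined"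
  by (auto intro: calg.smult_closed)

instance
proof
  fix x y z :: "'a algprod" and c d
  show "x + y + z = x + (y + z)"
    by transfer (auto simp: fun_eq_iff ring.ring_simprules calg.axioms(1))
  show "x + y = y + x"
    by transfer (auto simp: fun_eq_iff ring.ring_simprules calg.axioms(1))
  show "0 + x = x"
    by transfer (auto simp: fun_eq_iff ring.ring_simprules calg.axioms(1))
  show "- x + x = 0"
    by transfer (auto simp: fun_eq_iff ring.ring_simprules calg.axioms(1))
  show "x - y = x + - y"
    by transfer (auto simp: fun_eq_iff ring.ring_simprules calg.axioms(1))
  show "c *\<^sub>C (x + y) = c *\<^sub>C x + c *\<^sub>C y"
    by transfer (auto simp: fun_eq_iff calg.smult_add_right)
  show "(c + d) *\<^sub>C x = c *\<^sub>C x + d *\<^sub>C x"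
    by transfer (auto simp: fun_eq_iff calg.smult_add_left)
  show "c *\<^sub>C d *\<^sub>C x = (c * d) *\<^sub>C x"
    by transfer (auto simp: fun_eq_iff calg.smult_smult)
  show "1 *\<^sub>C x = x"
    by transfer (auto simp: fun_eq_iff calg.smult_one)
qed

end

lemma component_in_carrier: "calg A \<Longrightarrow> component k A \<in> carrier A"
  using component[of k] by blast

lemma component_add: "calg A \<Longrightarrow> component (k + l) A = component k A \<oplus>\<^bsub>A\<^esub> component l A"
  and component_cscale: "calg A \<Longrightarrow> component (c *\<^sub>C k) A = c \<odot>\<^bsub>A\<^esub> component k A"
  and component_zero: "calg A \<Longrightarrow> component 0 A = \<zero>\<^bsub>A\<^esub>"
  by (transfer; simp)+

lemma algprod_eqI:
  assumes "\<And>A. calg A \<Longrightarrow> component k A = component l A"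
  shows "k = l"
  using assms component[of k] component[of l]
  by (auto simp: component_inject[symmetric] fun_eq_iff) metis

text \<open>The left regular representation of \<open>A\<close> on its own factor of the product,
  extended by zero to the other factors. The value \<open>0\<close> outside the carrier makes the
  map total.\<close>

definition emb :: "(complex, 'a) module \<Rightarrow> 'a \<Rightarrow> 'a algprod endo" where
  "emb A x = (if x \<in> carrier A then Endo (\<lambda>k. Algprod (\<lambda>B.
     if \<not> calg B then undefined else if B = A then x \<otimes>\<^bsub>A\<^esub> component k A else \<zero>\<^bsub>B\<^esub>)) else 0)"

context calg
begin

lemma smult_zero_right [simp]: "c \<odot> \<zero> = \<zero>"
  using smult_add_right[of \<zero> \<zero> c] by simp

lemma smult_zero_left [simp]: "x \<in> carrier A \<Longrightarrow> 0 \<odot> x = \<zero>"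
  using smult_add_left[of x 0 0] by simp

lemma smult_eq_mult: "x \<in> carrier A \<Longrightarrow> c \<odot> x = (c \<odot> \<one>) \<otimes> x"
  by (simp add: smult_mult_left)

lemma component_emb:
  assumes x: "x \<in> carrier A" and B: "calg B"
  shows "component (app (emb A x) k) B = (if B = A then x \<otimes> component k A else \<zero>\<^bsub>B\<^esub>)"
proof -
  let ?f = "\<lambda>k B. if \<not> calg B then undefined else if B = A then x \<otimes> component k A else \<zero>\<^bsub>B\<^esub>"
  have zero: "calg B \<Longrightarrow> \<zero>\<^bsub>B\<^esub> \<in> carrier B" "calg B \<Longrightarrow> \<zero>\<^bsub>B\<^esub> \<oplus>\<^bsub>B\<^esub> \<zero>\<^bsub>B\<^esub> = \<zero>\<^bsub>B\<^esub>"
    "calg B \<Longrightarrow> c \<odot>\<^bsub>B\<^esub> \<zero>\<^bsub>B\<^esub> = \<zero>\<^bsub>B\<^esub>" for B :: "(complex, 'a) module" and c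
    by (auto simp: calg.axioms(1) ring.ring_simprules calg.smult_zero_right)
  have c: "component k A \<in> carrier A" for k
    by (rule component_in_carrier) (rule calg_axioms)
  have f: "component (Algprod (?f k)) = ?f k" for k
    by (intro Algprod_inverse) (auto simp: zero x c)
  have "app (Endo (\<lambda>k. Algprod (?f k))) = (\<lambda>k. Algprod (?f k))"
  proof (rule app_Endo; rule algprod_eqI)
    fix k l c and B :: "(complex, 'a) module"
    assume B: "calg B"
    show "component (Algprod (?f (k + l))) B = component (Algprod (?f k) + Algprod (?f l)) B"
      using B by (auto simp: f component_add zero r_distr x c)
    show "component (Algprod (?f (c *\<^sub>C k))) B = component (c *\<^sub>C Algprod (?f k)) B"
      using B by (auto simp: f component_cscale zero x c[rule_format] smult_mult_right)
  qed
  then show ?thesis using x B by (simp add: emb_def f)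
qed

lemma emb_outside: "x \<notin> carrier A \<Longrightarrow> emb A x = 0"
  by (simp add: emb_def)

lemma emb_mult: "\<lbrakk>x \<in> carrier A; y \<in> carrier A\<rbrakk> \<Longrightarrow> emb A (x \<otimes> y) = emb A x * emb A y"
  by (intro endo_eqI algprod_eqI) (simp add: component_emb component_in_carrier calg_axioms m_assoc calg.axioms(1) ring.ring_simprules)

lemma emb_add: "\<lbrakk>x \<in> carrier A; y \<in> carrier A\<rbrakk> \<Longrightarrow> emb A (x \<oplus> y) = emb A x + emb A y"
  by (intro endo_eqI algprod_eqI)
    (simp add: component_emb component_in_carrier calg_axioms l_distr component_add calg.axioms(1) ring.ring_simprules)

lemma emb_smult: "x \<in> carrier A \<Longrightarrow> emb A (c \<odot> x) = c *\<^sub>C emb A x"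
  by (intro endo_eqI algprod_eqI)
    (simp add: component_emb component_in_carrier calg_axioms smult_mult_left component_cscale calg.smult_zero_right)

lemma emb_inj:
  assumes "x \<in> carrier A" "y \<in> carrier A" "emb A x = emb A y"
  shows "x = y"
proof -
  \<comment> \<open>The family of all units separates elements: the operator of \<open>x\<close>
    turns its \<open>A\<close>-component into \<open>x\<close>.\<close>
  let ?k = "Algprod (\<lambda>B. if calg B then \<one>\<^bsub>B\<^esub> else undefined) :: 'a algprod"
  have k: "component ?k A = \<one>"
    by (subst Algprod_inverse) (auto simp: calg.axioms(1) ring.ring_simprules calg_axioms)
  have "component (app (emb A x) ?k) A = component (app (emb A y) ?k) A"
    using assms(3) by simp
  then have "x \<otimes> component ?k A = y \<otimes> component ?k A"
    using component_emb[OF assms(1) calg_axioms, of ?k] component_emb[OF assms(2) calg_axioms, of ?k]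
    by (simp only: simp_thms if_True)
  then show ?thesis
    unfolding k using assms by simp
qed

end

text \<open>
  Homomorphisms need not preserve the unit: \<open>emb A\<close> maps \<open>\<one>\<close> to the projection onto the factor \<open>A\<close>.
\<close>

locale alg_map = calg A for A :: "(complex, 'a) module" (structure) +
  fixes \<phi> :: "'a \<Rightarrow> 'b::calgebra"
  assumes map_mult: "\<lbrakk>x \<in> carrier A; y \<in> carrier A\<rbrakk> \<Longrightarrow> \<phi> (x \<otimes> y) = \<phi> x * \<phi> y"
    and map_add: "\<lbrakk>x \<in> carrier A; y \<in> carrier A\<rbrakk> \<Longrightarrow> \<phi> (x \<oplus> y) = \<phi> x + \<phi> y"
    and map_smult: "x \<in> carrier A \<Longrightarrow> \<phi> (c \<odot> x) = c *\<^sub>C \<phi> x"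
begin

lemma map_zero [simp]: "\<phi> \<zero> = 0"
  using map_add[of \<zero> \<zero>] by simp

lemma map_minus: "x \<in> carrier A \<Longrightarrow> \<phi> (\<ominus> x) = - \<phi> x"
  using map_add[of x "\<ominus> x"] by (simp add: r_neg eq_neg_iff_add_eq_0 add.commute)

lemma map_diff: "\<lbrakk>x \<in> carrier A; y \<in> carrier A\<rbrakk> \<Longrightarrow> \<phi> (x \<ominus> y) = \<phi> x - \<phi> y"
  by (simp add: minus_eq map_add map_minus)

lemma map_one_left: "x \<in> carrier A \<Longrightarrow> \<phi> \<one> * \<phi> x = \<phi> x"
  by (simp add: map_mult[symmetric])

lemma map_one_right: "x \<in> carrier A \<Longrightarrow> \<phi> x * \<phi> \<one> = \<phi> x"
  by (simp add: map_mult[symmetric])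

lemma map_finsum:
  "(\<And>i. i \<in> I \<Longrightarrow> f i \<in> carrier A) \<Longrightarrow> finite I \<Longrightarrow> \<phi> (\<Oplus>i\<in>I. f i) = (\<Sum>i\<in>I. \<phi> (f i))"
proof (induction I rule: infinite_finite_induct)
  case (insert i I)
  then show ?case by (simp add: finsum_insert map_add Pi_def finsum_closed)
qed auto

lemma list_prod_closed: "set xs \<subseteq> carrier A \<Longrightarrow> list_prod A xs \<in> carrier A"
  by (induction xs) (auto simp: list_prod_def)

lemma map_list_prod: "set xs \<subseteq> carrier A \<Longrightarrow> \<phi> (list_prod A xs) = foldr (\<lambda>x y. \<phi> x * y) xs (\<phi> \<one>)"
proof (induction xs)
  case (Cons x xs)
  then show ?case using list_prod_closed[of xs] by (simp add: list_prod_def map_mult)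
qed (simp add: list_prod_def)

end

lemma (in calg) emb_alg_map: "alg_map A (emb A)"
  by unfold_locales (auto simp: emb_mult emb_add emb_smult)

subsection \<open>Evaluation of noncommutative polynomials\<close>

text \<open>Every word ends in \<open>e\<close>, which stands for the unit in the image of a
  nonunital map; in particular the empty word has the value \<open>e\<close>.\<close>

definition word_eval :: "'b::calgebra \<Rightarrow> ('g \<Rightarrow> 'b) \<Rightarrow> 'g list \<Rightarrow> 'b" where
  "word_eval e t w = foldr (\<lambda>g y. t g * y) w e"

definition ev :: "'b::calgebra \<Rightarrow> ('g \<Rightarrow> 'b) \<Rightarrow> 'g ncpoly \<Rightarrow> 'b" where
  "ev e t f = (\<Sum>w\<in>Poly_Mapping.keys f. Poly_Mapping.lookup f w *\<^sub>C word_eval e t (letters w))"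

lemma word_eval_simps [simp]: "word_eval e t [] = e" "word_eval e t (g # w) = t g * word_eval e t w"
  by (simp_all add: word_eval_def)

lemma ev_superset:
  assumes "finite K" "Poly_Mapping.keys f \<subseteq> K"
  shows "ev e t f = (\<Sum>w\<in>K. Poly_Mapping.lookup f w *\<^sub>C word_eval e t (letters w))"
  unfolding ev_def by (rule sum.mono_neutral_left) (use assms in \<open>auto simp: in_keys_iff\<close>)

lemma ev_zero [simp]: "ev e t 0 = 0"
  by (simp add: ev_def)

lemma ev_single: "ev e t (Poly_Mapping.single w c) = c *\<^sub>C word_eval e t (letters w)"
  by (simp add: ev_def)

lemma ev_add: "ev e t (f + g) = ev e t f + ev e t g"
proof -
  let ?K = "Poly_Mapping.keys f \<union> Poly_Mapping.keys g"
  have "Poly_Mapping.keys (f + g) \<subseteq> ?K" by (rule Poly_Mapping.keys_add)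
  then show ?thesis
    by (simp add: ev_superset[of ?K] lookup_add cscale_add_left sum.distrib)
qed

lemma ncpoly_induct [case_names zero add_single]:
  fixes f :: "'g ncpoly"
  assumes "P 0" "\<And>f w c. P f \<Longrightarrow> w \<notin> Poly_Mapping.keys f \<Longrightarrow> c \<noteq> 0 \<Longrightarrow> P (f + Poly_Mapping.single w c)"
  shows "P f"
proof (induction f rule: Poly_Mapping.update_induct)
  case (update f w c)
  have "Poly_Mapping.update w c f = f + Poly_Mapping.single w c"
    by (rule poly_mapping_eqI) (use update.hyps in \<open>auto simp: lookup_update lookup_add lookup_single in_keys_iff when_def\<close>)
  then show ?case using assms(2) update by auto
qed (rule assms(1))

text \<open>When two words are joined, the \<open>e\<close> closing the first one meets the head of
  the second and is absorbed there by the hypotheses; the rest is bilinearity, by induction on both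
  polynomials.\<close>

lemma ev_mult:
  assumes "e * e = e" "\<And>g. e * t g = t g"
  shows "ev e t (f * g) = ev e t f * ev e t g"
proof -
  have e: "e * word_eval e t w = word_eval e t w" for w
    by (cases w) (simp_all add: assms mult.assoc[symmetric])
  have append: "word_eval e t (v @ w) = word_eval e t v * word_eval e t w" for v w
    by (induction v) (simp_all add: e mult.assoc)
  have single: "ev e t (Poly_Mapping.single v c * g) = ev e t (Poly_Mapping.single v c) * ev e t g" for v c
    by (induction g rule: ncpoly_induct)
      (simp_all add: algebra_simps ev_add ev_single mult_single plus_free_word_def append)
  show ?thesis
    by (induction f rule: ncpoly_induct) (simp_all add: algebra_simps ev_add single)
qed

lemma ev_const [simp]: "ev e t (nc_const c) = c *\<^sub>C e"
  by (simp add: nc_const_def ev_single zero_free_word_def)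

lemma ev_one [simp]: "ev e t 1 = e"
  using ev_const[of e t 1] by (simp add: nc_const_def)

lemma ev_gen [simp]: "ev e t (nc_gen g) = t g * e"
  by (simp add: nc_gen_def ev_single)

lemma ev_uminus: "ev e t (- f) = - ev e t f"
  using ev_add[of e t f "- f"] by (simp add: eq_neg_iff_add_eq_0 add.commute)

lemma ev_diff: "ev e t (f - g) = ev e t f - ev e t g"
  using ev_add[of e t f "- g"] by (simp add: ev_uminus)

lemma nc_const_mult: "nc_const (c * d) = nc_const c * nc_const d"
  by (simp add: nc_const_def mult_single)

lemma nc_const_add: "nc_const (c + d) = nc_const c + nc_const d"
  by (simp add: nc_const_def single_add)

lemma nc_const_one [simp]: "nc_const 1 = 1"
  by (simp add: nc_const_def)

lemma nc_const_commute: "f * nc_const c = nc_const c * f"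
  by (induction f rule: ncpoly_induct) (simp_all add: algebra_simps nc_const_def mult_single mult.commute)

lemma in_free_alg: "f \<in> carrier (free_alg S) \<longleftrightarrow> (\<forall>w \<in> Poly_Mapping.keys f. set (letters w) \<subseteq> S)"
  by (simp add: free_alg_def)

lemma free_alg_simps [simp]: "monoid.mult (free_alg S) = (*)" "one (free_alg S) = 1" "zero (free_alg S) = 0"
  "add (free_alg S) = (+)" "smult (free_alg S) = (\<lambda>c f. nc_const c * f)"
  by (simp_all add: free_alg_def)

lemma free_alg_closed [intro, simp]:
  "nc_const c \<in> carrier (free_alg S)" "0 \<in> carrier (free_alg S)" "1 \<in> carrier (free_alg S)"
  "g \<in> S \<Longrightarrow> nc_gen g \<in> carrier (free_alg S)"
  "f \<in> carrier (free_alg S) \<Longrightarrow> - f \<in> carrier (free_alg S)"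
  "f \<in> carrier (free_alg S) \<Longrightarrow> h \<in> carrier (free_alg S) \<Longrightarrow> f + h \<in> carrier (free_alg S)"
  "f \<in> carrier (free_alg S) \<Longrightarrow> h \<in> carrier (free_alg S) \<Longrightarrow> f * h \<in> carrier (free_alg S)"
proof -
  show "nc_const c \<in> carrier (free_alg S)" "0 \<in> carrier (free_alg S)" "1 \<in> carrier (free_alg S)"
    by (auto simp: in_free_alg nc_const_def zero_free_word_def)
  show "g \<in> S \<Longrightarrow> nc_gen g \<in> carrier (free_alg S)"
    by (auto simp: in_free_alg nc_gen_def)
  show "f \<in> carrier (free_alg S) \<Longrightarrow> - f \<in> carrier (free_alg S)"
    by (auto simp: in_free_alg in_keys_iff)
  show "f \<in> carrier (free_alg S) \<Longrightarrow> h \<in> carrier (free_alg S) \<Longrightarrow> f + h \<in> carrier (free_alg S)"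
    using Poly_Mapping.keys_add[of f h] by (auto simp: in_free_alg)
  show "f \<in> carrier (free_alg S) \<Longrightarrow> h \<in> carrier (free_alg S) \<Longrightarrow> f * h \<in> carrier (free_alg S)"
    using Poly_Mapping.keys_mult[of f h] by (fastforce simp: in_free_alg plus_free_word_def)
qed

lemma free_alg_diff [intro, simp]:
  "f \<in> carrier (free_alg S) \<Longrightarrow> h \<in> carrier (free_alg S) \<Longrightarrow> f - h \<in> carrier (free_alg S)"
  using free_alg_closed(6)[of f S "- h"] by simp

lemma free_alg_ring: "ring (free_alg S)"
proof (rule ringI)
  show "abelian_group (free_alg S)"
  proof (rule abelian_groupI)
    fix x assume "x \<in> carrier (free_alg S)"
    then show "\<exists>y\<in>carrier (free_alg S). y \<oplus>\<^bsub>free_alg S\<^esub> x = \<zero>\<^bsub>free_alg S\<^esub>"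
      by (intro bexI[of _ "- x"]) auto
  qed (auto simp: algebra_simps)
  show "monoid (free_alg S)"
    by (rule monoidI) (auto simp: algebra_simps)
qed (auto simp: algebra_simps)

subsection \<open>Presented algebras\<close>

lemma pres_alg_simps:
  "carrier (pres_alg S \<rho>) = carrier (free_alg S Quot (Idl\<^bsub>free_alg S\<^esub> \<rho>))"
  "monoid.mult (pres_alg S \<rho>) = monoid.mult (free_alg S Quot (Idl\<^bsub>free_alg S\<^esub> \<rho>))"
  "one (pres_alg S \<rho>) = one (free_alg S Quot (Idl\<^bsub>free_alg S\<^esub> \<rho>))"
  "zero (pres_alg S \<rho>) = zero (free_alg S Quot (Idl\<^bsub>free_alg S\<^esub> \<rho>))"
  "add (pres_alg S \<rho>) = add (free_alg S Quot (Idl\<^bsub>free_alg S\<^esub> \<rho>))"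
  "c \<odot>\<^bsub>pres_alg S \<rho>\<^esub> X = pres_class S \<rho> (nc_const c) \<otimes>\<^bsub>free_alg S Quot (Idl\<^bsub>free_alg S\<^esub> \<rho>)\<^esub> X"
  by (simp_all add: pres_alg_def ring.defs module.defs)

locale presentation =
  fixes S :: "'g set" and \<rho> :: "'g ncpoly set"
  assumes rels: "\<rho> \<subseteq> carrier (free_alg S)"
begin

abbreviation "F \<equiv> free_alg S"
abbreviation "J \<equiv> Idl\<^bsub>F\<^esub> \<rho>"
abbreviation "Q \<equiv> pres_alg S \<rho>"
abbreviation "cls \<equiv> pres_class S \<rho>"

sublocale J: ideal J F
  using ring.genideal_ideal[OF free_alg_ring rels] .

lemma cls_eq: "cls x = J +>\<^bsub>F\<^esub> x"
  by (simp add: pres_class_def)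

lemma carrier_Q: "carrier Q = cls ` carrier F"
  by (auto simp: pres_alg_simps FactRing_def A_RCOSETS_def' cls_eq)

lemma cls_closed [intro, simp]: "x \<in> carrier F \<Longrightarrow> cls x \<in> carrier Q"
  by (simp add: carrier_Q)

lemma cls_mult: "x \<in> carrier F \<Longrightarrow> y \<in> carrier F \<Longrightarrow> cls (x * y) = cls x \<otimes>\<^bsub>Q\<^esub> cls y"
  and cls_add: "x \<in> carrier F \<Longrightarrow> y \<in> carrier F \<Longrightarrow> cls (x + y) = cls x \<oplus>\<^bsub>Q\<^esub> cls y"
  and cls_one: "cls 1 = \<one>\<^bsub>Q\<^esub>"
  using J.rcos_ring_hom by (auto simp: ring_hom_def cls_eq pres_alg_simps)

lemma cls_zero: "cls 0 = \<zero>\<^bsub>Q\<^esub>"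
proof -
  have "J +>\<^bsub>F\<^esub> \<zero>\<^bsub>F\<^esub> = \<zero>\<^bsub>F Quot J\<^esub>"
    using J.a_rcos_const[OF additive_subgroup.zero_closed[OF J.additive_subgroup_axioms]] by (simp add: FactRing_def)
  then show ?thesis by (simp add: pres_alg_simps cls_eq)
qed

lemma cls_smult: "x \<in> carrier F \<Longrightarrow> cls (nc_const c * x) = c \<odot>\<^bsub>Q\<^esub> cls x"
  by (simp add: pres_alg_simps cls_mult)

sublocale calg Q
proof -
  interpret R: ring "F Quot J" by (rule J.quotient_is_ring)
  interpret ring Q
  proof (rule ringI)
    show "abelian_group Q"
    proof (rule abelian_groupI)
      fix x assume "x \<in> carrier Q"
      then show "\<exists>y\<in>carrier Q. y \<oplus>\<^bsub>Q\<^esub> x = \<zero>\<^bsub>Q\<^esub>"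
        by (intro bexI[of _ "\<ominus>\<^bsub>F Quot J\<^esub> x"]) (auto simp: pres_alg_simps R.l_neg)
    qed (auto simp: pres_alg_simps R.ring_simprules)
    show "monoid Q"
      by (rule monoidI) (auto simp: pres_alg_simps R.ring_simprules)
  qed (auto simp: pres_alg_simps R.ring_simprules)
  show "calg Q"
  proof unfold_locales
    fix x y and c d
    assume x: "x \<in> carrier Q"
    then obtain u where u: "x = cls u" "u \<in> carrier F" by (auto simp: carrier_Q)
    show "c \<odot>\<^bsub>Q\<^esub> x \<in> carrier Q" using u by (simp add: cls_smult[symmetric])
    show "(c + d) \<odot>\<^bsub>Q\<^esub> x = c \<odot>\<^bsub>Q\<^esub> x \<oplus>\<^bsub>Q\<^esub> d \<odot>\<^bsub>Q\<^esub> x"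
      using u by (simp add: cls_smult[symmetric] cls_add[symmetric] nc_const_add algebra_simps)
    show "c \<odot>\<^bsub>Q\<^esub> (d \<odot>\<^bsub>Q\<^esub> x) = (c * d) \<odot>\<^bsub>Q\<^esub> x"
      using u by (simp add: cls_smult[symmetric] nc_const_mult algebra_simps)
    show "1 \<odot>\<^bsub>Q\<^esub> x = x"
      using u by (simp add: cls_smult[symmetric])
    assume y: "y \<in> carrier Q"
    then obtain v where v: "y = cls v" "v \<in> carrier F" by (auto simp: carrier_Q)
    show "c \<odot>\<^bsub>Q\<^esub> (x \<oplus>\<^bsub>Q\<^esub> y) = c \<odot>\<^bsub>Q\<^esub> x \<oplus>\<^bsub>Q\<^esub> c \<odot>\<^bsub>Q\<^esub> y"
      using u v by (simp add: cls_smult[symmetric] cls_add[symmetric] algebra_simps)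
    show "(c \<odot>\<^bsub>Q\<^esub> x) \<otimes>\<^bsub>Q\<^esub> y = c \<odot>\<^bsub>Q\<^esub> (x \<otimes>\<^bsub>Q\<^esub> y)"
      using u v by (simp add: cls_smult[symmetric] cls_mult[symmetric] algebra_simps)
    show "x \<otimes>\<^bsub>Q\<^esub> (c \<odot>\<^bsub>Q\<^esub> y) = c \<odot>\<^bsub>Q\<^esub> (x \<otimes>\<^bsub>Q\<^esub> y)"
      using u v
      by (simp add: cls_smult[symmetric] cls_mult[symmetric] mult.assoc[symmetric] nc_const_commute)
  qed
qed

lemma cls_eq_zero_iff: "x \<in> carrier F \<Longrightarrow> cls x = \<zero>\<^bsub>Q\<^esub> \<longleftrightarrow> x \<in> J"
  using J.a_rcos_const[of x] J.a_rcos_self[of x]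
  by (auto simp: cls_eq pres_alg_simps FactRing_def)

lemma rel_in_J: "r \<in> \<rho> \<Longrightarrow> r \<in> J"
  using ring.genideal_self[OF free_alg_ring rels] by blast

lemma cls_rel: "r \<in> \<rho> \<Longrightarrow> cls r = \<zero>\<^bsub>Q\<^esub>"
  using rel_in_J rels by (subst cls_eq_zero_iff) auto

text \<open>Values of a homomorphism on the quotient become evaluations in a type class. Letters
  outside \<open>S\<close> are sent to \<open>0\<close>, so that the neutrality of the unit demanded
  by \<open>ev_mult\<close> holds for all letters.\<close>

lemma map_cls:
  assumes "alg_map Q \<phi>" "f \<in> carrier F"
  shows "\<phi> (cls f) = ev (\<phi> \<one>\<^bsub>Q\<^esub>) (\<lambda>g. if g \<in> S then \<phi> (cls (nc_gen g)) else 0) f"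
proof -
  interpret alg_map Q \<phi> by fact
  let ?t = "\<lambda>g. if g \<in> S then \<phi> (cls (nc_gen g)) else 0"
  have word: "Poly_Mapping.single w 1 \<in> carrier F \<and>
      \<phi> (cls (Poly_Mapping.single w 1)) = word_eval (\<phi> \<one>\<^bsub>Q\<^esub>) ?t (letters w)"
    if "set (letters w) \<subseteq> S" for w
    using that
  proof (induction "letters w" arbitrary: w)
    case Nil
    have "w = 0" using Nil by (cases w) (simp add: zero_free_word_def)
    then have "Poly_Mapping.single w 1 = (1 :: 'g ncpoly)" by simp
    then show ?case using Nil(1)[symmetric] by (simp add: cls_one)
  next
    case (Cons g gs)
    have w: "Poly_Mapping.single w 1 = nc_gen g * Poly_Mapping.single (Free_Word gs) (1::complex)"
      using Cons.hyps(2) by (cases w) (simp add: nc_gen_def mult_single plus_free_word_def)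
    have IH: "Poly_Mapping.single (Free_Word gs) (1::complex) \<in> carrier F"
      "\<phi> (cls (Poly_Mapping.single (Free_Word gs) 1)) = word_eval (\<phi> \<one>\<^bsub>Q\<^esub>) ?t gs"
      and g: "g \<in> S"
      using Cons.hyps(1)[of "Free_Word gs"] Cons.hyps(2)[symmetric] Cons.prems by auto
    show ?case
      using IH g unfolding w by (simp add: cls_mult map_mult Cons.hyps(2)[symmetric])
  qed
  have "f \<in> carrier F \<longrightarrow> \<phi> (cls f) = ev (\<phi> \<one>\<^bsub>Q\<^esub>) ?t f"
  proof (induction f rule: ncpoly_induct)
    case zero
    then show ?case by (simp add: cls_zero)
  next
    case (add_single f w c)
    show ?case
    proof
      assume *: "f + Poly_Mapping.single w c \<in> carrier F"
      have "Poly_Mapping.keys (f + Poly_Mapping.single w c) = insert w (Poly_Mapping.keys f)"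
        using add_single.hyps by (auto simp: in_keys_iff lookup_add lookup_single when_def split: if_splits)
      then have w: "set (letters w) \<subseteq> S" and f: "f \<in> carrier F"
        using * by (auto simp: in_free_alg)
      have s: "Poly_Mapping.single w c = nc_const c * Poly_Mapping.single w 1"
        by (simp add: nc_const_def mult_single)
      have "Poly_Mapping.single w c \<in> carrier F"
        "\<phi> (cls (Poly_Mapping.single w c)) = c *\<^sub>C word_eval (\<phi> \<one>\<^bsub>Q\<^esub>) ?t (letters w)"
        using word[OF w] unfolding s by (simp_all only: cls_smult map_smult cls_closed free_alg_closed)
      then show "\<phi> (cls (f + Poly_Mapping.single w c)) = ev (\<phi> \<one>\<^bsub>Q\<^esub>) ?t (f + Poly_Mapping.single w c)"
        using add_single.IH f by (simp only: cls_add ev_add map_add ev_single cls_closed simp_thms)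
    qed
  qed
  then show ?thesis using assms(2) by blast
qed

text \<open>The elements of the free algebra killed by the evaluation form a two-sided ideal; it
  contains the relations, hence the ideal they generate.\<close>

lemma ev_ideal:
  assumes "e * e = e" "\<And>g. e * t g = t g" "\<And>r. r \<in> \<rho> \<Longrightarrow> ev e t r = 0" "f \<in> J"
  shows "ev e t f = 0"
proof -
  have "ideal {f \<in> carrier F. ev e t f = 0} F"
  proof (rule idealI[OF free_alg_ring])
    show "subgroup {f \<in> carrier F. ev e t f = 0} (add_monoid F)"
    proof
      fix x assume x: "x \<in> {f \<in> carrier F. ev e t f = 0}"
      then have "inv\<^bsub>add_monoid F\<^esub> x = - x"
        using ring.is_abelian_group[OF free_alg_ring, of S]
        by (intro group.inv_equality[OF abelian_group.a_group]) auto
      then show "inv\<^bsub>add_monoid F\<^esub> x \<in> {f \<in> carrier F. ev e t f = 0}"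
        using x by (simp add: ev_uminus)
    qed (auto simp: ev_add)
  qed (auto simp: ev_mult[OF assms(1,2)])
  then have "J \<subseteq> {f \<in> carrier F. ev e t f = 0}"
    by (intro ring.genideal_minimal[OF free_alg_ring]) (use assms rels in auto)
  then show ?thesis using assms(4) by blast
qed

lemma map_nc_eval:
  assumes "alg_map A \<phi>" "\<And>g. g \<in> S \<Longrightarrow> h g \<in> carrier A" "f \<in> carrier F"
  shows "nc_eval A h f \<in> carrier A"
    and "\<phi> (nc_eval A h f) = ev (\<phi> \<one>\<^bsub>A\<^esub>) (\<lambda>g. if g \<in> S then \<phi> (h g) else 0) f"
proof -
  interpret A: alg_map A \<phi> by fact
  let ?t = "\<lambda>g. if g \<in> S then \<phi> (h g) else 0"
  have closed: "list_prod A (map h w) \<in> carrier A" if "set w \<subseteq> S" for w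
    by (rule A.list_prod_closed) (use that assms(2) in auto)
  have word: "\<phi> (list_prod A (map h w)) = word_eval (\<phi> \<one>\<^bsub>A\<^esub>) ?t w" if "set w \<subseteq> S" for w
  proof -
    have "\<phi> (list_prod A (map h w)) = foldr (\<lambda>x y. \<phi> x * y) (map h w) (\<phi> \<one>\<^bsub>A\<^esub>)"
      by (rule A.map_list_prod) (use that assms(2) in auto)
    also have "\<dots> = word_eval (\<phi> \<one>\<^bsub>A\<^esub>) ?t w"
      using that by (induction w) auto
    finally show ?thesis .
  qed
  show "nc_eval A h f \<in> carrier A"
    unfolding nc_eval_def using assms(3) by (intro A.finsum_closed) (auto simp: in_free_alg closed)
  show "\<phi> (nc_eval A h f) = ev (\<phi> \<one>\<^bsub>A\<^esub>) ?t f"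
    unfolding nc_eval_def ev_def using assms(3)
    by (subst A.map_finsum) (auto simp: in_free_alg closed A.map_smult word)
qed

text \<open>Justifies \<open>the_elem\<close> in \<open>pres_hom\<close>: members of a coset differ
  by elements of \<open>J\<close>, which evaluate to \<open>0\<close>, and injectivity of
  \<open>\<phi>\<close> carries the equality of values back to \<open>A\<close>.\<close>

lemma pres_hom_cls:
  assumes "alg_map A \<phi>" "inj_on \<phi> (carrier A)" "\<And>g. g \<in> S \<Longrightarrow> h g \<in> carrier A"
    and "\<And>r. r \<in> \<rho> \<Longrightarrow> ev (\<phi> \<one>\<^bsub>A\<^esub>) (\<lambda>g. if g \<in> S then \<phi> (h g) else 0) r = 0" "f \<in> carrier F"
  shows "pres_hom A h (cls f) = nc_eval A h f"
proof -
  interpret A: alg_map A \<phi> by fact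
  let ?t = "\<lambda>g. if g \<in> S then \<phi> (h g) else 0"
  note ev = map_nc_eval[where h = h, OF assms(1,3)]
  have "nc_eval A h x = nc_eval A h f" if "x \<in> cls f" for x
  proof -
    obtain j where j: "j \<in> J" "x = j + f"
      using \<open>x \<in> cls f\<close> by (auto simp: cls_eq a_r_coset_def')
    have "ev (\<phi> \<one>\<^bsub>A\<^esub>) ?t j = 0"
      by (rule ev_ideal[OF _ _ assms(4) j(1)]) (simp_all add: A.map_one_left assms(3))
    then have "ev (\<phi> \<one>\<^bsub>A\<^esub>) ?t x = ev (\<phi> \<one>\<^bsub>A\<^esub>) ?t f" and "x \<in> carrier F"
      using j assms(5) J.Icarr by (auto simp: ev_add)
    then show ?thesis
      using ev(1)[of x] ev(2)[of x] ev(1)[OF _ assms(5)] ev(2)[OF _ assms(5)]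
      by (intro inj_onD[OF assms(2)]) auto
  qed
  moreover have "f \<in> cls f"
    using J.a_rcos_self assms(5) by (simp add: cls_eq)
  ultimately have "nc_eval A h ` cls f = {nc_eval A h f}" by blast
  then show ?thesis
    by (simp add: pres_hom_def)
qed

end

subsection \<open>Commuting elements\<close>

definition commutes :: "'r::calgebra \<Rightarrow> 'r \<Rightarrow> bool" where
  "commutes x y \<longleftrightarrow> x * y = y * x"

lemma commutesD: "commutes x y \<Longrightarrow> x * y = y * x"
  and commutesI: "x * y = y * x \<Longrightarrow> commutes x y"
  and commutes_sym: "commutes x y \<Longrightarrow> commutes y x"
  and commutes_refl [simp]: "commutes x x"
  and commutes_zero [simp]: "commutes x 0" "commutes 0 x"
  by (simp_all add: commutes_def)

lemma commutes_mult: "\<lbrakk>commutes x y; commutes x z\<rbrakk> \<Longrightarrow> commutes x (y * z)"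
  unfolding commutes_def by (metis mult.assoc)

lemma commutes_add: "\<lbrakk>commutes x y; commutes x z\<rbrakk> \<Longrightarrow> commutes x (y + z)"
  by (simp add: commutes_def algebra_simps)

lemma commutes_diff: "\<lbrakk>commutes x y; commutes x z\<rbrakk> \<Longrightarrow> commutes x (y - z)"
  by (simp add: commutes_def algebra_simps)

lemma commutes_cscale: "commutes x y \<Longrightarrow> commutes x (c *\<^sub>C y)"
  by (simp add: commutes_def)

lemma commutes_sum: "(\<And>i. i \<in> I \<Longrightarrow> commutes x (f i)) \<Longrightarrow> commutes x (\<Sum>i\<in>I. f i)"
  by (induction I rule: infinite_finite_induct) (auto intro: commutes_add)

lemmas commutes_intros = commutes_mult commutes_add commutes_diff commutes_cscale commutes_sum

lemmas commutes_intros_left = commutes_intros[THEN commutes_sym]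

subsection \<open>The antisymmetrizer of the Hecke algebra\<close>

text \<open>The quantum integer [m].\<close>

definition qint :: "complex \<Rightarrow> nat \<Rightarrow> complex" where
  "qint q m = (q ^ m - inverse q ^ m) / (q - inverse q)"

locale generic_parameter =
  fixes q :: complex
  assumes q_nonzero [simp]: "q \<noteq> 0" and q_generic: "k \<ge> 1 \<Longrightarrow> q ^ k \<noteq> 1"
begin

lemma q_square: "q * q \<noteq> 1"
  using q_generic[of 2] by (simp add: power2_eq_square)

lemma q_diff [simp]: "q - inverse q \<noteq> 0" "q \<noteq> inverse q"
  using q_square by (auto simp: field_simps)

lemma qint_0 [simp]: "qint q 0 = 0" and qint_1 [simp]: "qint q (Suc 0) = 1"
  by (simp_all add: qint_def)

lemma qint_Suc: "qint q (Suc m) = q ^ m + inverse q * qint q m"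
proof -
  have "q ^ m + inverse q * qint q m = (q ^ m * (q - inverse q) + inverse q * (q ^ m - inverse q ^ m)) / (q - inverse q)"
    by (simp add: qint_def add_divide_distrib)
  also have "\<dots> = qint q (Suc m)"
    unfolding qint_def by (simp add: algebra_simps)
  finally show ?thesis by simp
qed

text \<open>[m] = 0 would make q^(2m) equal to 1.\<close>

lemma qint_nonzero: "m \<ge> 1 \<Longrightarrow> qint q m \<noteq> 0"
proof
  assume "m \<ge> 1" "qint q m = 0"
  then have "q ^ m * q ^ m = 1"
    using q_square by (simp add: qint_def power_inverse field_simps)
  then show False
    using q_generic[of "2 * m"] \<open>m \<ge> 1\<close> by (simp add: mult_2 power_add)
qed

end

text \<open>The recursion of the overview, taken as a definition. The generator \<open>T 0\<close>
  enters the first step with the coefficient [0] = 0, so in a Hecke family A_1 = e.\<close>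

primrec anti :: "'r::calgebra \<Rightarrow> (nat \<Rightarrow> 'r) \<Rightarrow> complex \<Rightarrow> nat \<Rightarrow> 'r" where
  "anti e T q 0 = e"
| "anti e T q (Suc m) =
     inverse (qint q (Suc m)) *\<^sub>C (anti e T q m * (q ^ m *\<^sub>C e - qint q m *\<^sub>C T m) * anti e T q m)"

text \<open>One step of the recursion, with b = A_p, c = A_(p+1), S = T_p, T = T_(p+1), k = [p+1]
  and l = [p]. In k T c T c the first \<open>c\<close> is replaced by means of the recursion; the
  quadratic relation settles the term with \<open>b\<close>, and the braid relation the term with b
  S b, because there S reaches \<open>c\<close> and becomes -1/q. Multiplication from the right is
  the mirror image.\<close>

lemma anti_step:
  fixes S T b c e :: "'r::calgebra" and q :: complex
  assumes q: "q \<noteq> 0" and unit: "e * c = c" "c * e = c" "b * b = b"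
    and idem: "c * c = c" "b * c = c" "c * b = c"
    and comm: "T * b = b * T" and S: "S * c = (- inverse q) *\<^sub>C c" "c * S = (- inverse q) *\<^sub>C c"
    and quad: "T * T = e + (q - inverse q) *\<^sub>C T" and braid: "T * S * T = S * T * S"
    and c: "k *\<^sub>C c = q ^ p *\<^sub>C b - l *\<^sub>C (b * S * b)"
  shows "(T + inverse q *\<^sub>C e) * (c * (q ^ Suc p *\<^sub>C e - k *\<^sub>C T) * c) = 0"
    and "(c * (q ^ Suc p *\<^sub>C e - k *\<^sub>C T) * c) * (T + inverse q *\<^sub>C e) = 0"
proof -
  let ?r = "inverse q"
  have 1: "T * b * T * c = c + (q - ?r) *\<^sub>C (T * c)" "c * T * b * T = c + (q - ?r) *\<^sub>C (c * T)"
  proof -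
    have "T * b * T * c = T * T * (b * c)" "c * T * b * T = (c * b) * (T * T)"
      using comm by (metis mult.assoc)+
    then show "T * b * T * c = c + (q - ?r) *\<^sub>C (T * c)" "c * T * b * T = c + (q - ?r) *\<^sub>C (c * T)"
      by (simp_all add: idem quad unit distrib_left distrib_right)
  qed
  have 2: "T * (b * S * b) * T * c = (- ?r) *\<^sub>C (b * S * T * c)"
    "c * T * (b * S * b) * T = (- ?r) *\<^sub>C (c * T * S * b)"
  proof -
    have "T * (b * S * b) * T * c = b * (T * S * T) * (b * c)"
      using comm by (metis mult.assoc)
    also have "\<dots> = b * S * T * (S * c)"
      unfolding braid idem by (simp only: mult.assoc)
    finally show "T * (b * S * b) * T * c = (- ?r) *\<^sub>C (b * S * T * c)" by (simp add: S mult.assoc)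
    have "c * T * (b * S * b) * T = (c * b) * (T * S * T) * b"
      using comm by (metis mult.assoc)
    also have "\<dots> = (c * S) * (T * S * b)"
      unfolding braid idem by (simp only: mult.assoc)
    finally show "c * T * (b * S * b) * T = (- ?r) *\<^sub>C (c * T * S * b)" by (simp add: S mult.assoc)
  qed
  have 3: "b * T * c = T * c" "c * T * b = c * T"
    using comm idem by (metis mult.assoc)+
  have 4: "b * S * b * T * c = b * S * T * c" "c * T * (b * S * b) = c * T * S * b"
    using comm idem by (metis mult.assoc)+
  have X1: "k *\<^sub>C (T * c * T * c) = q ^ p *\<^sub>C (c + (q - ?r) *\<^sub>C (T * c)) + (l * ?r) *\<^sub>C (b * S * T * c)"
    "k *\<^sub>C (c * T * c * T) = q ^ p *\<^sub>C (c + (q - ?r) *\<^sub>C (c * T)) + (l * ?r) *\<^sub>C (c * T * S * b)"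
  proof -
    have "k *\<^sub>C (T * c * T * c) = T * (k *\<^sub>C c) * T * c" by simp
    also have "\<dots> = q ^ p *\<^sub>C (T * b * T * c) - l *\<^sub>C (T * (b * S * b) * T * c)"
      unfolding c by (simp add: algebra_simps)
    finally show "k *\<^sub>C (T * c * T * c) = q ^ p *\<^sub>C (c + (q - ?r) *\<^sub>C (T * c)) + (l * ?r) *\<^sub>C (b * S * T * c)"
      by (simp add: 1 2)
    have "k *\<^sub>C (c * T * c * T) = c * T * (k *\<^sub>C c) * T" by simp
    also have "\<dots> = q ^ p *\<^sub>C (c * T * b * T) - l *\<^sub>C (c * T * (b * S * b) * T)"
      unfolding c by (simp add: algebra_simps)
    finally show "k *\<^sub>C (c * T * c * T) = q ^ p *\<^sub>C (c + (q - ?r) *\<^sub>C (c * T)) + (l * ?r) *\<^sub>C (c * T * S * b)"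
      by (simp add: 1 2)
  qed
  have X2: "k *\<^sub>C (c * T * c) = q ^ p *\<^sub>C (T * c) - l *\<^sub>C (b * S * T * c)"
    "k *\<^sub>C (c * T * c) = q ^ p *\<^sub>C (c * T) - l *\<^sub>C (c * T * S * b)"
  proof -
    have "k *\<^sub>C (c * T * c) = (k *\<^sub>C c) * T * c" by simp
    also have "\<dots> = q ^ p *\<^sub>C (b * T * c) - l *\<^sub>C (b * S * b * T * c)"
      unfolding c by (simp add: algebra_simps)
    finally show "k *\<^sub>C (c * T * c) = q ^ p *\<^sub>C (T * c) - l *\<^sub>C (b * S * T * c)"
      by (simp add: 3 4)
    have "k *\<^sub>C (c * T * c) = c * T * (k *\<^sub>C c)" by simp
    also have "\<dots> = q ^ p *\<^sub>C (c * T * b) - l *\<^sub>C (c * T * (b * S * b))"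
      unfolding c by (simp add: algebra_simps)
    finally show "k *\<^sub>C (c * T * c) = q ^ p *\<^sub>C (c * T) - l *\<^sub>C (c * T * S * b)"
      by (simp add: 3 4)
  qed
  \<comment> \<open>Here \<open>z\<close> stands for T c or c T, and \<open>y\<close> for b S T c or
    c T S b; the coefficients of \<open>y\<close>, \<open>z\<close> and \<open>c\<close> cancel
    separately.\<close>
  have collect: "q ^ Suc p *\<^sub>C z - (q ^ p *\<^sub>C (c + (q - ?r) *\<^sub>C z) + (l * ?r) *\<^sub>C y)
      + (?r * q ^ Suc p) *\<^sub>C c - ?r *\<^sub>C (q ^ p *\<^sub>C z - l *\<^sub>C y) = 0" for y z :: 'r
  proof -
    have "q ^ Suc p *\<^sub>C z - (q ^ p *\<^sub>C (c + (q - ?r) *\<^sub>C z) + (l * ?r) *\<^sub>C y)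
      + (?r * q ^ Suc p) *\<^sub>C c - ?r *\<^sub>C (q ^ p *\<^sub>C z - l *\<^sub>C y)
      = (q ^ Suc p - q ^ p * (q - ?r) - ?r * q ^ p) *\<^sub>C z + (?r * q ^ Suc p - q ^ p) *\<^sub>C c"
      by (simp add: cscale_distribs algebra_simps)
    also have "q ^ Suc p - q ^ p * (q - ?r) - ?r * q ^ p = 0" by (simp add: algebra_simps)
    also have "?r * q ^ Suc p - q ^ p = 0" using q by simp
    finally show ?thesis by simp
  qed
  have "(T + ?r *\<^sub>C e) * (c * (q ^ Suc p *\<^sub>C e - k *\<^sub>C T) * c) = q ^ Suc p *\<^sub>C (T * c)
      - k *\<^sub>C (T * c * T * c) + (?r * q ^ Suc p) *\<^sub>C c - ?r *\<^sub>C (k *\<^sub>C (c * T * c))"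
  proof -
    have "c * (q ^ Suc p *\<^sub>C e - k *\<^sub>C T) * c = q ^ Suc p *\<^sub>C c - k *\<^sub>C (c * T * c)"
      by (simp add: right_diff_distrib left_diff_distrib unit idem)
    moreover have "e * (c * T * c) = c * T * c" using unit by (metis mult.assoc)
    ultimately show ?thesis
      by (simp add: unit algebra_simps cscale_add_right cscale_diff_right)
  qed
  then show "(T + ?r *\<^sub>C e) * (c * (q ^ Suc p *\<^sub>C e - k *\<^sub>C T) * c) = 0"
    unfolding X1(1) X2(1) collect .
  have "(c * (q ^ Suc p *\<^sub>C e - k *\<^sub>C T) * c) * (T + ?r *\<^sub>C e) = q ^ Suc p *\<^sub>C (c * T)
      - k *\<^sub>C (c * T * c * T) + (?r * q ^ Suc p) *\<^sub>C c - ?r *\<^sub>C (k *\<^sub>C (c * T * c))"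
  proof -
    have "c * (q ^ Suc p *\<^sub>C e - k *\<^sub>C T) * c = q ^ Suc p *\<^sub>C c - k *\<^sub>C (c * T * c)"
      by (simp add: right_diff_distrib left_diff_distrib unit idem)
    moreover have "c * T * c * e = c * T * c" using unit by (metis mult.assoc)
    ultimately show ?thesis
      by (simp add: unit algebra_simps cscale_add_right cscale_diff_right)
  qed
  then show "(c * (q ^ Suc p *\<^sub>C e - k *\<^sub>C T) * c) * (T + ?r *\<^sub>C e) = 0"
    unfolding X1(2) X2(2) collect .
qed

locale hecke_family = generic_parameter q for q +
  fixes e :: "'r::calgebra" and T :: "nat \<Rightarrow> 'r" and N :: nat
  assumes unit_idem [simp]: "e * e = e"
    and unit_T [simp]: "i \<in> {1..<N} \<Longrightarrow> e * T i = T i" "i \<in> {1..<N} \<Longrightarrow> T i * e = T i"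
    and quad: "i \<in> {1..<N} \<Longrightarrow> T i * T i = e + (q - inverse q) *\<^sub>C T i"
    and braid: "\<lbrakk>1 \<le> i; Suc i < N\<rbrakk> \<Longrightarrow> T i * T (Suc i) * T i = T (Suc i) * T i * T (Suc i)"
    and far_commute: "\<lbrakk>1 \<le> i; Suc i < j; j < N\<rbrakk> \<Longrightarrow> T i * T j = T j * T i"
begin

abbreviation "A m \<equiv> anti e T q m"

lemma anti_unit: "m \<le> N \<Longrightarrow> e * A m = A m \<and> A m * e = A m"
proof (induction m)
  case (Suc m)
  then have "e * A m = A m" "A m * e = A m" by auto
  then show ?case by (simp add: mult.assoc) (simp flip: mult.assoc)
qed simp

lemma anti_commutes: "(\<And>j. 1 \<le> j \<Longrightarrow> j < m \<Longrightarrow> commutes x (T j)) \<Longrightarrow> commutes x e \<Longrightarrow> commutes x (A m)"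
proof (induction m)
  case (Suc m)
  have "commutes x (qint q m *\<^sub>C T m)"
    using Suc.prems(1)[of m] by (cases "m = 0") (auto intro: commutes_cscale)
  with Suc show ?case by (auto intro!: commutes_intros)
qed simp

lemma anti_commute: "\<lbrakk>m < j; j < N\<rbrakk> \<Longrightarrow> T j * A m = A m * T j"
  using far_commute[of _ j] by (intro commutesD anti_commutes) (auto simp: commutes_def)

text \<open>Strong induction, since A_(p+2) is treated through both A_(p+1) and A_p. The eigenvalue
  property precedes idempotency: it evaluates the middle factor in the product of two copies of
  A_(p+2) as q^(p+1) + [p+1]/q, which is [p+2].\<close>

lemma anti_properties:
  assumes "m \<le> N"
  shows "A m * A m = A m \<and> (\<forall>i\<in>{1..<m}. T i * A m = (- inverse q) *\<^sub>C A m \<and> A m * T i = (- inverse q) *\<^sub>C A m)"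
  using assms
proof (induction m rule: less_induct)
  case (less m)
  show ?case
  proof (cases "m \<le> 1")
    case True
    then show ?thesis by (cases m) auto
  next
    case False
    then obtain p where m: "m = Suc (Suc p)" by (metis One_nat_def not0_implies_Suc not_less_eq_eq le0)
    define c where "c = A (Suc p)"
    define b where "b = A p"
    let ?k = "qint q (Suc p)" and ?T = "T (Suc p)" and ?r = "inverse q"
    let ?d = "c * (q ^ Suc p *\<^sub>C e - ?k *\<^sub>C ?T) * c"
    have Am: "A m = inverse (qint q m) *\<^sub>C ?d" by (simp add: m c_def)
    have k: "?k \<noteq> 0" "qint q m \<noteq> 0" by (auto intro!: qint_nonzero simp: m)
    have IH: "c * c = c" "\<And>i. i \<in> {1..<Suc p} \<Longrightarrow> T i * c = (- ?r) *\<^sub>C c"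
      "\<And>i. i \<in> {1..<Suc p} \<Longrightarrow> c * T i = (- ?r) *\<^sub>C c" "b * b = b"
      using less.IH[of "Suc p"] less.IH[of p] less.prems by (auto simp: m c_def b_def)
    have unit: "e * c = c" "c * e = c" "e * b = b" "b * e = b"
      using anti_unit[of "Suc p"] anti_unit[of p] less.prems by (auto simp: m c_def b_def)
    have c: "?k *\<^sub>C c = q ^ p *\<^sub>C b - qint q p *\<^sub>C (b * T p * b)"
      using k by (simp add: c_def b_def[symmetric] right_diff_distrib left_diff_distrib unit IH)
    have top: "(?T + ?r *\<^sub>C e) * ?d = 0 \<and> ?d * (?T + ?r *\<^sub>C e) = 0"
    \<comment> \<open>For p = 0 the element \<open>T p\<close> is \<open>T 0\<close>, about which
      nothing is assumed; then c = e and the claim is the quadratic relation itself.\<close>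
    proof (cases "p = 0")
      case True
      then have "c = e" by (simp add: c_def)
      moreover have "1 \<in> {1..<N}" using less.prems m by auto
      ultimately show ?thesis using True quad[of 1] unit_T[of 1]
        by (simp add: algebra_simps cscale_distribs)
    next
      case False
      have bc: "b * c = c" "c * b = c"
      proof -
        have "b * (?k *\<^sub>C c) = ?k *\<^sub>C c"
          unfolding c by (simp add: right_diff_distrib IH mult.assoc[symmetric])
        moreover have "(?k *\<^sub>C c) * b = ?k *\<^sub>C c"
          unfolding c by (simp add: left_diff_distrib IH mult.assoc)
        ultimately show "b * c = c" "c * b = c"
          using k by (auto dest: cscale_cancel)
      qed
      have p: "p \<in> {1..<Suc p}" "Suc p < N" using False less.prems m by auto
      have 1: "?T * b = b * ?T" unfolding b_def by (rule anti_commute) (use p in auto)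
      have 2: "?T * ?T = e + (q - ?r) *\<^sub>C ?T" by (rule quad) (use p in auto)
      have 3: "?T * T p * ?T = T p * ?T * T p" by (rule braid[symmetric]) (use p in auto)
      note step = anti_step[OF q_nonzero unit(1,2) IH(4,1) bc 1 IH(2)[OF p(1)] IH(3)[OF p(1)] 2 3 c]
      show ?thesis by (rule conjI[OF step])
    qed
    have top': "?T * A m = (- ?r) *\<^sub>C A m" "A m * ?T = (- ?r) *\<^sub>C A m"
    proof -
      have e: "e * ?d = ?d" "?d * e = ?d" using unit by (metis mult.assoc)+
      have "?T * ?d = (- ?r) *\<^sub>C ?d" "?d * ?T = (- ?r) *\<^sub>C ?d"
        using top by (auto simp only: distrib_left distrib_right mult_cscale_left mult_cscale_right e
          cscale_minus_left eq_neg_iff_add_eq_0)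
      then show "?T * A m = (- ?r) *\<^sub>C A m" "A m * ?T = (- ?r) *\<^sub>C A m"
        unfolding Am by (simp_all only: mult_cscale_left mult_cscale_right cscale_cscale mult.commute)
    qed
    have low: "T i * A m = (- ?r) *\<^sub>C A m \<and> A m * T i = (- ?r) *\<^sub>C A m" if "i \<in> {1..<Suc p}" for i
    proof
      have "T i * ?d = (T i * c) * ((q ^ Suc p *\<^sub>C e - ?k *\<^sub>C ?T) * c)" by (simp only: mult.assoc)
      then show "T i * A m = (- ?r) *\<^sub>C A m"
        unfolding Am IH(2)[OF that] by (simp add: mult.commute mult.assoc)
      have "?d * T i = (c * (q ^ Suc p *\<^sub>C e - ?k *\<^sub>C ?T)) * (c * T i)" by (simp only: mult.assoc)
      then show "A m * T i = (- ?r) *\<^sub>C A m"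
        unfolding Am IH(3)[OF that] by (simp add: mult.commute)
    qed
    have "A m * A m = A m"
    proof -
      have Amc: "A m * c = A m" "A m * e = A m"
        using IH(1) unit by (simp_all add: Am mult.assoc)
      have "A m * A m = inverse (qint q m) *\<^sub>C (((A m * c) * (q ^ Suc p *\<^sub>C e - ?k *\<^sub>C ?T)) * c)"
        unfolding Am[THEN arg_cong, of "\<lambda>x. A m * x"] by (simp add: mult.assoc)
      also have "\<dots> = inverse (qint q m) *\<^sub>C ((q ^ Suc p + ?r * ?k) *\<^sub>C A m)"
        by (simp only: Amc right_diff_distrib mult_cscale_right top' left_diff_distrib mult_cscale_left)
          (simp add: Amc cscale_distribs mult.commute)
      also have "q ^ Suc p + ?r * ?k = qint q m" by (simp only: m qint_Suc[of "Suc p"])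
      finally show ?thesis using k by simp
    qed
    moreover have "i = Suc p \<or> i \<in> {1..<Suc p}" if "i \<in> {1..<m}" for i using that m by auto
    ultimately show ?thesis using low top' by blast
  qed
qed

lemmas anti_idem = anti_properties[THEN conjunct1]

end

section \<open>The column idempotent of the presented Hecke algebra\<close>

primrec anti_poly :: "complex \<Rightarrow> nat \<Rightarrow> nat ncpoly" where
  "anti_poly q 0 = 1"
| "anti_poly q (Suc m) = nc_const (inverse (qint q (Suc m))) *
     (anti_poly q m * (nc_const (q ^ m) - nc_const (qint q m) * nc_gen m) * anti_poly q m)"

lemma nc_const_zero [simp]: "nc_const 0 = 0"
  by (simp add: nc_const_def)

context generic_parameter
begin

lemma anti_poly_closed: "k \<le> m \<Longrightarrow> anti_poly q k \<in> carrier (free_alg {1..<m})"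
proof (induction k)
  case (Suc k)
  have "nc_const (qint q k) * nc_gen k \<in> carrier (free_alg {1..<m})"
    using Suc.prems by (cases "k = 0") (simp_all add: free_alg_closed)
  with Suc show ?case by simp
qed simp

lemma ev_anti_poly:
  assumes "e * e = e" "\<And>g. e * t g = t g" "\<And>g. t g * e = t g"
  shows "ev e t (anti_poly q k) = anti e t q k"
proof -
  have unit: "e * anti e t q k = anti e t q k" for k
  proof (induction k)
    case (Suc k)
    then show ?case by (simp add: mult.assoc[symmetric])
  qed (simp add: assms)
  show ?thesis
    by (induction k) (simp_all add: ev_mult[OF assms(1,2)] ev_diff assms unit mult.assoc[symmetric])
qed

lemma hecke_rels_closed: "presentation {1..<m} (hecke_rels m q)"
  by unfold_locales (auto simp: hecke_rels_def)

text \<open>Translates the relations of the presentation into the equations of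
  \<open>hecke_family\<close>; \<open>hecke_family_ev_rel\<close> is the converse.\<close>

lemma hecke_familyI:
  assumes "e * e = e" "\<And>g. e * t g = t g" "\<And>g. t g * e = t g"
    and "\<And>r. r \<in> hecke_rels m q \<Longrightarrow> ev e t r = 0"
  shows "hecke_family q e t m"
proof
  note ev = ev_mult[OF assms(1,2)] ev_diff ev_add assms(1-3)
  show "t i * t i = e + (q - inverse q) *\<^sub>C t i" if "i \<in> {1..<m}" for i
  proof -
    have "ev e t ((nc_gen i - nc_const q) * (nc_gen i + nc_const (inverse q))) = 0"
      by (rule assms(4)) (use that in \<open>auto simp: hecke_rels_def\<close>)
    then show ?thesis
      by (simp add: ev algebra_simps cscale_distribs)
  qed
  show "t i * t (Suc i) * t i = t (Suc i) * t i * t (Suc i)" if "1 \<le> i" "Suc i < m" for i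
  proof -
    have "ev e t (nc_gen i * nc_gen (i + 1) * nc_gen i - nc_gen (i + 1) * nc_gen i * nc_gen (i + 1)) = 0"
      by (rule assms(4)) (use that in \<open>auto simp: hecke_rels_def\<close>)
    then show ?thesis by (simp add: ev)
  qed
  show "t i * t j = t j * t i" if "1 \<le> i" "Suc i < j" "j < m" for i j
  proof -
    have "ev e t (nc_gen i * nc_gen j - nc_gen j * nc_gen i) = 0"
      by (rule assms(4)) (use that in \<open>force simp: hecke_rels_def\<close>)
    then show ?thesis by (simp add: ev)
  qed
qed (simp_all add: assms)

lemma hecke_family_ev_rel:
  assumes "hecke_family q e t m" "\<And>g. e * t g = t g" "\<And>g. t g * e = t g" "r \<in> hecke_rels m q"
  shows "ev e t r = 0"
proof -
  interpret hecke_family q e t m by fact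
  note ev = ev_mult[OF unit_idem assms(2)] ev_diff ev_add assms(2,3) unit_idem
  consider i where "i \<in> {1..<m}" "r = (nc_gen i - nc_const q) * (nc_gen i + nc_const (inverse q))"
    | i where "i \<in> {1..<m}" "i + 1 \<in> {1..<m}"
        "r = nc_gen i * nc_gen (i + 1) * nc_gen i - nc_gen (i + 1) * nc_gen i * nc_gen (i + 1)"
    | i j where "i \<in> {1..<m}" "j \<in> {1..<m}" "\<bar>int i - int j\<bar> > 1" "r = nc_gen i * nc_gen j - nc_gen j * nc_gen i"
    using assms(4) unfolding hecke_rels_def by blast
  then show ?thesis
  proof cases
    case 1
    show ?thesis
      unfolding 1(2) using quad[OF 1(1)] by (simp add: ev algebra_simps cscale_distribs)
  next
    case 2
    show ?thesis
      unfolding 2(3) using braid[of i] 2(1,2) by (simp add: ev)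
  next
    case 3
    then have "Suc i < j \<or> Suc j < i" by auto
    then show ?thesis
      using 3 far_commute[of i j] far_commute[of j i] by (auto simp: ev)
  qed
qed

text \<open>The one-dimensional representation with all generators sent to -1/q: this number is a
  root of the quadratic relation, and the other relations hold since the images are equal.\<close>

lemma hecke_family_character: "hecke_family q (1::complex) (\<lambda>g. - inverse q) m"
  by unfold_locales (auto simp: cscale_complex_def algebra_simps)

text \<open>In this representation the recursion reduces to [k+1] = q^k + [k]/q. The nonzero value
  shows that the class of \<open>anti_poly\<close> is not zero in the quotient.\<close>

lemma anti_character: "anti (1::complex) (\<lambda>g. - inverse q) q k = 1"
proof (induction k)
  case (Suc k)
  have "anti (1::complex) (\<lambda>g. - inverse q) q (Suc k) = inverse (qint q (Suc k)) * (q ^ k + inverse q * qint q k)"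
    using Suc by (simp add: cscale_complex_def algebra_simps)
  also have "\<dots> = 1"
    using qint_nonzero[of "Suc k"] by (simp add: qint_Suc[symmetric])
  finally show ?case .
qed simp

text \<open>The definite description is resolved by exhibiting the class of \<open>anti_poly\<close>
  and proving uniqueness. Since \<open>emb\<close> is injective, the defining equations can be read
  off from \<open>anti_properties\<close> for the operators that represent the generators.\<close>

lemma column_idem_eq:
  "column_idem m q = pres_class {1..<m} (hecke_rels m q) (anti_poly q m)"
proof -
  define S where "S = {1..<m}"
  interpret H: presentation S "hecke_rels m q" unfolding S_def by (rule hecke_rels_closed)
  have hecke_alg: "hecke_alg m q = H.Q" and hecke_T: "hecke_T m q = (\<lambda>k. H.cls (nc_gen k))"
    by (simp_all only: hecke_alg_def hecke_T_def fun_eq_iff S_def simp_thms)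
  interpret em: alg_map H.Q "emb H.Q" by (rule H.emb_alg_map)
  let ?e = "emb H.Q \<one>\<^bsub>H.Q\<^esub>"
  let ?t = "\<lambda>g. if g \<in> S then emb H.Q (H.cls (nc_gen g)) else 0"
  have ev: "emb H.Q (H.cls f) = ev ?e ?t f" if "f \<in> carrier H.F" for f
    by (rule H.map_cls) (use that H.emb_alg_map in auto)
  have unit: "?e * ?e = ?e" "?e * ?t g = ?t g" "?t g * ?e = ?t g" for g
    by (simp_all add: em.map_one_left em.map_one_right)
  have fam: "hecke_family q ?e ?t m"
  proof (rule hecke_familyI[OF unit])
    fix r assume "r \<in> hecke_rels m q"
    then have "r \<in> carrier H.F" "H.cls r = \<zero>\<^bsub>H.Q\<^esub>" using H.rels H.cls_rel by auto
    then show "ev ?e ?t r = 0" using ev[of r] by simp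
  qed
  then interpret hecke_family q ?e ?t m .
  define a where "a = H.cls (anti_poly q m)"
  have poly: "anti_poly q m \<in> carrier H.F" unfolding S_def by (rule anti_poly_closed) simp
  have emb_a: "emb H.Q a = anti ?e ?t q m"
    unfolding a_def ev[OF poly] by (rule ev_anti_poly[OF unit])
  define is_idem where "is_idem x \<longleftrightarrow> x \<in> carrier H.Q \<and> x \<noteq> \<zero>\<^bsub>H.Q\<^esub> \<and> x \<otimes>\<^bsub>H.Q\<^esub> x = x \<and>
    (\<forall>k \<in> S. H.cls (nc_gen k) \<otimes>\<^bsub>H.Q\<^esub> x = (- inverse q) \<odot>\<^bsub>H.Q\<^esub> x \<and>
      x \<otimes>\<^bsub>H.Q\<^esub> H.cls (nc_gen k) = (- inverse q) \<odot>\<^bsub>H.Q\<^esub> x)" for x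
  have a: "is_idem a"
    unfolding is_idem_def
  proof (intro conjI ballI)
    show cl: "a \<in> carrier H.Q" by (simp add: a_def poly)
    show "a \<noteq> \<zero>\<^bsub>H.Q\<^esub>"
    proof
      assume "a = \<zero>\<^bsub>H.Q\<^esub>"
      then have "anti_poly q m \<in> H.J" using H.cls_eq_zero_iff[OF poly] by (simp add: a_def)
      then have "ev (1::complex) (\<lambda>g. - inverse q) (anti_poly q m) = 0"
        by (rule H.ev_ideal[rotated 3]) (auto intro: hecke_family_ev_rel[OF hecke_family_character])
      then show False by (simp add: ev_anti_poly anti_character)
    qed
    show "a \<otimes>\<^bsub>H.Q\<^esub> a = a"
      by (rule H.emb_inj) (simp_all add: cl em.map_mult emb_a anti_idem)
    fix k assume k: "k \<in> S"
    then have tk: "?t k = emb H.Q (H.cls (nc_gen k))" "H.cls (nc_gen k) \<in> carrier H.Q" by auto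
    have ab: "?t k * anti ?e ?t q m = (- inverse q) *\<^sub>C anti ?e ?t q m \<and>
        anti ?e ?t q m * ?t k = (- inverse q) *\<^sub>C anti ?e ?t q m"
      using anti_properties[OF order_refl, THEN conjunct2, rule_format, OF k[unfolded S_def]] .
    note ab = ab[THEN conjunct1, unfolded tk(1)] ab[THEN conjunct2, unfolded tk(1)]
    show "H.cls (nc_gen k) \<otimes>\<^bsub>H.Q\<^esub> a = (- inverse q) \<odot>\<^bsub>H.Q\<^esub> a"
      by (rule H.emb_inj) (simp_all only: cl tk(2) H.m_closed H.smult_closed em.map_mult em.map_smult emb_a ab)
    show "a \<otimes>\<^bsub>H.Q\<^esub> H.cls (nc_gen k) = (- inverse q) \<odot>\<^bsub>H.Q\<^esub> a"
      by (rule H.emb_inj) (simp_all only: cl tk(2) H.m_closed H.smult_closed em.map_mult em.map_smult emb_a ab)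
  qed
  \<comment> \<open>An element with the properties of the idempotent is multiplied by every \<open>x\<close> through the
    character sending all generators to \<open>-1/q\<close>.\<close>
  have char: "\<exists>c. \<forall>y. is_idem y \<longrightarrow> x \<otimes>\<^bsub>H.Q\<^esub> y = c \<odot>\<^bsub>H.Q\<^esub> y \<and> y \<otimes>\<^bsub>H.Q\<^esub> x = c \<odot>\<^bsub>H.Q\<^esub> y"
    if "x \<in> carrier H.Q" for x
  proof -
    obtain f where f: "x = H.cls f" "f \<in> carrier H.F" using \<open>x \<in> carrier H.Q\<close> by (auto simp: H.carrier_Q)
    \<comment> \<open>The value of the character at \<open>f\<close>; it is chosen before the
      candidate \<open>y\<close> and serves all candidates.\<close>
    let ?c = "\<Sum>w\<in>Poly_Mapping.keys f. Poly_Mapping.lookup f w * (- inverse q) ^ length (letters w)"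
    show ?thesis
    proof (intro exI allI impI)
      fix y assume y: "is_idem y"
      let ?y = "emb H.Q y"
      have cl: "y \<in> carrier H.Q" using y by (simp add: is_idem_def)
      have ty: "?t g * ?y = (- inverse q) *\<^sub>C ?y" "?y * ?t g = (- inverse q) *\<^sub>C ?y" if "g \<in> S" for g
      proof -
        have "H.cls (nc_gen g) \<otimes>\<^bsub>H.Q\<^esub> y = (- inverse q) \<odot>\<^bsub>H.Q\<^esub> y"
          "y \<otimes>\<^bsub>H.Q\<^esub> H.cls (nc_gen g) = (- inverse q) \<odot>\<^bsub>H.Q\<^esub> y"
          using y that by (auto simp: is_idem_def)
        from this[THEN arg_cong, of "emb H.Q"] show "?t g * ?y = (- inverse q) *\<^sub>C ?y" "?y * ?t g = (- inverse q) *\<^sub>C ?y"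
          using that by (simp_all only: if_True em.map_mult em.map_smult cl H.cls_closed free_alg_closed)
      qed
      have word: "word_eval ?e ?t w * ?y = (- inverse q) ^ length w *\<^sub>C ?y \<and>
          ?y * word_eval ?e ?t w = (- inverse q) ^ length w *\<^sub>C ?y" if "set w \<subseteq> S" for w
        using that
      proof (induction w)
        case Nil
        then show ?case using em.map_one_left em.map_one_right cl by simp
      next
        case (Cons g w)
        then have g: "g \<in> S"
          and IH: "word_eval ?e ?t w * ?y = (- inverse q) ^ length w *\<^sub>C ?y"
            "?y * word_eval ?e ?t w = (- inverse q) ^ length w *\<^sub>C ?y" by auto
        have "word_eval ?e ?t (g # w) * ?y = ?t g * (word_eval ?e ?t w * ?y)"
          "?y * word_eval ?e ?t (g # w) = (?y * ?t g) * word_eval ?e ?t w"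
          by (simp_all only: word_eval_simps mult.assoc)
        then show ?case
          by (simp only: IH ty[OF g] mult_cscale_left mult_cscale_right cscale_cscale
            power_Suc list.size mult.commute simp_thms add_Suc_right add_0_right)
      qed
      have "emb H.Q x * ?y = ?c *\<^sub>C ?y" "?y * emb H.Q x = ?c *\<^sub>C ?y"
        using f(2) unfolding f(1) ev[OF f(2)] ev_def
        by (auto simp: sum_distrib_right sum_distrib_left cscale_sum_left in_free_alg word simp del: power_minus
            intro!: sum.cong)
      then show "x \<otimes>\<^bsub>H.Q\<^esub> y = ?c \<odot>\<^bsub>H.Q\<^esub> y \<and> y \<otimes>\<^bsub>H.Q\<^esub> x = ?c \<odot>\<^bsub>H.Q\<^esub> y"
        using cl \<open>x \<in> carrier H.Q\<close>
        by (intro conjI H.emb_inj H.m_closed H.smult_closed) (simp_all only: em.map_mult em.map_smult)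
    qed
  qed
  \<comment> \<open>Each of the two elements acts on both by a scalar, and idempotency makes these
    scalars 1; the product of \<open>x\<close> and \<open>y\<close> then equals both of
    them.\<close>
  have unique: "x = y" if x: "is_idem x" and y: "is_idem y" for x y
  proof -
    have cl: "x \<in> carrier H.Q" "y \<in> carrier H.Q" using x y by (auto simp: is_idem_def)
    obtain c where c: "\<And>z. is_idem z \<Longrightarrow> x \<otimes>\<^bsub>H.Q\<^esub> z = c \<odot>\<^bsub>H.Q\<^esub> z \<and> z \<otimes>\<^bsub>H.Q\<^esub> x = c \<odot>\<^bsub>H.Q\<^esub> z"
      using char[OF cl(1)] by blast
    obtain d where d: "\<And>z. is_idem z \<Longrightarrow> y \<otimes>\<^bsub>H.Q\<^esub> z = d \<odot>\<^bsub>H.Q\<^esub> z \<and> z \<otimes>\<^bsub>H.Q\<^esub> y = d \<odot>\<^bsub>H.Q\<^esub> z"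
      using char[OF cl(2)] by blast
    have one: "c = 1" if "z \<in> carrier H.Q" "z \<noteq> \<zero>\<^bsub>H.Q\<^esub>" "z = c \<odot>\<^bsub>H.Q\<^esub> z" for z c
    proof -
      have "emb H.Q z \<noteq> 0" using that H.emb_inj[of z "\<zero>\<^bsub>H.Q\<^esub>"] by auto
      moreover have "emb H.Q z = c *\<^sub>C emb H.Q z" using that em.map_smult by metis
      then have "(c - 1) *\<^sub>C emb H.Q z = 0" by (simp add: cscale_diff_left)
      ultimately show ?thesis by (simp add: cscale_eq_0_iff)
    qed
    have "c = 1" by (rule one[of x]) (use x c[OF x] in \<open>auto simp: is_idem_def\<close>)
    moreover have "d = 1" by (rule one[of y]) (use y d[OF y] in \<open>auto simp: is_idem_def\<close>)
    ultimately have "y = x \<otimes>\<^bsub>H.Q\<^esub> y" "x \<otimes>\<^bsub>H.Q\<^esub> y = x"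
      using c[OF y] d[OF x] cl by auto
    then show ?thesis by simp
  qed
  have "column_idem m q = (THE x. is_idem x)"
    unfolding column_idem_def Let_def hecke_alg hecke_T is_idem_def S_def ..
  also have "\<dots> = a"
    using a unique by (intro the_equality) auto
  finally show ?thesis by (simp only: a_def S_def)
qed

end

subsection \<open>Commuting families of matrix units\<close>

lemma sum_sum_delta:
  fixes f :: "'i \<Rightarrow> 'j \<Rightarrow> 'a::comm_monoid_add"
  assumes "finite I" "finite J" "a \<in> I" "b \<in> J"
  shows "(\<Sum>i\<in>I. \<Sum>j\<in>J. if i = a \<and> j = b then f i j else 0) = f a b"
proof -
  have "(\<Sum>j\<in>J. if i = a \<and> j = b then f i j else 0) = (if i = a then f a b else 0)" for i
    using assms by (cases "i = a") (simp_all add: sum.delta)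
  then show ?thesis using assms by (simp add: sum.delta)
qed

text \<open>
  \<open>E k a b\<close> is the matrix unit \<open>e\<^sub>a\<^sub>b\<close> in the \<open>k\<close>-th tensor factor, for infinitely many factors at once,
  so that all tensor powers are treated in a single algebra.
\<close>

locale tensor_units = generic_parameter q for q +
  fixes n :: nat and E :: "nat \<Rightarrow> nat \<Rightarrow> nat \<Rightarrow> 'r::calgebra" and e :: 'r
  assumes n_pos: "n \<ge> 1"
    and e_idem [simp]: "e * e = e"
    and unit_E [simp]: "e * E k a b = E k a b" "E k a b * e = E k a b"
    and E_mult: "E k a b * E k c d = (if b = c \<and> b \<in> {1..n} then E k a d else 0)"
    and E_outside: "a \<notin> {1..n} \<or> b \<notin> {1..n} \<Longrightarrow> E k a b = 0"
    and E_sum: "(\<Sum>a\<in>{1..n}. E k a a) = e"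
    and E_commute: "k \<noteq> l \<Longrightarrow> E k a b * E l c d = E l c d * E k a b"
begin

definition I where "I = {1..n}"

lemma finite_I [simp]: "finite I" by (simp add: I_def)

lemma one_in_I [simp]: "Suc 0 \<in> I" using n_pos by (simp add: I_def)

lemma E_mult' [simp]: "E k a b * E k c d = (if b = c \<and> b \<in> I then E k a d else 0)"
  unfolding I_def by (rule E_mult)

lemma sum_E: "(\<Sum>a\<in>I. E k a a) = e"
  unfolding I_def by (rule E_sum)

text \<open>Triviality in the \<open>k\<close>-th tensor factor, expressed through the matrix units
  there.\<close>

definition free :: "nat \<Rightarrow> 'r \<Rightarrow> bool" where
  "free k X \<longleftrightarrow> (\<forall>a b. commutes (E k a b) X)"

text \<open>Membership in the corner e R e, which takes the place of the unit laws.\<close>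

definition cor :: "'r \<Rightarrow> bool" where
  "cor X \<longleftrightarrow> e * X = X \<and> X * e = X"

lemma corD [simp]: "cor X \<Longrightarrow> e * X = X" "cor X \<Longrightarrow> X * e = X"
  by (simp_all add: cor_def)

lemma corI: "e * X = X \<Longrightarrow> X * e = X \<Longrightarrow> cor X"
  unfolding cor_def by blast

lemma cor_E [simp]: "cor (E k a b)" and cor_e [simp]: "cor e"
  by (simp_all add: cor_def del: corD)

lemma cor_mult [intro, simp]: "cor X \<Longrightarrow> cor Y \<Longrightarrow> cor (X * Y)"
  unfolding cor_def by (metis mult.assoc)

lemma cor_add [intro, simp]: "cor X \<Longrightarrow> cor Y \<Longrightarrow> cor (X + Y)"
  and cor_diff [intro, simp]: "cor X \<Longrightarrow> cor Y \<Longrightarrow> cor (X - Y)"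
  and cor_cscale [intro, simp]: "cor X \<Longrightarrow> cor (c *\<^sub>C X)"
  and cor_zero [simp]: "cor 0"
  by (simp_all add: cor_def distrib_left distrib_right left_diff_distrib right_diff_distrib del: corD)

lemma cor_sum [intro, simp]: "(\<And>i. i \<in> J \<Longrightarrow> cor (f i)) \<Longrightarrow> cor (\<Sum>i\<in>J. f i)"
  by (induction J rule: infinite_finite_induct) auto

lemma free_mult [intro]: "free k X \<Longrightarrow> free k Y \<Longrightarrow> free k (X * Y)"
  and free_add [intro]: "free k X \<Longrightarrow> free k Y \<Longrightarrow> free k (X + Y)"
  and free_diff [intro]: "free k X \<Longrightarrow> free k Y \<Longrightarrow> free k (X - Y)"
  and free_cscale [intro]: "free k X \<Longrightarrow> free k (c *\<^sub>C X)"
  and free_sum [intro]: "(\<And>i. i \<in> J \<Longrightarrow> free k (f i)) \<Longrightarrow> free k (\<Sum>i\<in>J. f i)"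
  by (auto simp: free_def intro!: commutes_intros)

lemma free_e [simp]: "free k e"
  by (simp add: free_def commutes_def)

lemma free_E [intro]: "k \<noteq> l \<Longrightarrow> free k (E l a b)"
  by (simp add: free_def commutes_def E_commute)

lemma freeD: "free k X \<Longrightarrow> X * E k a b = E k a b * X"
  by (simp add: free_def commutes_def)

section \<open>Partial q-traces\<close>

definition weight :: "nat \<Rightarrow> complex" where
  "weight a = q powi (2 - 2 * int a)"

lemma weight_nonzero [simp]: "weight a \<noteq> 0"
  by (simp add: weight_def)

text \<open>Consecutive entries of D differ by the factor q^2, so sums of weights multiplied by q -
  1/q, the off-diagonal coefficient of R, telescope.\<close>

lemma weight_step: "(q - inverse q) * weight a = q * (weight a - weight (Suc a))"
proof -
  have "q powi (2 - 2 * int a) = q powi (2 - 2 * int (Suc a)) * (q * q)"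
  proof -
    have "2 - 2 * int a = (2 - 2 * int (Suc a)) + 2" by simp
    then have "q powi (2 - 2 * int a) = q powi (2 - 2 * int (Suc a)) * q powi 2"
      using power_int_add[of q "2 - 2 * int (Suc a)" 2] by simp
    then show ?thesis by (simp add: power2_eq_square)
  qed
  then show ?thesis
    by (simp add: weight_def algebra_simps)
qed

text \<open>The sum over \<open>b\<close> is the trace of the \<open>k\<close>-th factor against D;
  the sum over \<open>a\<close> spreads the result along the diagonal of that factor, so that the
  trace remains an operator on the same space and is trivial in the factor \<open>k\<close>.\<close>

definition ptr :: "nat \<Rightarrow> 'r \<Rightarrow> 'r" where
  "ptr k X = (\<Sum>a\<in>I. \<Sum>b\<in>I. weight b *\<^sub>C (E k a b * X * E k b a))"

lemma ptr_add: "ptr k (X + Y) = ptr k X + ptr k Y"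
  and ptr_diff: "ptr k (X - Y) = ptr k X - ptr k Y"
  and ptr_cscale [simp]: "ptr k (c *\<^sub>C X) = c *\<^sub>C ptr k X"
  by (simp_all add: ptr_def algebra_simps cscale_distribs sum.distrib sum_subtractf cscale_sum_right)

lemma ptr_zero [simp]: "ptr k 0 = 0"
  by (simp add: ptr_def)

lemma ptr_sum: "ptr k (\<Sum>i\<in>J. f i) = (\<Sum>i\<in>J. ptr k (f i))"
  by (induction J rule: infinite_finite_induct) (simp_all add: ptr_add)

lemma ptr_left: "free k Y \<Longrightarrow> ptr k (Y * X) = Y * ptr k X"
  unfolding ptr_def sum_distrib_left
  by (intro sum.cong refl) (simp add: mult.assoc[symmetric] freeD)

lemma ptr_right: "free k Y \<Longrightarrow> ptr k (X * Y) = ptr k X * Y"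
  unfolding ptr_def sum_distrib_right
  by (intro sum.cong refl) (simp add: mult.assoc freeD)

lemma cor_ptr [simp]: "cor (ptr k X)"
  unfolding ptr_def by (intro cor_sum cor_cscale corI) (simp_all only: mult_cscale_left mult_cscale_right mult.assoc unit_E, simp_all only: mult.assoc[symmetric] unit_E)

lemma free_ptr: "free k (ptr k X)"
  unfolding free_def commutes_def
proof (intro allI)
  fix c d
  show "E k c d * ptr k X = ptr k X * E k c d"
  proof (cases "c \<in> I \<and> d \<in> I")
    case True
    have "E k c d * ptr k X = (\<Sum>a\<in>I. if a = d then \<Sum>b\<in>I. weight b *\<^sub>C (E k c b * X * E k b a) else 0)"
      unfolding ptr_def sum_distrib_left
      using True by (intro sum.cong refl) (auto simp: mult.assoc[symmetric])
    moreover have "ptr k X * E k c d = (\<Sum>a\<in>I. if a = c then \<Sum>b\<in>I. weight b *\<^sub>C (E k a b * X * E k b d) else 0)"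
      unfolding ptr_def sum_distrib_right
      using True by (intro sum.cong refl) (auto simp: mult.assoc)
    ultimately show ?thesis using True by (simp add: sum.delta)
  next
    case False
    then show ?thesis using E_outside[of c d k] by (auto simp: I_def)
  qed
qed

lemma free_ptr_other: "l \<noteq> k \<Longrightarrow> free l X \<Longrightarrow> free l (ptr k X)"
  unfolding ptr_def by (intro free_sum free_cscale free_mult free_E) auto

lemma ptr_E: "ptr k (E k a b) = (if a = b \<and> a \<in> I then weight a *\<^sub>C e else 0)"
proof (cases "a \<in> I \<and> b \<in> I")
  case True
  have "ptr k (E k a b) = (\<Sum>c\<in>I. \<Sum>d\<in>I. if d = a then (if a = b then weight a *\<^sub>C E k c c else 0) else 0)"
    unfolding ptr_def using True by (intro sum.cong refl) auto
  also have "\<dots> = (\<Sum>c\<in>I. if a = b then weight a *\<^sub>C E k c c else 0)"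
    using True by (simp add: sum.delta)
  also have "\<dots> = (if a = b then weight a *\<^sub>C e else 0)"
    by (simp add: sum_E cscale_sum_right[symmetric])
  finally show ?thesis using True by simp
next
  case False
  then have "E k a b = 0" by (intro E_outside) (auto simp: I_def)
  then show ?thesis using False by auto
qed

lemma ptr_E_times: "free k X \<Longrightarrow> cor X \<Longrightarrow> ptr k (X * E k a b) = (if a = b \<and> a \<in> I then weight a *\<^sub>C X else 0)"
  by (auto simp: ptr_left ptr_E)

text \<open>The coefficient of the matrix unit \<open>E k a b\<close> in \<open>X\<close>, again
  spread along the diagonal of the factor \<open>k\<close>; \<open>expand_coef\<close> recovers
  \<open>X\<close> from these coefficients.\<close>

definition coef :: "nat \<Rightarrow> nat \<Rightarrow> nat \<Rightarrow> 'r \<Rightarrow> 'r" where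
  "coef k a b X = (\<Sum>c\<in>I. E k c a * X * E k b c)"

lemma free_coef: "free k (coef k a b X)"
  unfolding free_def commutes_def
proof (intro allI)
  fix c d
  show "E k c d * coef k a b X = coef k a b X * E k c d"
  proof (cases "c \<in> I \<and> d \<in> I")
    case True
    have "E k c d * coef k a b X = (\<Sum>x\<in>I. if x = d then E k c a * X * E k b x else 0)"
      unfolding coef_def sum_distrib_left
      using True by (intro sum.cong refl) (auto simp: mult.assoc[symmetric])
    moreover have "coef k a b X * E k c d = (\<Sum>x\<in>I. if x = c then E k x a * X * E k b d else 0)"
      unfolding coef_def sum_distrib_right
      using True by (intro sum.cong refl) (auto simp: mult.assoc)
    ultimately show ?thesis using True by (simp add: sum.delta)
  next
    case False
    then show ?thesis using E_outside[of c d k] by (auto simp: I_def)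
  qed
qed

lemma free_coef_other: "l \<noteq> k \<Longrightarrow> free l X \<Longrightarrow> free l (coef k a b X)"
  unfolding coef_def by (intro free_sum free_mult free_E) auto

lemma expand_coef:
  assumes "cor X"
  shows "X = (\<Sum>a\<in>I. \<Sum>b\<in>I. E k a b * coef k a b X)"
proof -
  have "E k a b * coef k a b X = E k a a * X * E k b b" if "a \<in> I" "b \<in> I" for a b
  proof -
    have "E k a b * coef k a b X = (\<Sum>c\<in>I. if c = b then E k a a * X * E k b b else 0)"
      unfolding coef_def sum_distrib_left using that by (intro sum.cong refl) (auto simp: mult.assoc[symmetric])
    then show ?thesis using that by (simp add: sum.delta)
  qed
  then have "(\<Sum>a\<in>I. \<Sum>b\<in>I. E k a b * coef k a b X) = (\<Sum>a\<in>I. \<Sum>b\<in>I. E k a a * X * E k b b)"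
    by simp
  also have "\<dots> = e * X * e"
    by (simp add: sum_E[of k, symmetric] sum_distrib_left sum_distrib_right) (rule sum.swap)
  finally show ?thesis using assms by simp
qed

subsection \<open>Operators of R-matrix type\<close>

text \<open>The operator sending e_i (x) e_j to c_ij e_i (x) e_j + d_ij e_j (x) e_i in the factors
  \<open>k\<close> and \<open>k + 1\<close>. R, the braid operator P R, the inverse of the latter
  and P are all of this kind, so traces and conjugations are computed once for arbitrary
  coefficients.\<close>

definition Smat :: "nat \<Rightarrow> (nat \<Rightarrow> nat \<Rightarrow> complex) \<Rightarrow> (nat \<Rightarrow> nat \<Rightarrow> complex) \<Rightarrow> 'r" where
  "Smat k c d = (\<Sum>i\<in>I. \<Sum>j\<in>I. c i j *\<^sub>C (E k i i * E (Suc k) j j) + d i j *\<^sub>C (E k j i * E (Suc k) i j))"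

lemma cor_Smat [simp]: "cor (Smat k c d)"
  unfolding Smat_def by simp

lemma commutes_Smat: "free k X \<Longrightarrow> free (Suc k) X \<Longrightarrow> commutes X (Smat k c d)"
  unfolding Smat_def by (intro commutes_intros) (auto simp: free_def intro: commutes_sym)

lemma free_Smat: "l \<noteq> k \<Longrightarrow> l \<noteq> Suc k \<Longrightarrow> free l (Smat k c d)"
  unfolding Smat_def by (intro free_sum free_add free_cscale free_mult free_E) auto

lemma EE_mult: "(E k a b * E (Suc k) c d) * (E k a' b' * E (Suc k) c' d')
    = (if b = a' \<and> b \<in> I \<and> d = c' \<and> d \<in> I then E k a b' * E (Suc k) c d' else 0)"
proof -
  have "(E k a b * E (Suc k) c d) * (E k a' b' * E (Suc k) c' d')
    = E k a b * (E (Suc k) c d * E k a' b') * E (Suc k) c' d'" by (simp only: mult.assoc)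
  also have "E (Suc k) c d * E k a' b' = E k a' b' * E (Suc k) c d" by (rule E_commute) simp
  also have "E k a b * (E k a' b' * E (Suc k) c d) * E (Suc k) c' d'
    = (E k a b * E k a' b') * (E (Suc k) c d * E (Suc k) c' d')" by (simp only: mult.assoc)
  finally show ?thesis by auto
qed

lemma Smat_EE:
  assumes "a \<in> I" "y \<in> I"
  shows "Smat k c d * (E k a x * E (Suc k) y z)
    = c a y *\<^sub>C (E k a x * E (Suc k) y z) + d a y *\<^sub>C (E k y x * E (Suc k) a z)"
proof -
  have "Smat k c d * (E k a x * E (Suc k) y z) = (\<Sum>i\<in>I. \<Sum>j\<in>I. if i = a \<and> j = y
      then c a y *\<^sub>C (E k a x * E (Suc k) y z) + d a y *\<^sub>C (E k y x * E (Suc k) a z) else 0)"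
    unfolding Smat_def sum_distrib_right by (intro sum.cong refl) (auto simp: distrib_right EE_mult)
  then show ?thesis using assms by (simp add: sum_sum_delta)
qed

lemma EE_Smat:
  assumes "b \<in> I" "j \<in> I"
  shows "(E k x b * E (Suc k) y j) * Smat k c d
    = c b j *\<^sub>C (E k x b * E (Suc k) y j) + d j b *\<^sub>C (E k x j * E (Suc k) y b)"
proof -
  let ?c = "\<lambda>i l. if i = b \<and> l = j then c b j *\<^sub>C (E k x b * E (Suc k) y j) else 0"
  let ?d = "\<lambda>i l. if i = j \<and> l = b then d j b *\<^sub>C (E k x j * E (Suc k) y b) else 0"
  have 1: "E k x b * E (Suc k) y j * (E k i i * E (Suc k) l l)
      = (if i = b \<and> l = j then E k x b * E (Suc k) y j else 0)" for i l
    unfolding EE_mult using assms by (cases "i = b"; cases "l = j"; simp)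
  have 2: "E k x b * E (Suc k) y j * (E k l i * E (Suc k) i l)
      = (if i = j \<and> l = b then E k x j * E (Suc k) y b else 0)" for i l
    unfolding EE_mult using assms by (cases "i = j"; cases "l = b"; simp)
  have "E k x b * E (Suc k) y j * (c i l *\<^sub>C (E k i i * E (Suc k) l l) + d i l *\<^sub>C (E k l i * E (Suc k) i l))
      = ?c i l + ?d i l" for i l
    unfolding distrib_left mult_cscale_right 1 2 by (intro arg_cong2[where f = "(+)"]) (simp_all split: if_splits)
  then have "(E k x b * E (Suc k) y j) * Smat k c d = (\<Sum>i\<in>I. \<Sum>l\<in>I. ?c i l + ?d i l)"
    by (simp only: Smat_def sum_distrib_left)
  also have "\<dots> = (\<Sum>i\<in>I. \<Sum>l\<in>I. ?c i l) + (\<Sum>i\<in>I. \<Sum>l\<in>I. ?d i l)"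
    by (simp only: sum.distrib)
  finally show ?thesis using assms by (simp add: sum_sum_delta)
qed

lemma ptr_Smat_conj:
  assumes ab: "a \<in> I" "b \<in> I"
  shows "ptr (Suc k) (Smat k c d * E k a b * Smat k c' d')
    = (if a = b then weight a *\<^sub>C (\<Sum>y\<in>I. (d a y * d' y a) *\<^sub>C E k y y) else 0)
      + (weight a * d a a * c' b a + weight b * c a b * d' b b + (\<Sum>y\<in>I. weight y * c a y * c' b y)) *\<^sub>C E k a b"
proof -
  let ?E' = "E (Suc k)"
  \<comment> \<open>A resolution of the identity in the factor \<open>k + 1\<close> makes
    \<open>Smat_EE\<close> and \<open>EE_Smat\<close> applicable. Among the resulting terms, those
    with a diagonal unit in that factor survive the trace.\<close>
  have "(\<Sum>y\<in>I. E k a b * ?E' y y) = E k a b"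
    by (simp add: sum_distrib_left[symmetric] sum_E)
  then have "Smat k c d * E k a b * Smat k c' d' = Smat k c d * (\<Sum>y\<in>I. E k a b * ?E' y y) * Smat k c' d'"
    by (simp only:)
  also have "\<dots> = (\<Sum>y\<in>I. Smat k c d * (E k a b * ?E' y y) * Smat k c' d')"
    by (simp only: sum_distrib_left sum_distrib_right)
  also have "\<dots> = (\<Sum>y\<in>I.
      (c a y * c' b y) *\<^sub>C (E k a b * ?E' y y) + (c a y * d' y b) *\<^sub>C (E k a y * ?E' y b)
      + ((d a y * c' b y) *\<^sub>C (E k y b * ?E' a y) + (d a y * d' y b) *\<^sub>C (E k y y * ?E' a b)))"
    using ab by (intro sum.cong refl)
      (simp add: Smat_EE distrib_right EE_Smat cscale_add_right del: mult_cscale_right)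
  finally have "ptr (Suc k) (Smat k c d * E k a b * Smat k c' d') = ptr (Suc k) \<dots>"
    by (rule arg_cong)
  also have "\<dots> = (\<Sum>y\<in>I.
      (c a y * c' b y) *\<^sub>C weight y *\<^sub>C E k a b + (if y = b then (c a b * d' b b) *\<^sub>C weight b *\<^sub>C E k a b else 0)
      + ((if y = a then (d a a * c' b a) *\<^sub>C weight a *\<^sub>C E k a b else 0)
      + (if a = b then (d a y * d' y a) *\<^sub>C weight a *\<^sub>C E k y y else 0)))"
    unfolding ptr_sum
  proof (intro sum.cong refl)
    fix y assume y: "y \<in> I"
    have P: "ptr (Suc k) (E k x z * ?E' u v) = (if u = v \<and> u \<in> I then weight u *\<^sub>C E k x z else 0)" for x z u v
      by (rule ptr_E_times) (auto intro: free_E)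
    show "ptr (Suc k) ((c a y * c' b y) *\<^sub>C (E k a b * ?E' y y) + (c a y * d' y b) *\<^sub>C (E k a y * ?E' y b)
      + ((d a y * c' b y) *\<^sub>C (E k y b * ?E' a y) + (d a y * d' y b) *\<^sub>C (E k y y * ?E' a b)))
      = (c a y * c' b y) *\<^sub>C weight y *\<^sub>C E k a b + (if y = b then (c a b * d' b b) *\<^sub>C weight b *\<^sub>C E k a b else 0)
      + ((if y = a then (d a a * c' b a) *\<^sub>C weight a *\<^sub>C E k a b else 0)
      + (if a = b then (d a y * d' y a) *\<^sub>C weight a *\<^sub>C E k y y else 0))"
      unfolding ptr_add ptr_cscale P using ab y
      by (cases "y = b"; cases "y = a"; cases "a = b"; simp)
  qed
  also have "\<dots> = (if a = b then weight a *\<^sub>C (\<Sum>y\<in>I. (d a y * d' y a) *\<^sub>C E k y y) else 0)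
      + (weight a * d a a * c' b a + weight b * c a b * d' b b + (\<Sum>y\<in>I. weight y * c a y * c' b y)) *\<^sub>C E k a b"
  proof -
    have "(\<Sum>y\<in>I. (c a y * c' b y) *\<^sub>C weight y *\<^sub>C E k a b) = (\<Sum>y\<in>I. weight y * c a y * c' b y) *\<^sub>C E k a b"
      by (simp only: cscale_sum_left cscale_cscale) (simp only: mult.commute mult.left_commute)
    moreover have "(\<Sum>y\<in>I. if y = b then (c a b * d' b b) *\<^sub>C weight b *\<^sub>C E k a b else 0)
        = (weight b * c a b * d' b b) *\<^sub>C E k a b"
      using ab by (simp add: mult_ac)
    moreover have "(\<Sum>y\<in>I. if y = a then (d a a * c' b a) *\<^sub>C weight a *\<^sub>C E k a b else 0)
        = (weight a * d a a * c' b a) *\<^sub>C E k a b"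
      using ab by (simp add: mult_ac)
    moreover have "(\<Sum>y\<in>I. if a = b then (d a y * d' y a) *\<^sub>C weight a *\<^sub>C E k y y else 0)
        = (if a = b then weight a *\<^sub>C (\<Sum>y\<in>I. (d a y * d' y a) *\<^sub>C E k y y) else 0)"
      by (simp add: cscale_sum_right mult_ac)
    ultimately show ?thesis
      by (simp only: sum.distrib cscale_add_left) (simp only: add_ac)
  qed
  finally show ?thesis .
qed

lemma ptr_Smat: "ptr (Suc k) (Smat k c d)
    = (\<Sum>i\<in>I. ((\<Sum>j\<in>I. weight j * c i j) + weight i * d i i) *\<^sub>C E k i i)"
proof -
  have "ptr (Suc k) (Smat k c d) = (\<Sum>i\<in>I. \<Sum>j\<in>I.
      c i j *\<^sub>C weight j *\<^sub>C E k i i + (if j = i then d i i *\<^sub>C weight i *\<^sub>C E k i i else 0))"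
    unfolding Smat_def ptr_sum
    by (intro sum.cong refl) (auto simp: ptr_add ptr_E_times free_E)
  also have "\<dots> = (\<Sum>i\<in>I. ((\<Sum>j\<in>I. weight j * c i j) + weight i * d i i) *\<^sub>C E k i i)"
    by (intro sum.cong refl) (simp add: sum.distrib sum.delta cscale_add_left cscale_sum_left mult.commute)
  finally show ?thesis .
qed

text \<open>The property of the \<open>q\<close>-trace behind the invariance of the overlined copies.\<close>

lemma ptr_conj:
  assumes S: "\<And>a b. a \<in> I \<Longrightarrow> b \<in> I \<Longrightarrow> ptr (Suc k) (Smat k c d * E k a b * Smat k c' d') = ptr k (E k a b)"
    and X: "cor X" "free (Suc k) X"
  shows "ptr (Suc k) (Smat k c d * X * Smat k c' d') = ptr k X"
proof -
  let ?S = "Smat k c d" and ?S' = "Smat k c' d'"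
  \<comment> \<open>The coefficients of \<open>X\<close> are trivial in both factors and so commute
    with \<open>Smat\<close>; this reduces the claim to matrix units.\<close>
  have free: "free k (coef k a b X)" "free (Suc k) (coef k a b X)" for a b
    using X by (auto intro: free_coef free_coef_other)
  have "?S * X * ?S' = (\<Sum>a\<in>I. \<Sum>b\<in>I. ?S * (E k a b * coef k a b X) * ?S')"
    by (subst expand_coef[OF X(1), of k]) (simp only: sum_distrib_left sum_distrib_right)
  also have "\<dots> = (\<Sum>a\<in>I. \<Sum>b\<in>I. (?S * E k a b * ?S') * coef k a b X)"
    using commutesD[OF commutes_Smat[OF free]]
    by (intro sum.cong refl) (simp add: mult.assoc)
  finally have "ptr (Suc k) (?S * X * ?S') = ptr (Suc k) \<dots>"
    by (rule arg_cong)
  also have "\<dots> = (\<Sum>a\<in>I. \<Sum>b\<in>I. ptr k (E k a b * coef k a b X))"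
    unfolding ptr_sum by (intro sum.cong refl) (simp add: ptr_right free S)
  also have "\<dots> = ptr k X"
    by (subst (2) expand_coef[OF X(1), of k]) (simp only: ptr_sum)
  finally show ?thesis .
qed

text \<open>The ordinary trace is cyclic, and moving a matrix unit past D costs the ratio of two
  weights.\<close>

lemma ptr_cyclic:
  "weight b *\<^sub>C ptr k (E k a b * X) = weight a *\<^sub>C ptr k (X * E k a b)"
proof (cases "a \<in> I \<and> b \<in> I")
  case True
  have "ptr k (E k a b * X) = (\<Sum>c\<in>I. \<Sum>d\<in>I. if d = a then weight a *\<^sub>C (E k c b * X * E k a c) else 0)"
    unfolding ptr_def using True by (intro sum.cong refl) (auto simp: mult.assoc[symmetric])
  moreover have "ptr k (X * E k a b) = (\<Sum>c\<in>I. \<Sum>d\<in>I. if d = b then weight b *\<^sub>C (E k c b * X * E k a c) else 0)"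
    unfolding ptr_def using True by (intro sum.cong refl) (auto simp: mult.assoc)
  ultimately show ?thesis
    using True by (simp add: sum.delta cscale_sum_right mult.commute)
next
  case False
  then have "E k a b = 0" by (intro E_outside) (auto simp: I_def)
  then show ?thesis by simp
qed

lemma ptr_EE_cyclic:
  "(weight b * weight d) *\<^sub>C ptr k (ptr (Suc k) (E k a b * E (Suc k) c d * X))
    = (weight a * weight c) *\<^sub>C ptr k (ptr (Suc k) (X * (E k a b * E (Suc k) c d)))"
proof -
  have free: "free (Suc k) (E k a b)" by (intro free_E) simp
  have "(weight b * weight d) *\<^sub>C ptr k (ptr (Suc k) (E k a b * E (Suc k) c d * X))
    = weight b *\<^sub>C ptr k (E k a b * (weight d *\<^sub>C ptr (Suc k) (E (Suc k) c d * X)))"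
    by (simp add: mult.assoc ptr_left[OF free])
  also have "\<dots> = weight c *\<^sub>C (weight b *\<^sub>C ptr k (E k a b * ptr (Suc k) (X * E (Suc k) c d)))"
    unfolding ptr_cyclic[of d "Suc k" c X] by (simp add: mult.commute)
  also have "\<dots> = weight c *\<^sub>C (weight a *\<^sub>C ptr k (ptr (Suc k) (X * E (Suc k) c d) * E k a b))"
    unfolding ptr_cyclic ..
  also have "ptr (Suc k) (X * E (Suc k) c d) * E k a b = ptr (Suc k) (X * (E k a b * E (Suc k) c d))"
    by (simp add: ptr_right[OF free, symmetric] mult.assoc E_commute)
  finally show ?thesis by (simp add: mult.commute)
qed

text \<open>The weights cancel because each term of \<open>Smat\<close> at most permutes the two
  indices; in other words, D (x) D commutes with it.\<close>

lemma ptr_Smat_cyclic: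
  "ptr k (ptr (Suc k) (Smat k c d * X)) = ptr k (ptr (Suc k) (X * Smat k c d))"
proof -
  have 1: "ptr k (ptr (Suc k) (E k i i * E (Suc k) j j * X)) = ptr k (ptr (Suc k) (X * (E k i i * E (Suc k) j j)))" for i j
    using ptr_EE_cyclic[where a=i and b=i and c=j and d=j] by (rule cscale_cancel) simp
  have 2: "ptr k (ptr (Suc k) (E k j i * E (Suc k) i j * X)) = ptr k (ptr (Suc k) (X * (E k j i * E (Suc k) i j)))" for i j
  proof (rule cscale_cancel)
    show "(weight i * weight j) *\<^sub>C ptr k (ptr (Suc k) (E k j i * E (Suc k) i j * X))
        = (weight i * weight j) *\<^sub>C ptr k (ptr (Suc k) (X * (E k j i * E (Suc k) i j)))"
      using ptr_EE_cyclic[where a=j and b=i and c=i and d=j] by (simp only: mult.commute)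
  qed simp
  show ?thesis
    unfolding Smat_def sum_distrib_left sum_distrib_right ptr_sum distrib_left distrib_right ptr_add
      mult_cscale_left mult_cscale_right ptr_cscale 1 2 ..
qed

end

section \<open>Braid operators, their inverses and permutations\<close>

context tensor_units
begin

text \<open>Coefficients of P R: a pair of indices is swapped, with the coefficient q if they are
  equal, and a pair with the larger index first also keeps the multiple q - 1/q of itself.
  Subtracting q - 1/q from all diagonal coefficients gives \<open>Tc'\<close>, which belongs to the
  inverse.\<close>

definition Tc where "Tc i j = (if j < i then q - inverse q else (0::complex))" for i j :: nat
definition Tc' where "Tc' i j = (if j < i then 0 else inverse q - q :: complex)" for i j :: nat
definition Td where "Td i j = (if i = j then q else (1::complex))" for i j :: nat

definition T :: "nat \<Rightarrow> 'r" where "T k = Smat k Tc Td"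
definition T' :: "nat \<Rightarrow> 'r" where "T' k = Smat k Tc' Td"
definition Pm :: "nat \<Rightarrow> 'r" where "Pm k = Smat k (\<lambda>_ _. 0) (\<lambda>_ _. 1)"

lemma cor_T [simp]: "cor (T k)" "cor (T' k)" "cor (Pm k)"
  by (simp_all add: T_def T'_def Pm_def)

text \<open>The first columns E_a1 act like basis vectors: multiplication by E_1a restores E_aa, and
  these sum to the unit.\<close>

lemma unit_ext:
  assumes "cor X" "\<And>a. a \<in> I \<Longrightarrow> X * E k a 1 = 0"
  shows "X = 0"
proof -
  have "X = (\<Sum>a\<in>I. X * E k a a)"
    using assms(1) by (simp add: sum_distrib_left[symmetric] sum_E)
  also have "\<dots> = (\<Sum>a\<in>I. (X * E k a 1) * E k 1 a)"
    by (intro sum.cong refl) (simp add: mult.assoc)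
  also have "\<dots> = 0" using assms(2) by simp
  finally show ?thesis .
qed

text \<open>The vector e_a (x) e_b (x) e_c in three consecutive factors, encoded by first columns
  inside the algebra, so that identities of operators can be checked on vectors in an abstract
  algebra.\<close>

definition B3 :: "nat \<Rightarrow> nat \<Rightarrow> nat \<Rightarrow> nat \<Rightarrow> 'r" where
  "B3 k a b c = (E k a 1 * E (Suc k) b 1) * E (Suc (Suc k)) c 1"

lemma B3_ext:
  assumes "cor X" "cor Y" "\<And>a b c. \<lbrakk>a \<in> I; b \<in> I; c \<in> I\<rbrakk> \<Longrightarrow> X * B3 k a b c = Y * B3 k a b c"
  shows "X = Y"
proof -
  have "X - Y = 0"
  proof (rule unit_ext[where k = k])
    show "(X - Y) * E k a 1 = 0" if "a \<in> I" for a
    proof (rule unit_ext[where k = "Suc k"])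
      show "(X - Y) * E k a 1 * E (Suc k) b 1 = 0" if "b \<in> I" for b
      proof (rule unit_ext[where k = "Suc (Suc k)"])
        show "(X - Y) * E k a 1 * E (Suc k) b 1 * E (Suc (Suc k)) c 1 = 0" if "c \<in> I" for c
          using assms(3)[OF \<open>a \<in> I\<close> \<open>b \<in> I\<close> \<open>c \<in> I\<close>]
          by (simp add: B3_def mult.assoc left_diff_distrib)
      qed (use assms in auto)
    qed (use assms in auto)
  qed (use assms in auto)
  then show ?thesis by simp
qed

lemma Smat_B3:
  assumes "a \<in> I" "b \<in> I" "g \<in> I"
  shows "Smat k c d * B3 k a b g = c a b *\<^sub>C B3 k a b g + d a b *\<^sub>C B3 k b a g"
    and "Smat (Suc k) c d * B3 k a b g = c b g *\<^sub>C B3 k a b g + d b g *\<^sub>C B3 k a g b"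
proof -
  show "Smat k c d * B3 k a b g = c a b *\<^sub>C B3 k a b g + d a b *\<^sub>C B3 k b a g"
    by (simp add: B3_def mult.assoc[symmetric]) (simp add: mult.assoc Smat_EE[OF assms(1,2)] distrib_right flip: mult.assoc[of "Smat k c d"])
  have "Smat (Suc k) c d * E k a 1 = E k a 1 * Smat (Suc k) c d"
    using free_Smat[of k "Suc k" c d] by (simp add: freeD)
  then have "Smat (Suc k) c d * B3 k a b g = E k a 1 * (Smat (Suc k) c d * (E (Suc k) b 1 * E (Suc (Suc k)) g 1))"
    by (simp add: B3_def mult.assoc[symmetric])
  then show "Smat (Suc k) c d * B3 k a b g = c b g *\<^sub>C B3 k a b g + d b g *\<^sub>C B3 k a g b"
    by (simp add: Smat_EE[OF assms(2,3)] B3_def distrib_left mult.assoc)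
qed

definition w where "w = q - inverse q"

text \<open>Since q w = q^2 - 1, these rules lower the degree in \<open>q\<close> and, with
  \<open>w\<close> kept as an atom, normalize the coefficients arising in the case analyses
  below.\<close>

lemma q_quad: "q * q = 1 + q * w" and q_quad': "q * (q * x) = x + q * (w * x)"
proof -
  show 1: "q * q = 1 + q * w" by (simp add: w_def algebra_simps)
  have "q * (q * x) = (q * q) * x" by simp
  then show "q * (q * x) = x + q * (w * x)" unfolding 1 by (simp add: algebra_simps)
qed

lemma T_coefs: "Tc i j = (if j < i then w else 0)" "Tc' i j = (if j < i then 0 else - w)"
  "Td i j = (if i = j then q else 1)"
  by (simp_all add: Tc_def Tc'_def Td_def w_def)

lemma T_B3:
  assumes "a \<in> I" "b \<in> I" "g \<in> I"
  shows "T k * B3 k a b g = Tc a b *\<^sub>C B3 k a b g + Td a b *\<^sub>C B3 k b a g"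
    and "T (Suc k) * B3 k a b g = Tc b g *\<^sub>C B3 k a b g + Td b g *\<^sub>C B3 k a g b"
    and "T' k * B3 k a b g = Tc' a b *\<^sub>C B3 k a b g + Td a b *\<^sub>C B3 k b a g"
    and "T' (Suc k) * B3 k a b g = Tc' b g *\<^sub>C B3 k a b g + Td b g *\<^sub>C B3 k a g b"
    and "Pm k * B3 k a b g = B3 k b a g"
    and "Pm (Suc k) * B3 k a b g = B3 k a g b"
  using Smat_B3[OF assms] by (simp_all add: T_def T'_def Pm_def)

lemma T_inverse: "T k * T' k = e" "T' k * T k = e"
  by (rule B3_ext[where k = k]; simp add: mult.assoc T_B3 distrib_left T_coefs;
      auto simp: q_quad algebra_simps B3_def cscale_distribs)+

lemma Pm_square: "Pm k * Pm k = e"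
  by (rule B3_ext[where k = k]; simp add: mult.assoc T_B3; simp add: B3_def mult.assoc)

lemma braid_T: "T k * T (Suc k) * T k = T (Suc k) * T k * T (Suc k)"
proof (rule B3_ext[where k = k])
  fix a b c assume abc: "a \<in> I" "b \<in> I" "c \<in> I"
  show "T k * T (Suc k) * T k * B3 k a b c = T (Suc k) * T k * T (Suc k) * B3 k a b c"
    using abc
    by (cases "a < b"; cases "a = b"; cases "b < c"; cases "b = c"; cases "a < c"; cases "a = c";
      simp add: mult.assoc T_B3 distrib_left T_coefs;
      simp add: T_B3 T_coefs algebra_simps q_quad q_quad' cscale_distribs)
qed auto

text \<open>These give the assumption \<open>G_braid\<close> of \<open>shift_family\<close> for the
  inverse braid operators and for the permutations.\<close>

lemma mixed_braid:
  "T' k * T' (Suc k) * T k = T (Suc k) * T' k * T' (Suc k)"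
  "Pm k * Pm (Suc k) * T k = T (Suc k) * Pm k * Pm (Suc k)"
proof -
  show "T' k * T' (Suc k) * T k = T (Suc k) * T' k * T' (Suc k)"
  proof (rule B3_ext[where k = k])
    fix a b c assume abc: "a \<in> I" "b \<in> I" "c \<in> I"
    show "T' k * T' (Suc k) * T k * B3 k a b c = T (Suc k) * T' k * T' (Suc k) * B3 k a b c"
      using abc
      by (cases "a < b"; cases "a = b"; cases "b < c"; cases "b = c"; cases "a < c"; cases "a = c";
        simp add: mult.assoc T_B3 distrib_left T_coefs;
        simp add: T_B3 T_coefs algebra_simps q_quad q_quad' cscale_distribs)
  qed auto
  show "Pm k * Pm (Suc k) * T k = T (Suc k) * Pm k * Pm (Suc k)"
    by (rule B3_ext[where k = k]; simp add: mult.assoc T_B3 distrib_left)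
qed

lemma T'_eq: "T' k = T k - w *\<^sub>C e"
proof -
  have "w *\<^sub>C e = (\<Sum>i\<in>I. \<Sum>j\<in>I. w *\<^sub>C (E k i i * E (Suc k) j j))"
    by (simp add: cscale_sum_right[symmetric] sum_distrib_left[symmetric] sum_E)
  then have "T' k + w *\<^sub>C e = T k"
    unfolding T_def T'_def Smat_def
    by (simp add: sum.distrib[symmetric]) (intro sum.cong refl, simp add: T_coefs)
  then show ?thesis by (simp add: eq_diff_eq)
qed

lemma quad_T: "T k * T k = e + w *\<^sub>C T k"
  using T_inverse(1)[of k] by (simp add: T'_eq right_diff_distrib diff_eq_eq)

lemma far_T: "Suc i < j \<Longrightarrow> T i * T j = T j * T i"
  unfolding T_def by (intro commutesD commutes_Smat free_Smat) auto

sublocale hecke: hecke_family q e T N for N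
  by unfold_locales (auto simp: quad_T braid_T w_def[symmetric] intro: far_T)

lemma weight_sum:
  assumes "b \<le> a" "1 \<le> b" "a \<le> Suc n"
  shows "w * (\<Sum>y\<in>{b..<a}. weight y) = q * (weight b - weight a)"
  using assms(1)
proof (induction a rule: dec_induct)
  case (step a)
  then show ?case using weight_step[of a] by (simp add: w_def algebra_simps)
qed simp

text \<open>At the index \<open>i\<close> the telescoping sum gives q (1 - weight i), and the
  diagonal coefficient adds q times weight i. This constant is the \<open>q\<close> in the recursion
  for the mixed traces.\<close>

lemma ptr_T: "ptr (Suc k) (T k) = q *\<^sub>C e"
proof -
  have "(\<Sum>j\<in>I. weight j * Tc i j) + weight i * Td i i = q" if "i \<in> I" for i
  proof -
    have "(\<Sum>j\<in>I. weight j * Tc i j) = (\<Sum>j\<in>{1..<i}. weight j * w)"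
      using that by (intro sum.mono_neutral_cong_right) (auto simp: I_def T_coefs)
    also have "\<dots> = q * (weight 1 - weight i)"
      using weight_sum[of 1 i] that by (simp add: sum_distrib_left I_def mult.commute)
    finally show ?thesis by (simp add: T_coefs weight_def algebra_simps)
  qed
  then show ?thesis
    by (simp add: T_def ptr_Smat cscale_sum_right[symmetric] sum_E)
qed

lemma sum_Td: "a \<in> I \<Longrightarrow> (\<Sum>y\<in>I. (Td a y * Td y a) *\<^sub>C E k y y) = e + (q * w) *\<^sub>C E k a a"
proof -
  assume a: "a \<in> I"
  have "(\<Sum>y\<in>I. (Td a y * Td y a) *\<^sub>C E k y y) = (\<Sum>y\<in>I. E k y y + (if y = a then (q * w) *\<^sub>C E k a a else 0))"
    by (intro sum.cong refl) (auto simp: T_coefs q_quad cscale_add_left)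
  then show ?thesis using a by (simp add: sum.distrib sum_E)
qed

text \<open>By \<open>ptr_conj\<close> matrix units suffice. For equal indices the extra term of
  \<open>sum_Td\<close> cancels against the term with coinciding indices; for different indices such
  terms are compensated by the telescoped sum.\<close>

lemma ptr_conj_T:
  assumes "cor X" "free (Suc k) X"
  shows "ptr (Suc k) (T k * X * T' k) = ptr k X"
    and "ptr (Suc k) (T' k * X * T k) = ptr k X"
    and "ptr (Suc k) (Pm k * X * Pm k) = ptr k X"
proof -
  have sum: "(\<Sum>y\<in>I. weight y * Tc a y * Tc' b y) = (if b < a then w * q * (weight a - weight b) else 0)"
    if "a \<in> I" "b \<in> I" for a b
  proof (cases "b < a")
    case True
    have "(\<Sum>y\<in>I. weight y * Tc a y * Tc' b y) = (\<Sum>y\<in>{b..<a}. weight y * (- w * w))"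
      using that by (intro sum.mono_neutral_cong_right) (auto simp: I_def T_coefs)
    also have "\<dots> = - w * (w * (\<Sum>y\<in>{b..<a}. weight y))"
      by (simp add: sum_distrib_right[symmetric] mult.commute mult.left_commute sum_distrib_left)
    also have "\<dots> = w * q * (weight a - weight b)"
      using True that by (subst weight_sum) (auto simp: I_def algebra_simps)
    finally show ?thesis using True by simp
  next
    case False
    then have "(\<Sum>y\<in>I. weight y * Tc a y * Tc' b y) = 0"
      by (intro sum.neutral) (auto simp: T_coefs)
    then show ?thesis using False by simp
  qed
  show "ptr (Suc k) (T k * X * T' k) = ptr k X"
    unfolding T_def T'_def
  proof (rule ptr_conj[OF _ assms])
    fix a b assume ab: "a \<in> I" "b \<in> I"
    show "ptr (Suc k) (Smat k Tc Td * E k a b * Smat k Tc' Td) = ptr k (E k a b)"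
      unfolding ptr_Smat_conj[OF ab] sum[OF ab] using ab
      by (simp add: sum_Td ptr_E) (auto simp: T_coefs cscale_distribs algebra_simps)
  qed
  have sum': "(\<Sum>y\<in>I. weight y * Tc' a y * Tc b y) = (if a < b then w * q * (weight b - weight a) else 0)"
    if "a \<in> I" "b \<in> I" for a b
    using sum[OF that(2,1)] by (simp add: mult.commute mult.left_commute)
  show "ptr (Suc k) (T' k * X * T k) = ptr k X"
    unfolding T_def T'_def
  proof (rule ptr_conj[OF _ assms])
    fix a b assume ab: "a \<in> I" "b \<in> I"
    show "ptr (Suc k) (Smat k Tc' Td * E k a b * Smat k Tc Td) = ptr k (E k a b)"
      unfolding ptr_Smat_conj[OF ab] sum'[OF ab] using ab
      by (simp add: sum_Td ptr_E) (auto simp: T_coefs cscale_distribs algebra_simps)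
  qed
  show "ptr (Suc k) (Pm k * X * Pm k) = ptr k X"
    unfolding Pm_def
  proof (rule ptr_conj[OF _ assms])
    fix a b assume ab: "a \<in> I" "b \<in> I"
    show "ptr (Suc k) (Smat k (\<lambda>_ _. 0) (\<lambda>_ _. 1) * E k a b * Smat k (\<lambda>_ _. 0) (\<lambda>_ _. 1)) = ptr k (E k a b)"
      unfolding ptr_Smat_conj[OF ab] using ab by (auto simp: ptr_E sum_E)
  qed
qed

end

subsection \<open>Vanishing of long antisymmetrizers\<close>

context tensor_units
begin

primrec basis_vec :: "nat \<Rightarrow> (nat \<Rightarrow> nat) \<Rightarrow> 'r" where
  "basis_vec 0 s = e"
| "basis_vec (Suc m) s = basis_vec m s * E (Suc m) (s (Suc m)) 1"

lemma cor_basis_vec [simp]: "cor (basis_vec m s)"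
  by (induction m) auto

lemma free_basis_vec: "m < k \<Longrightarrow> free k (basis_vec m s)"
  by (induction m) (auto intro!: free_mult free_E)

lemma basis_vec_cong: "(\<And>k. k \<in> {1..m} \<Longrightarrow> s k = s' k) \<Longrightarrow> basis_vec m s = basis_vec m s'"
  by (induction m) auto

lemma basis_vec_ext:
  "\<lbrakk>cor X; \<And>s. (\<And>k. s k \<in> I) \<Longrightarrow> X * basis_vec m s = 0\<rbrakk> \<Longrightarrow> X = 0"
proof (induction m)
  case 0
  then show ?case using 0(2)[of "\<lambda>_. Suc 0"] by simp
next
  case (Suc m)
  show ?case
  proof (rule Suc.IH[OF Suc.prems(1)])
    fix s :: "nat \<Rightarrow> nat" assume s: "\<And>k. s k \<in> I"
    show "X * basis_vec m s = 0"
    proof (rule unit_ext[where k = "Suc m"])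
      fix a assume "a \<in> I"
      then have "X * basis_vec (Suc m) (s(Suc m := a)) = 0" using s by (intro Suc.prems(2)) auto
      moreover have "basis_vec m (s(Suc m := a)) = basis_vec m s" by (rule basis_vec_cong) auto
      ultimately show "X * basis_vec m s * E (Suc m) a 1 = 0" by (simp add: mult.assoc)
    qed (use Suc.prems in auto)
  qed
qed

lemma Smat_basis_vec:
  assumes "\<And>j. s j \<in> I" "1 \<le> k" "k < m"
  shows "Smat k c d * basis_vec m s = c (s k) (s (Suc k)) *\<^sub>C basis_vec m s
    + d (s k) (s (Suc k)) *\<^sub>C basis_vec m (s(k := s (Suc k), Suc k := s k))"
  using assms(3)
proof (induction m)
  case (Suc m)
  show ?case
  proof (cases "k < m")
    case True
    then show ?thesis using Suc.IH by (simp add: mult.assoc[symmetric] distrib_right)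
  next
    case False
    then have m: "m = k" using Suc.prems by simp
    obtain p where k: "k = Suc p" using assms(2) by (cases k) auto
    have "commutes (basis_vec p s) (Smat k c d)"
      by (rule commutes_Smat) (auto intro: free_basis_vec simp: k)
    moreover have split: "basis_vec (Suc m) s' = basis_vec p s' * (E k (s' k) 1 * E (Suc k) (s' (Suc k)) 1)" for s'
      by (simp add: m k mult.assoc)
    ultimately have "Smat k c d * basis_vec (Suc m) s
        = basis_vec p s * (Smat k c d * (E k (s k) 1 * E (Suc k) (s (Suc k)) 1))"
      unfolding split by (simp add: commutes_def mult.assoc[symmetric])
    moreover have "basis_vec p (s(k := s (Suc k), Suc k := s k)) = basis_vec p s"
      by (rule basis_vec_cong) (auto simp: k)
    ultimately show ?thesis
      unfolding split by (simp add: Smat_EE assms(1) distrib_left)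
  qed
qed simp

text \<open>If \<open>X\<close> kills a basis vector, it also kills the one with two adjacent
  distinct indices swapped, so equal indices can be brought together. On adjacent equal indices
  \<open>T\<close> acts by q, whereas X T = -X/q, and q is not -1/q.\<close>

lemma antisymmetric_vanishes:
  assumes X: "cor X" "\<And>k. 1 \<le> k \<Longrightarrow> k < m \<Longrightarrow> X * T k = (- inverse q) *\<^sub>C X" and m: "n < m"
  shows "X = 0"
proof (rule basis_vec_ext[OF X(1), where m = m])
  fix s :: "nat \<Rightarrow> nat" assume s: "\<And>k. s k \<in> I"
  let ?swap = "\<lambda>s k. s(k := s (Suc k), Suc k := s k :: nat)"
  have step: "(- inverse q - Tc (s k) (s (Suc k))) *\<^sub>C (X * basis_vec m s)
      = Td (s k) (s (Suc k)) *\<^sub>C (X * basis_vec m (?swap s k))"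
    if "\<And>k. s k \<in> I" "1 \<le> k" "k < m" for s k
  proof -
    have "(X * T k) * basis_vec m s = X * (T k * basis_vec m s)" by (rule mult.assoc)
    then show ?thesis
      unfolding X(2)[OF that(2,3)] unfolding T_def Smat_basis_vec[OF that]
      by (simp add: distrib_left cscale_diff_left)
  qed
  have eq: "X * basis_vec m s = 0" if "\<And>k. s k \<in> I" "1 \<le> k" "k < m" "s k = s (Suc k)" for s k
  proof -
    have "?swap s k = s" using that(4) by auto
    then have "(- inverse q - q) *\<^sub>C (X * basis_vec m s) = 0"
      using step[of s k, OF that(1-3)] that(4) by (simp add: T_coefs cscale_diff_left)
    moreover have "- inverse q - q \<noteq> 0"
    proof
      assume "- inverse q - q = 0"
      then have "q * q = - 1" by (simp add: field_simps eq_neg_iff_add_eq_0)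
      then have "q ^ 4 = 1" by (simp add: power4_eq_xxxx mult.assoc)
      then show False using q_generic[of 4] by simp
    qed
    ultimately show ?thesis by (simp add: cscale_eq_0_iff)
  qed
  have dist: "X * basis_vec m s = 0" if "\<And>k. s k \<in> I" "1 \<le> i" "i < j" "j \<le> m" "s i = s j" for s i j
    using that
  proof (induction "j - Suc i" arbitrary: s j)
    case 0
    then have "j = Suc i" by simp
    then show ?case using 0 by (intro eq[of s i]) auto
  next
    case (Suc d)
    then obtain p where j: "j = Suc p" by (cases j) auto
    have ip: "i < p" "1 \<le> p" "p < m" using Suc.hyps(2) Suc.prems by (auto simp: j)
    show ?case
    proof (cases "s p = s (Suc p)")
      case True
      then show ?thesis using ip Suc.prems by (intro eq[of s p]) auto
    next
      case False
      \<comment> \<open>The swap moves the repeated index one place closer to \<open>i\<close>. Then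
        \<open>step\<close> is used at the swapped sequence, where swapping back has the coefficient
        1 because the two indices differ.\<close>
      let ?s = "?swap s p"
      have s': "?s k \<in> I" for k using Suc.prems(1) by simp
      have "X * basis_vec m ?s = 0"
        using Suc.hyps(2) Suc.prems ip s' by (intro Suc.hyps(1)[of p ?s]) (auto simp: j)
      moreover have "?swap ?s p = s" by auto
      moreover have "?s p \<noteq> ?s (Suc p)" using False by simp
      ultimately show ?thesis
        using step[of ?s p, OF s' ip(2,3)] by (simp add: T_coefs)
    qed
  qed
  have "\<not> inj_on s {1..m}"
  proof
    assume "inj_on s {1..m}"
    then have "card {1..m} \<le> card I" by (rule card_inj_on_le) (use s in auto)
    then show False using m by (simp add: I_def)
  qed
  then obtain i j where "i \<in> {1..m}" "j \<in> {1..m}" "i \<noteq> j" "s i = s j" by (auto simp: inj_on_def)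
  then show "X * basis_vec m s = 0"
    using dist[of s i j] dist[of s j i] s by (cases "i < j") auto
qed

abbreviation "As m \<equiv> anti e T q m"

lemma cor_As [simp]: "cor (As m)"
  using hecke.anti_unit[of m m] by (simp add: cor_def del: corD)

lemma As_vanishes: "n < m \<Longrightarrow> As m = 0"
  by (rule antisymmetric_vanishes) (use hecke.anti_properties[of m m] in auto)

lemma free_T: "j \<noteq> k \<Longrightarrow> j \<noteq> Suc k \<Longrightarrow> free j (T k)" "j \<noteq> k \<Longrightarrow> j \<noteq> Suc k \<Longrightarrow> free j (T' k)"
  "j \<noteq> k \<Longrightarrow> j \<noteq> Suc k \<Longrightarrow> free j (Pm k)"
  unfolding T_def T'_def Pm_def by (rule free_Smat; assumption)+

lemma free_As: "m < j \<Longrightarrow> free j (As m)"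
  unfolding free_def by (intro allI hecke.anti_commutes) (use free_T in \<open>auto simp: free_def commutes_def\<close>)

subsection \<open>Iterated partial traces\<close>

text \<open>The trace over the factors l, ..., l + m - 1, beginning with the last one.\<close>

primrec ttr :: "nat \<Rightarrow> nat \<Rightarrow> 'r \<Rightarrow> 'r" where
  "ttr l 0 X = X"
| "ttr l (Suc m) X = ttr l m (ptr (l + m) X)"

lemma ttr_add: "ttr l m (X + Y) = ttr l m X + ttr l m Y"
  and ttr_diff: "ttr l m (X - Y) = ttr l m X - ttr l m Y"
  and ttr_cscale [simp]: "ttr l m (c *\<^sub>C X) = c *\<^sub>C ttr l m X"
  by (induction m arbitrary: X Y) (simp_all add: ptr_add ptr_diff)

lemma ttr_left: "(\<And>k. l \<le> k \<Longrightarrow> k < l + m \<Longrightarrow> free k Y) \<Longrightarrow> ttr l m (Y * X) = Y * ttr l m X"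
  by (induction m arbitrary: X) (simp_all add: ptr_left)

lemma ttr_right: "(\<And>k. l \<le> k \<Longrightarrow> k < l + m \<Longrightarrow> free k Y) \<Longrightarrow> ttr l m (X * Y) = ttr l m X * Y"
  by (induction m arbitrary: X) (simp_all add: ptr_right)

lemma cor_ttr: "cor X \<Longrightarrow> cor (ttr l m X)"
  by (induction m arbitrary: X) simp_all

lemma free_ttr_other: "free j X \<Longrightarrow> \<not> (l \<le> j \<and> j < l + m) \<Longrightarrow> free j (ttr l m X)"
proof (induction m arbitrary: X)
  case (Suc m)
  then have "free j (ptr (l + m) X)" by (intro free_ptr_other) auto
  then show ?case using Suc.IH[of "ptr (l + m) X"] Suc.prems by auto
qed simp

lemma free_ttr: "l \<le> j \<Longrightarrow> j < l + m \<Longrightarrow> free j (ttr l m X)"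
proof (induction m arbitrary: X)
  case (Suc m)
  show ?case
  proof (cases "j < l + m")
    case False
    then have "j = l + m" using Suc.prems by simp
    then show ?thesis using free_ttr_other[of j "ptr j X" l m] free_ptr by simp
  qed (use Suc in auto)
qed simp

lemma ttr_T_cyclic:
  "\<lbrakk>l \<le> k; Suc k < l + m\<rbrakk> \<Longrightarrow> ttr l m (T k * X) = ttr l m (X * T k)"
proof (induction m arbitrary: X)
  case (Suc m)
  show ?case
  proof (cases "Suc k = l + m")
    case True
    then obtain p where m: "m = Suc p" using Suc.prems by (cases m) auto
    then have "l + p = k" "l + m = Suc k" using True by auto
    then show ?thesis unfolding ttr.simps m using ptr_Smat_cyclic[of k] by (simp add: T_def m)
  next
    case False
    then have "free (l + m) (T k)" using Suc.prems by (intro free_T) auto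
    then show ?thesis using Suc False by (simp add: ptr_left ptr_right)
  qed
qed simp

text \<open>The elements that may be moved cyclically under the trace are closed under products and
  linear combinations, and the braid generators on the traced factors are among them.\<close>

lemma ttr_As_cyclic:
  assumes "j \<le> m" "cor X"
  shows "ttr 1 m (As j * X) = ttr 1 m (X * As j)"
proof -
  define cyc where "cyc Y \<longleftrightarrow> cor Y \<and> (\<forall>X. cor X \<longrightarrow> ttr 1 m (Y * X) = ttr 1 m (X * Y))" for Y
  have mult: "cyc (Y * Z)" if "cyc Y" "cyc Z" for Y Z
    unfolding cyc_def
  proof (intro conjI allI impI)
    fix X assume X: "cor X"
    have "ttr 1 m (Y * Z * X) = ttr 1 m (Y * (Z * X))" by (simp only: mult.assoc)
    also have "\<dots> = ttr 1 m (Z * (X * Y))" using that X by (simp add: cyc_def mult.assoc)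
    also have "\<dots> = ttr 1 m (X * Y * Z)" using that X by (simp add: cyc_def)
    finally show "ttr 1 m (Y * Z * X) = ttr 1 m (X * (Y * Z))" by (simp only: mult.assoc)
  qed (use that in \<open>auto simp: cyc_def\<close>)
  have "cyc (As j)" using assms(1)
  proof (induction j)
    case (Suc j)
    have "cyc (q ^ j *\<^sub>C e - qint q j *\<^sub>C T j)"
      unfolding cyc_def using Suc.prems ttr_T_cyclic[of 1 j m]
      by (cases "j = 0") (auto simp: left_diff_distrib right_diff_distrib ttr_diff)
    with Suc have "cyc (As j * (q ^ j *\<^sub>C e - qint q j *\<^sub>C T j) * As j)" by (intro mult) auto
    then show ?case by (simp add: cyc_def)
  qed (simp add: cyc_def)
  then show ?thesis using assms(2) by (simp add: cyc_def)
qed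

text \<open>Powers in the corner: the zeroth power is \<open>e\<close> and not the unit of the type
  class.\<close>

primrec pw :: "'r \<Rightarrow> nat \<Rightarrow> 'r" where
  "pw x 0 = e"
| "pw x (Suc j) = x * pw x j"

lemma cor_pw [simp]: "cor x \<Longrightarrow> cor (pw x j)"
  by (induction j) auto

lemma free_pw: "free k x \<Longrightarrow> free k (pw x j)"
  by (induction j) auto

lemma commutes_pw: "commutes y x \<Longrightarrow> commutes y e \<Longrightarrow> commutes y (pw x j)"
  by (induction j) (auto intro: commutes_mult)

lemma pw_conj:
  assumes "cor x" "cor s" "s' * s = e" "s * s' = e"
  shows "pw (s * x * s') j = s * pw x j * s'"
proof (induction j)
  case (Suc j)
  have "s * x * s' * (s * pw x j * s') = s * x * (s' * s) * pw x j * s'" by (simp only: mult.assoc)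
  also have "\<dots> = s * (x * pw x j) * s'"
    using assms by (simp add: mult.assoc)
  finally show ?case using Suc by simp
qed (use assms in simp)

lemma commutes_e: "cor x \<Longrightarrow> commutes x e"
  by (simp add: commutes_def)

end

subsection \<open>Newton identities and centrality\<close>

text \<open>
  \<open>G\<close> is one of \<open>T\<close>, \<open>T'\<close> and the permutation operators \<open>Pm\<close>; conjugation by \<open>G 1 * \<dots> * G m\<close>
  shifts the braid generators and is compatible with the partial traces.
\<close>

locale shift_family = tensor_units q n E e for q n and E :: "nat \<Rightarrow> nat \<Rightarrow> nat \<Rightarrow> 'r::calgebra" and e +
  fixes G G' :: "nat \<Rightarrow> 'r"
  assumes cor_G [simp]: "cor (G k)" "cor (G' k)"
    and G_inverse: "G k * G' k = e" "G' k * G k = e"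
    and free_G: "j \<noteq> k \<Longrightarrow> j \<noteq> Suc k \<Longrightarrow> free j (G k)" "j \<noteq> k \<Longrightarrow> j \<noteq> Suc k \<Longrightarrow> free j (G' k)"
    and G_commutes: "free k X \<Longrightarrow> free (Suc k) X \<Longrightarrow> commutes X (G k)"
    and G_braid: "G k * G (Suc k) * T k = T (Suc k) * G k * G (Suc k)"
    and ptr_conj_G: "cor X \<Longrightarrow> free (Suc k) X \<Longrightarrow> ptr (Suc k) (G k * X * G' k) = ptr k X"
begin

text \<open>For permutations, conjugation by this product carries the factors 1, ..., m to 2, ..., m
  + 1. The braid versions share its effect on braid generators and on traces.\<close>

primrec shift :: "nat \<Rightarrow> 'r" where
  "shift 0 = e" | "shift (Suc m) = shift m * G (Suc m)"

primrec shift' :: "nat \<Rightarrow> 'r" where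
  "shift' 0 = e" | "shift' (Suc m) = G' (Suc m) * shift' m"

lemma cor_shift [simp]: "cor (shift m)" "cor (shift' m)"
  by (induction m) auto

lemma shift_inverse: "shift m * shift' m = e" "shift' m * shift m = e"
proof (induction m)
  case (Suc m)
  have "shift (Suc m) * shift' (Suc m) = shift m * (G (Suc m) * G' (Suc m)) * shift' m"
    "shift' (Suc m) * shift (Suc m) = G' (Suc m) * (shift' m * shift m) * G (Suc m)"
    by (simp_all add: mult.assoc)
  then show "shift (Suc m) * shift' (Suc m) = e" "shift' (Suc m) * shift (Suc m) = e"
    using Suc by (simp_all add: G_inverse)
qed simp_all

lemma free_shift: "Suc m < j \<Longrightarrow> free j (shift m)" "Suc m < j \<Longrightarrow> free j (shift' m)"
  by (induction m) (auto intro!: free_mult free_G)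

lemma shift_commutes: "(\<And>k. 1 \<le> k \<Longrightarrow> k \<le> Suc m \<Longrightarrow> free k X) \<Longrightarrow> cor X \<Longrightarrow> commutes X (shift m)"
  by (induction m) (auto intro!: commutes_mult G_commutes simp: commutes_e)

text \<open>The last factor of the product commutes with \<open>T i\<close> unless \<open>i\<close>
  is the largest admissible index, and there \<open>G_braid\<close> applies.\<close>

lemma shift_T: "1 \<le> i \<Longrightarrow> i < m \<Longrightarrow> shift m * T i = T (Suc i) * shift m"
proof (induction m)
  case (Suc m)
  show ?case
  proof (cases "i < m")
    case True
    have "G (Suc m) * T i = T i * G (Suc m)"
      using True by (intro commutesD[OF commutes_sym] G_commutes free_T) auto
    then have "shift (Suc m) * T i = (shift m * T i) * G (Suc m)" by (simp add: mult.assoc)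
    then show ?thesis using Suc True by (simp add: mult.assoc)
  next
    case False
    then obtain p where m: "m = Suc p" "i = Suc p" using Suc.prems by (cases i) auto
    have "T (Suc (Suc p)) * shift p = shift p * T (Suc (Suc p))"
      by (intro commutesD shift_commutes free_T) auto
    moreover have "shift (Suc m) * T i = shift p * (G (Suc p) * G (Suc (Suc p)) * T (Suc p))"
      by (simp add: m mult.assoc)
    ultimately show ?thesis
      unfolding G_braid by (simp add: m mult.assoc[symmetric])
  qed
qed simp

text \<open>All factors but \<open>G 1\<close> commute with an operator in the first copy and cancel
  against their inverses.\<close>

lemma shift_first:
  assumes "\<And>k. 2 \<le> k \<Longrightarrow> free k X" "cor X"
  shows "shift (Suc m) * X * shift' (Suc m) = G 1 * X * G' 1"
proof (induction m)
  case (Suc m)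
  have "commutes X (G (Suc (Suc m)))" using assms by (intro G_commutes) auto
  have "shift (Suc (Suc m)) * X * shift' (Suc (Suc m))
    = shift (Suc m) * (G (Suc (Suc m)) * X) * G' (Suc (Suc m)) * shift' (Suc m)"
    by (simp add: mult.assoc)
  also have "G (Suc (Suc m)) * X = X * G (Suc (Suc m))"
    by (rule commutesD[OF commutes_sym]) fact
  also have "shift (Suc m) * (X * G (Suc (Suc m))) * G' (Suc (Suc m)) * shift' (Suc m)
    = shift (Suc m) * X * (G (Suc (Suc m)) * G' (Suc (Suc m))) * shift' (Suc m)"
    by (simp only: mult.assoc)
  also have "\<dots> = shift (Suc m) * X * shift' (Suc m)"
    using assms by (simp add: G_inverse)
  finally show ?case using Suc by simp
qed (use assms in simp)

text \<open>The trace over the last factor absorbs the innermost conjugation and leaves the trace of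
  \<open>Y\<close> over the factor before it; induction does the rest.\<close>

lemma ttr_shift:
  "\<lbrakk>cor Y; \<And>j. m < j \<Longrightarrow> free j Y\<rbrakk> \<Longrightarrow> ttr 2 m (shift m * Y * shift' m) = ttr 1 m Y"
proof (induction m arbitrary: Y)
  case (Suc m)
  have free: "free (Suc (Suc m)) (shift m)" "free (Suc (Suc m)) (shift' m)"
    by (auto intro: free_shift)
  have "shift (Suc m) * Y * shift' (Suc m) = shift m * ((G (Suc m) * Y * G' (Suc m)) * shift' m)"
    by (simp add: mult.assoc)
  then have "ttr 2 (Suc m) (shift (Suc m) * Y * shift' (Suc m))
    = ttr 2 m (shift m * (ptr (Suc (Suc m)) (G (Suc m) * Y * G' (Suc m)) * shift' m))"
    by (simp only: ttr.simps add_2_eq_Suc ptr_left[OF free(1)] ptr_right[OF free(2)])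
  also have "ptr (Suc (Suc m)) (G (Suc m) * Y * G' (Suc m)) = ptr (Suc m) Y"
    by (rule ptr_conj_G) (use Suc.prems in auto)
  also have "ttr 2 m (shift m * (ptr (Suc m) Y * shift' m)) = ttr 2 m (shift m * ptr (Suc m) Y * shift' m)"
    by (simp only: mult.assoc)
  also have "\<dots> = ttr 1 m (ptr (Suc m) Y)"
  proof (rule Suc.IH)
    show "free j (ptr (Suc m) Y)" if "m < j" for j
      using that Suc.prems(2)[of j] free_ptr free_ptr_other by (cases "j = Suc m") auto
  qed simp
  finally show ?case by simp
qed simp

end

context tensor_units
begin

lemma shift_family_T: "shift_family q n E e T T'"
  by unfold_locales
    (auto simp: T_inverse braid_T ptr_conj_T intro!: free_T, auto simp: T_def intro: commutes_Smat)

lemma shift_family_T': "shift_family q n E e T' T"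
  by unfold_locales
    (auto simp: T_inverse mixed_braid ptr_conj_T intro!: free_T, auto simp: T'_def intro: commutes_Smat)

lemma shift_family_Pm: "shift_family q n E e Pm Pm"
  by unfold_locales
    (auto simp: Pm_square mixed_braid ptr_conj_T intro!: free_T, auto simp: Pm_def intro: commutes_Smat)

end

text \<open>
  \<open>X\<close>, \<open>Y\<close>, \<open>Yi\<close> are the matrices \<open>L\<^sup>+\<close>, \<open>L\<^sup>-\<close> and the inverse of \<open>L\<^sup>-\<close> in the first tensor factor.
  The relation \<open>R X\<^sub>1 Y\<^sub>2 = Y\<^sub>2 X\<^sub>1 R\<close> has been multiplied by the permutation from the left.
\<close>

locale quantum_matrices = tensor_units q n E e
  for q n and E :: "nat \<Rightarrow> nat \<Rightarrow> nat \<Rightarrow> 'r::calgebra" and e +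
  fixes X Y Yi :: 'r
  assumes cor_XY [simp]: "cor X" "cor Y" "cor Yi"
    and free_XY: "2 \<le> k \<Longrightarrow> free k X" "2 \<le> k \<Longrightarrow> free k Y" "2 \<le> k \<Longrightarrow> free k Yi"
    and Y_inverse: "Y * Yi = e" "Yi * Y = e"
    and RXX: "T 1 * X * (Pm 1 * X * Pm 1) = X * (Pm 1 * X * Pm 1) * T 1"
    and RYY: "T 1 * Y * (Pm 1 * Y * Pm 1) = Y * (Pm 1 * Y * Pm 1) * T 1"
    and RXY: "T 1 * X * (Pm 1 * Y * Pm 1) = Y * (Pm 1 * X * Pm 1) * T 1"
begin

definition L where "L = X * Yi"

lemma cor_L [simp]: "cor L" by (simp add: L_def)

lemma free_L: "2 \<le> k \<Longrightarrow> free k L" by (auto simp: L_def intro: free_XY)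

definition X2 where "X2 = Pm 1 * X * Pm 1"
definition Y2 where "Y2 = Pm 1 * Y * Pm 1"
definition Yi2 where "Yi2 = Pm 1 * Yi * Pm 1"

lemmas RLL = RXX[folded X2_def] RYY[folded Y2_def] RXY[folded X2_def Y2_def]

lemma cor_X2 [simp]: "cor X2" "cor Y2" "cor Yi2"
  by (simp_all add: X2_def Y2_def Yi2_def)

lemma Y2_inverse: "Y2 * Yi2 = e" "Yi2 * Y2 = e"
proof -
  have "Y2 * Yi2 = Pm 1 * Y * (Pm 1 * Pm 1) * Yi * Pm 1" by (simp only: Y2_def Yi2_def mult.assoc)
  also have "\<dots> = Pm 1 * (Y * Yi) * Pm 1" by (simp add: Pm_square mult.assoc)
  finally show "Y2 * Yi2 = e" by (simp add: Y_inverse Pm_square)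
  have "Yi2 * Y2 = Pm 1 * Yi * (Pm 1 * Pm 1) * Y * Pm 1" by (simp only: Y2_def Yi2_def mult.assoc)
  also have "\<dots> = Pm 1 * (Yi * Y) * Pm 1" by (simp add: Pm_square mult.assoc)
  finally show "Yi2 * Y2 = e" by (simp add: Y_inverse Pm_square)
qed

lemma Yi_T_X: "Yi * T 1 * X = X2 * T 1 * Yi2"
proof -
  have "Yi * (T 1 * X * Y2) * Yi2 = Yi * (Y * X2 * T 1) * Yi2" by (simp only: RLL(3))
  then have "Yi * T 1 * X * (Y2 * Yi2) = (Yi * Y) * X2 * T 1 * Yi2" by (simp only: mult.assoc)
  then show ?thesis by (simp add: Y_inverse Y2_inverse)
qed

lemma Yi2_Yi_T: "Yi2 * Yi * T 1 = T 1 * Yi2 * Yi"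
proof -
  have "Yi2 * Yi * (T 1 * Y * Y2) * Yi2 * Yi = Yi2 * Yi * (Y * Y2 * T 1) * Yi2 * Yi" by (simp only: RLL(2))
  then have "Yi2 * Yi * T 1 * Y * (Y2 * Yi2) * Yi = Yi2 * (Yi * Y) * Y2 * T 1 * Yi2 * Yi" by (simp only: mult.assoc)
  then have "Yi2 * Yi * T 1 * Y * Yi = (Yi2 * Y2) * T 1 * Yi2 * Yi" by (simp add: Y_inverse Y2_inverse)
  then have "Yi2 * Yi * T 1 * (Y * Yi) = T 1 * Yi2 * Yi" by (simp add: Y2_inverse mult.assoc)
  then show ?thesis by (simp add: Y_inverse)
qed

lemma T'_XX: "T' 1 * X * X2 = X * X2 * T' 1"
  unfolding T'_eq using RLL(1) by (simp add: left_diff_distrib right_diff_distrib mult.assoc)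

text \<open>With subscripts for the copies, L T L = X_1 X_2 T Yi_2 Yi_1 by the mixed relation. As
  \<open>T\<close> commutes with X_1 X_2 and with Yi_2 Yi_1, it commutes with L T L.\<close>

lemma reflection: "T 1 * L * T 1 * L = L * T 1 * L * T 1"
proof -
  have LTL: "L * T 1 * L = X * X2 * T 1 * Yi2 * Yi"
  proof -
    have "L * T 1 * L = X * (Yi * T 1 * X) * Yi" by (simp only: L_def mult.assoc)
    then show ?thesis unfolding Yi_T_X by (simp only: mult.assoc)
  qed
  have "T 1 * L * T 1 * L = T 1 * (L * T 1 * L)" by (simp only: mult.assoc)
  also have "\<dots> = (T 1 * X * X2) * T 1 * Yi2 * Yi" unfolding LTL by (simp only: mult.assoc)
  also have "\<dots> = X * X2 * T 1 * (T 1 * Yi2 * Yi)" unfolding RLL(1) by (simp only: mult.assoc)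
  also have "\<dots> = X * X2 * T 1 * (Yi2 * Yi * T 1)" by (simp only: Yi2_Yi_T)
  also have "\<dots> = L * T 1 * L * T 1" unfolding LTL by (simp only: mult.assoc)
  finally show ?thesis .
qed

text \<open>The basic exchange behind centrality: passing L^- turns the braided second copy of L
  into the permuted one. \<open>conj_X\<close> is the counterpart for L^+, with the inverse braid
  operator in the place of the braid operator.\<close>

lemma conj_Y: "T 1 * L * T' 1 * Y = Y * Pm 1 * L * Pm 1"
proof -
  have "Yi * T' 1 * Y = Y2 * T' 1 * Yi2"
  proof -
    have "T' 1 * Y * Y2 = Y * Y2 * T' 1"
      unfolding T'_eq using RLL(2) by (simp add: left_diff_distrib right_diff_distrib mult.assoc)
    then have "Yi * (T' 1 * Y * Y2) * Yi2 = Yi * (Y * Y2 * T' 1) * Yi2" by (simp only:)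
    then have "Yi * T' 1 * Y * (Y2 * Yi2) = (Yi * Y) * Y2 * T' 1 * Yi2" by (simp only: mult.assoc)
    then show ?thesis by (simp add: Y_inverse Y2_inverse)
  qed
  then have "T 1 * L * T' 1 * Y = (T 1 * X * Y2) * T' 1 * Yi2" by (simp only: L_def mult.assoc)
  also have "\<dots> = Y * X2 * (T 1 * T' 1) * Yi2" unfolding RLL(3) by (simp only: mult.assoc)
  also have "\<dots> = Y * Pm 1 * X * (Pm 1 * Pm 1) * Yi * Pm 1" by (simp add: T_inverse X2_def Yi2_def mult.assoc)
  also have "\<dots> = Y * Pm 1 * L * Pm 1" by (simp add: Pm_square L_def mult.assoc)
  finally show ?thesis .
qed

lemma conj_X: "T' 1 * L * T 1 * X = X * Pm 1 * L * Pm 1"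
proof -
  have "T' 1 * L * T 1 * X = T' 1 * X * (Yi * T 1 * X)" by (simp only: L_def mult.assoc)
  also have "\<dots> = (T' 1 * X * X2) * T 1 * Yi2" unfolding Yi_T_X by (simp only: mult.assoc)
  also have "\<dots> = X * X2 * (T' 1 * T 1) * Yi2" unfolding T'_XX by (simp only: mult.assoc)
  also have "\<dots> = X * Pm 1 * X * (Pm 1 * Pm 1) * Yi * Pm 1" by (simp add: T_inverse X2_def Yi2_def mult.assoc)
  also have "\<dots> = X * Pm 1 * L * Pm 1" by (simp add: Pm_square L_def mult.assoc)
  finally show ?thesis .
qed

section \<open>Overlined copies and the braid generators\<close>

primrec Lb :: "nat \<Rightarrow> 'r" where
  "Lb 0 = L"
| "Lb (Suc k) = T (Suc k) * Lb k * T' (Suc k)"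

text \<open>\<open>Lb\<close> counts from 0: \<open>Lb k\<close> has the overlined subscript k + 1,
  and \<open>Lprod m\<close> is the product of the copies 1, ..., m.\<close>

primrec Lprod :: "nat \<Rightarrow> 'r" where
  "Lprod 0 = e"
| "Lprod (Suc m) = Lprod m * Lb m"

lemma cor_Lb [simp]: "cor (Lb k)" and cor_Lprod [simp]: "cor (Lprod k)"
proof -
  show *: "cor (Lb k)" for k by (induction k) auto
  show "cor (Lprod k)" by (induction k) (auto simp: *)
qed

lemma free_Lb: "Suc k < j \<Longrightarrow> free j (Lb k)"
  by (induction k) (auto intro!: free_mult free_T free_L)

lemma free_Lprod: "k < j \<Longrightarrow> free j (Lprod k)"
  by (induction k) (auto intro!: free_mult free_Lb)

lemma T_commutes: "free k Z \<Longrightarrow> free (Suc k) Z \<Longrightarrow> commutes (T k) Z" "free k Z \<Longrightarrow> free (Suc k) Z \<Longrightarrow> commutes (T' k) Z"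
  by (auto simp: T_def T'_def intro: commutes_Smat commutes_sym)

text \<open>In the only nontrivial case the braid relation turns \<open>T i\<close> into the next
  generator, which passes the inner copy of L and is turned back on the other side by
  \<open>mixed_braid\<close>.\<close>

lemma T_Lb_low: "1 \<le> i \<Longrightarrow> i < k \<Longrightarrow> commutes (T i) (Lb k)"
proof (induction k)
  case (Suc k)
  show ?case
  proof (cases "i < k")
    case True
    then have "commutes (T i) (T (Suc k))" "commutes (T i) (T' (Suc k))"
      by (auto intro!: T_commutes free_T)
    then show ?thesis using Suc True by (auto intro!: commutes_mult)
  next
    case False
    then obtain p where k: "k = Suc p" "i = Suc p" using Suc.prems by (cases i) auto
    have far: "T (Suc (Suc p)) * Lb p = Lb p * T (Suc (Suc p))"
      by (intro commutesD T_commutes free_Lb) auto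
    have "T (Suc p) * Lb (Suc (Suc p)) = (T (Suc p) * T (Suc (Suc p)) * T (Suc p)) * Lb p * T' (Suc p) * T' (Suc (Suc p))"
      by (simp add: mult.assoc)
    also have "\<dots> = T (Suc (Suc p)) * T (Suc p) * (T (Suc (Suc p)) * Lb p) * T' (Suc p) * T' (Suc (Suc p))"
      unfolding braid_T by (simp only: mult.assoc)
    also have "\<dots> = T (Suc (Suc p)) * T (Suc p) * Lb p * (T (Suc (Suc p)) * T' (Suc p) * T' (Suc (Suc p)))"
      unfolding far by (simp only: mult.assoc)
    also have "\<dots> = Lb (Suc (Suc p)) * T (Suc p)"
      unfolding mixed_braid(1)[symmetric] by (simp only: Lb.simps mult.assoc)
    finally show ?thesis by (simp add: k commutes_def)
  qed
qed simp

lemma T_conj: "T' k * T (Suc k) * T k = T (Suc k) * T k * T' (Suc k)"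
  "T' (Suc k) * T' k * T (Suc k) = T k * T' (Suc k) * T' k"
proof -
  have "T' k * (T k * T (Suc k) * T k) * T' (Suc k) = T' k * (T (Suc k) * T k * T (Suc k)) * T' (Suc k)"
    by (simp only: braid_T)
  then have "(T' k * T k) * T (Suc k) * T k * T' (Suc k) = T' k * T (Suc k) * T k * (T (Suc k) * T' (Suc k))"
    by (simp only: mult.assoc)
  then show 1: "T' k * T (Suc k) * T k = T (Suc k) * T k * T' (Suc k)" by (simp add: T_inverse)
  have "T' (Suc k) * (T' k * T (Suc k) * T k) * T' k = T' (Suc k) * (T (Suc k) * T k * T' (Suc k)) * T' k"
    by (simp only: 1)
  then have "T' (Suc k) * T' k * T (Suc k) * (T k * T' k) = (T' (Suc k) * T (Suc k)) * T k * T' (Suc k) * T' k"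
    by (simp only: mult.assoc)
  then show "T' (Suc k) * T' k * T (Suc k) = T k * T' (Suc k) * T' k" by (simp add: T_inverse)
qed

text \<open>In the abbreviations of the proof, both sides for the next copy reduce to s t (x s x s)
  t' s': \<open>T_conj\<close> resolves the conjugations of t by s, and t commutes with the lower
  copy x. The equation for x makes the two reductions meet.\<close>

lemma reflection_Lb: "T (Suc k) * Lb k * T (Suc k) * Lb k = Lb k * T (Suc k) * Lb k * T (Suc k)"
proof (induction k)
  case 0
  then show ?case using reflection by simp
next
  case (Suc k)
  define s t s' t' x where "s = T (Suc k)" and "t = T (Suc (Suc k))" and "s' = T' (Suc k)"
    and "t' = T' (Suc (Suc k))" and "x = Lb k"
  have tx: "t * x = x * t" "t' * x = x * t'"
    unfolding t_def t'_def x_def by (intro commutesD T_commutes free_Lb; simp)+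
  have c: "s' * t * s = t * s * t'" "t' * s' * t = s * t' * s'"
    using T_conj[of "Suc k"] by (simp_all add: s_def t_def s'_def t'_def)
  have IH: "s * x * s * x = x * s * x * s" using Suc by (simp add: s_def x_def)
  have "t * (s * x * s') * t * (s * x * s') = t * s * x * (s' * t * s) * x * s'" by (simp only: mult.assoc)
  also have "\<dots> = t * s * (x * t) * s * (t' * x) * s'" unfolding c by (simp only: mult.assoc)
  also have "\<dots> = t * s * t * (x * s * x) * t' * s'" unfolding tx(1)[symmetric] tx(2) by (simp only: mult.assoc)
  also have "\<dots> = (s * t * s) * (x * s * x) * t' * s'"
    using braid_T[of "Suc k"] by (simp only: s_def t_def)
  also have "\<dots> = s * t * (s * x * s * x) * t' * s'" by (simp only: mult.assoc)
  finally have 1: "t * (s * x * s') * t * (s * x * s') = s * t * (x * s * x * s) * t' * s'"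
    by (simp only: IH)
  have "(s * x * s') * t * (s * x * s') * t = s * x * (s' * t * s) * x * s' * t" by (simp only: mult.assoc)
  also have "\<dots> = s * (x * t) * s * (t' * x) * s' * t" unfolding c by (simp only: mult.assoc)
  also have "\<dots> = s * t * x * s * x * (t' * s' * t)" unfolding tx(1)[symmetric] tx(2) by (simp only: mult.assoc)
  also have "\<dots> = s * t * (x * s * x * s) * t' * s'" unfolding c by (simp only: mult.assoc)
  finally show ?case using 1 by (simp add: s_def t_def s'_def x_def)
qed

text \<open>The reflection equation multiplied by the inverse braid operator from the right.\<close>

lemma T_Lb_pair: "commutes (T (Suc k)) (Lb k * Lb (Suc k))"
proof -
  let ?t = "T (Suc k)" and ?t' = "T' (Suc k)"
  have "?t * (Lb k * Lb (Suc k)) = (?t * Lb k * ?t * Lb k) * ?t'" by (simp add: mult.assoc)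
  also have "\<dots> = Lb k * ?t * Lb k * (?t * ?t')" unfolding reflection_Lb by (simp only: mult.assoc)
  also have "?t * ?t' = ?t' * ?t" by (simp only: T_inverse)
  also have "Lb k * ?t * Lb k * (?t' * ?t) = (Lb k * Lb (Suc k)) * ?t" by (simp add: mult.assoc)
  finally show ?thesis by (simp add: commutes_def)
qed

lemma T_Lprod: "1 \<le> i \<Longrightarrow> i < m \<Longrightarrow> commutes (T i) (Lprod m)"
proof (induction m)
  case (Suc m)
  show ?case
  proof (cases "i < m")
    case True
    then show ?thesis using Suc by (auto intro!: commutes_mult T_Lb_low)
  next
    case False
    then obtain p where m: "m = Suc p" "i = Suc p" using Suc.prems by (cases i) auto
    have "commutes (T (Suc p)) (Lprod p * (Lb p * Lb (Suc p)))"
      by (intro commutes_mult[OF _ T_Lb_pair] T_commutes free_Lprod) auto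
    then show ?thesis by (simp add: m mult.assoc)
  qed
qed simp

lemma As_Lb: "commutes (Lb m) (As m)" and As_Lprod: "commutes (Lprod m) (As m)"
  by (intro hecke.anti_commutes commutes_e commutes_sym[OF T_Lb_low] commutes_sym[OF T_Lprod]; simp)+

section \<open>Power sums, antisymmetrized traces and the Newton identities\<close>

definition ps :: "nat \<Rightarrow> 'r" where "ps j = ptr 1 (pw L j)"

definition el :: "nat \<Rightarrow> 'r" where "el m = ttr 1 m (Lprod m * As m)"

lemma cor_el [simp]: "cor (el m)" and cor_ps [simp]: "cor (ps j)"
  by (simp_all add: el_def ps_def cor_ttr)

text \<open>Overlined copies are successive conjugates by braid operators, under which the partial
  q-trace is invariant.\<close>

lemma ptr_pw_Lb: "ptr (Suc m) (pw (Lb m) j) = ps j"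
proof (induction m)
  case (Suc m)
  have "pw (Lb (Suc m)) j = T (Suc m) * pw (Lb m) j * T' (Suc m)"
    by (simp add: pw_conj T_inverse)
  then show ?case using Suc by (simp add: ptr_conj_T(1) free_pw free_Lb)
qed (simp add: ps_def)

lemma free_ttr_pos: "(\<And>j. m < j \<Longrightarrow> free j Z) \<Longrightarrow> 1 \<le> k \<Longrightarrow> free k (ttr 1 m Z)"
  using free_ttr[of 1 k m Z] free_ttr_other[of k Z 1 m] by (cases "k < 1 + m") auto

lemma free_ps: "1 \<le> k \<Longrightarrow> free k (ps j)"
  using free_ttr_pos[of 1 "pw L j" k] by (simp add: ps_def free_pw free_L)

text \<open>The elements whose transports by \<open>G\<close> and by \<open>Pm\<close> are exchanged
  on passing \<open>B\<close> form a subalgebra. It contains L by \<open>rel\<close>, and it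
  contains the braid generators because both transports send \<open>T i\<close> to
  \<open>T (Suc i)\<close>, which commutes with \<open>B\<close>. The traces over the factors 2,
  ..., m + 1 turn both transports back into the trace of \<open>Z\<close>, and \<open>B\<close> can
  be taken out of them.\<close>

lemma intertwine:
  assumes "shift_family q n E e G G'" and B: "cor B" "\<And>k. 2 \<le> k \<Longrightarrow> free k B"
    and rel: "G 1 * L * G' 1 * B = B * Pm 1 * L * Pm 1"
    and Z: "Z = Lprod m * As m \<or> (Z = pw L j \<and> m = 1)"
  shows "commutes (ttr 1 m Z) B"
proof -
  interpret G: shift_family q n E e G G' by fact
  interpret Pm: shift_family q n E e Pm Pm by (rule shift_family_Pm)
  define good where "good Z \<longleftrightarrow> cor Z \<and>
    G.shift m * Z * G.shift' m * B = B * (Pm.shift m * Z * Pm.shift' m)" for Z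
  have mult: "good (Z * W)" if "good Z" "good W" for Z W
  proof -
    have cor: "cor Z" "cor W" using that by (simp_all add: good_def)
    have "G.shift m * (Z * W) * G.shift' m * B = G.shift m * Z * (G.shift' m * G.shift m) * W * G.shift' m * B"
      using cor by (simp add: G.shift_inverse mult.assoc)
    also have "\<dots> = G.shift m * Z * G.shift' m * (G.shift m * W * G.shift' m * B)" by (simp only: mult.assoc)
    also have "G.shift m * W * G.shift' m * B = B * (Pm.shift m * W * Pm.shift' m)"
      using that by (simp only: good_def)
    also have "G.shift m * Z * G.shift' m * (B * (Pm.shift m * W * Pm.shift' m))
        = (G.shift m * Z * G.shift' m * B) * (Pm.shift m * W * Pm.shift' m)" by (simp only: mult.assoc)
    also have "G.shift m * Z * G.shift' m * B = B * (Pm.shift m * Z * Pm.shift' m)"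
      using that by (simp only: good_def)
    also have "B * (Pm.shift m * Z * Pm.shift' m) * (Pm.shift m * W * Pm.shift' m)
        = B * (Pm.shift m * Z * (Pm.shift' m * Pm.shift m) * W * Pm.shift' m)" by (simp only: mult.assoc)
    also have "\<dots> = B * (Pm.shift m * (Z * W) * Pm.shift' m)"
      using cor by (simp add: Pm.shift_inverse mult.assoc)
    finally show ?thesis using cor by (simp add: good_def)
  qed
  have e: "good e"
    using B(1) by (simp add: good_def G.shift_inverse Pm.shift_inverse)
  have diff: "good (Z - W)" if "good Z" "good W" for Z W
    using that by (simp add: good_def left_diff_distrib right_diff_distrib)
  have cscale: "good (c *\<^sub>C Z)" if "good Z" for c Z
    using that by (simp add: good_def)
  have T: "good (T i)" if "1 \<le> i" "i < m" for i
  proof -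
    have "G.shift m * T i * G.shift' m * B = T (Suc i) * (G.shift m * G.shift' m) * B"
      unfolding G.shift_T[OF that] by (simp only: mult.assoc)
    moreover have "B * (Pm.shift m * T i * Pm.shift' m) = B * T (Suc i) * (Pm.shift m * Pm.shift' m)"
      unfolding Pm.shift_T[OF that] by (simp only: mult.assoc)
    moreover have "T (Suc i) * B = B * T (Suc i)"
      using that by (intro commutesD T_commutes B) auto
    ultimately show ?thesis by (simp add: good_def G.shift_inverse Pm.shift_inverse mult.assoc)
  qed
  have T': "good (T' i)" if "1 \<le> i" "i < m" for i
    unfolding T'_eq using that by (intro diff cscale T e)
  have L: "good L" if "1 \<le> m"
  proof -
    obtain p where "m = Suc p" using \<open>1 \<le> m\<close> by (cases m) auto
    then have "G.shift m * L * G.shift' m = G 1 * L * G' 1" "Pm.shift m * L * Pm.shift' m = Pm 1 * L * Pm 1"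
      using G.shift_first[OF free_L cor_L] Pm.shift_first[OF free_L cor_L] by auto
    then show ?thesis using rel by (simp add: good_def mult.assoc)
  qed
  have Lb: "good (Lb k)" if "k < m" for k
    using that by (induction k) (auto intro!: mult T T' L)
  have Lprod: "good (Lprod k)" if "k \<le> m" for k
    using that by (induction k) (auto intro!: mult Lb e)
  have As: "good (As k)" if "k \<le> m" for k
    using that
  proof (induction k)
    case (Suc k)
    \<comment> \<open>For k = 0 the coefficient [0] = 0 disposes of \<open>T 0\<close>, which the
      fact \<open>T\<close> does not cover.\<close>
    have "good (qint q k *\<^sub>C T k)"
      using Suc.prems cscale[OF e, of 0] by (cases "k = 0") (auto intro!: cscale T)
    with Suc show ?case by (auto intro!: mult cscale diff e)
  qed (simp add: e)
  have pw: "good (pw L j)" if "1 \<le> m" for j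
    using that by (induction j) (auto intro!: mult e L)
  have good: "good Z"
    using Z by (auto intro!: mult Lprod As pw)
  have free: "free j Z" if "m < j" for j
    using Z that by (auto intro!: free_mult free_Lprod free_As free_pw free_L)
  have free_B: "free k B" if "2 \<le> k" for k using B that by simp
  have "ttr 1 m Z * B = ttr 2 m (G.shift m * Z * G.shift' m) * B"
    using good free by (subst G.ttr_shift) (auto simp: good_def)
  also have "\<dots> = ttr 2 m (G.shift m * Z * G.shift' m * B)"
    by (rule ttr_right[symmetric]) (rule free_B)
  also have "\<dots> = B * ttr 2 m (Pm.shift m * Z * Pm.shift' m)"
    using good unfolding good_def by (simp add: ttr_left free_B)
  also have "\<dots> = B * ttr 1 m Z"
    using good free by (subst Pm.ttr_shift) (auto simp: good_def)
  finally show ?thesis by (simp add: commutes_def)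
qed

lemma el_central: "commutes (el m) X" "commutes (el m) Y"
  unfolding el_def
  using intertwine[OF shift_family_T' cor_XY(1) free_XY(1) conj_X, of "Lprod m * As m" m]
    intertwine[OF shift_family_T cor_XY(2) free_XY(2) conj_Y, of "Lprod m * As m" m] by auto

lemma ps_central: "commutes (ps j) X" "commutes (ps j) Y"
  unfolding ps_def
  using intertwine[OF shift_family_T' cor_XY(1) free_XY(1) conj_X, of "pw L j" 1]
    intertwine[OF shift_family_T cor_XY(2) free_XY(2) conj_Y, of "pw L j" 1] by auto

lemma ps_L: "commutes (ps j) L"
proof -
  have "ps j * Yi = Yi * (Y * ps j) * Yi" by (simp add: mult.assoc[symmetric] Y_inverse)
  also have "\<dots> = Yi * (ps j * Y) * Yi" using ps_central(2) by (simp add: commutes_def)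
  also have "\<dots> = Yi * ps j" by (simp add: mult.assoc Y_inverse)
  finally have "commutes (ps j) Yi" by (simp add: commutes_def)
  then show ?thesis unfolding L_def by (intro commutes_mult ps_central)
qed

lemma ps_T: "1 \<le> k \<Longrightarrow> commutes (ps j) (T k)" "1 \<le> k \<Longrightarrow> commutes (ps j) (T' k)"
  by (auto intro!: commutes_sym[OF T_commutes(1)] commutes_sym[OF T_commutes(2)] free_ps)

lemma ps_Lprod: "commutes (ps j) (Lprod m)"
proof -
  have "commutes (ps j) (Lb k)" for k
    by (induction k) (auto intro!: commutes_mult ps_L ps_T)
  then show ?thesis by (induction m) (auto intro!: commutes_mult commutes_e)
qed

text \<open>In the notation of the overview, \<open>mixed m j\<close> is x_(m+1,j): there are m + 1
  copies, the last one raised to the power \<open>j\<close>.\<close>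

definition mixed :: "nat \<Rightarrow> nat \<Rightarrow> 'r" where
  "mixed m j = ttr 1 (Suc m) (Lprod m * pw (Lb m) j * As (Suc m))"

text \<open>In the second term one A_m is moved around cyclically and absorbed by the other. Then
  L_(m+1)^j T_m = T_m L_m^j, so the last trace sees only T_m and gives \<open>q\<close>. At m = 0
  the coefficient [0] makes the truncated \<open>m - 1\<close> harmless.\<close>

lemma mixed_rec:
  "qint q (Suc m) *\<^sub>C mixed m j = q ^ m *\<^sub>C (ps j * el m) - (q * qint q m) *\<^sub>C mixed (m - 1) (Suc j)"
proof -
  let ?a = "As m" and ?p = "pw (Lb m) j"
  have a: "?a * ?a = ?a" by (rule hecke.anti_idem[OF order_refl])
  have "qint q (Suc m) *\<^sub>C As (Suc m) = q ^ m *\<^sub>C ?a - qint q m *\<^sub>C (?a * T m * ?a)"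
    using qint_nonzero[of "Suc m"] by (simp add: left_diff_distrib right_diff_distrib a)
  then have "qint q (Suc m) *\<^sub>C mixed m j
      = ttr 1 (Suc m) (Lprod m * ?p * (q ^ m *\<^sub>C ?a - qint q m *\<^sub>C (?a * T m * ?a)))"
    unfolding mixed_def by (simp only: mult_cscale_right[symmetric] ttr_cscale[symmetric])
  also have "\<dots> = q ^ m *\<^sub>C ttr 1 (Suc m) (Lprod m * ?p * ?a)
      - qint q m *\<^sub>C ttr 1 (Suc m) (Lprod m * ?p * (?a * T m * ?a))"
    by (simp only: right_diff_distrib mult_cscale_right ttr_diff ttr_cscale)
  also have "ttr 1 (Suc m) (Lprod m * ?p * ?a) = ps j * el m"
  proof -
    have free: "free (Suc m) (Lprod m)" "free (Suc m) ?a" by (auto intro: free_Lprod free_As)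
    have "ttr 1 (Suc m) (Lprod m * ?p * ?a) = ttr 1 m (Lprod m * ps j * ?a)"
      by (simp add: ptr_right[OF free(2)] ptr_left[OF free(1)] ptr_pw_Lb)
    also have "Lprod m * ps j * ?a = ps j * (Lprod m * ?a)"
      unfolding commutesD[OF ps_Lprod, symmetric] by (rule mult.assoc)
    finally show ?thesis by (simp add: ttr_left free_ps el_def)
  qed
  also have "qint q m *\<^sub>C ttr 1 (Suc m) (Lprod m * ?p * (?a * T m * ?a))
      = (q * qint q m) *\<^sub>C mixed (m - 1) (Suc j)"
  proof (cases m)
    case (Suc p)
    have free: "free (Suc m) (Lprod m)" "free (Suc m) (pw (Lb p) j)" "free (Suc m) ?a"
      by (intro free_Lprod free_As free_pw free_Lb; simp add: Suc)+
    have "commutes ?a (Lprod m * ?p)"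
      by (intro commutes_mult commutes_pw commutes_e commutes_sym[OF As_Lb] commutes_sym[OF As_Lprod]) simp
    then have "Lprod m * ?p * (?a * T m * ?a) = ?a * (Lprod m * ?p * T m * ?a)"
      by (simp add: commutes_def mult.assoc[symmetric])
    then have "ttr 1 (Suc m) (Lprod m * ?p * (?a * T m * ?a)) = ttr 1 (Suc m) (Lprod m * ?p * T m * ?a * ?a)"
      by (simp only:) (rule ttr_As_cyclic; simp)
    also have "Lprod m * ?p * T m * ?a * ?a = Lprod m * (?p * T m) * ?a"
      by (simp add: mult.assoc a)
    also have "?p * T m = T m * pw (Lb p) j"
    proof -
      have "?p = T m * pw (Lb p) j * T' m"
        unfolding Suc by (simp add: pw_conj T_inverse)
      then show ?thesis by (simp add: mult.assoc T_inverse)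
    qed
    also have "ttr 1 (Suc m) (Lprod m * (T m * pw (Lb p) j) * ?a) = q *\<^sub>C ttr 1 m (Lprod m * pw (Lb p) j * ?a)"
      by (simp add: ptr_right[OF free(2)] ptr_right[OF free(3)] ptr_left[OF free(1)] ptr_T)
    also have "ttr 1 m (Lprod m * pw (Lb p) j * ?a) = mixed p (Suc j)"
      by (simp add: mixed_def Suc mult.assoc)
    finally show ?thesis by (simp add: Suc mult.commute)
  qed simp
  finally show ?thesis .
qed

lemma mixed_sum:
  "qint q (Suc m) *\<^sub>C mixed m j = q ^ m *\<^sub>C (\<Sum>k\<le>m. (- 1) ^ k *\<^sub>C (ps (j + k) * el (m - k)))"
proof (induction m arbitrary: j)
  case 0
  then show ?case using mixed_rec[of 0 j] by simp
next
  case (Suc m)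
  have "qint q (Suc (Suc m)) *\<^sub>C mixed (Suc m) j
      = q ^ Suc m *\<^sub>C (ps j * el (Suc m)) - q *\<^sub>C (qint q (Suc m) *\<^sub>C mixed m (Suc j))"
    using mixed_rec[of "Suc m" j] by simp
  also have "\<dots> = q ^ Suc m *\<^sub>C (ps j * el (Suc m)
      + (\<Sum>k\<le>m. (- 1) ^ Suc k *\<^sub>C (ps (j + Suc k) * el (Suc m - Suc k))))"
    unfolding Suc by (simp add: cscale_add_right cscale_diff_right sum_negf)
  finally show ?case by (simp only: sum.atMost_Suc_shift) simp
qed

text \<open>The case j = 1, in which the mixed trace is \<open>el (Suc m)\<close> itself.\<close>

theorem newton:
  "qint q (Suc m) *\<^sub>C el (Suc m) = q ^ m *\<^sub>C (\<Sum>k\<le>m. (- 1) ^ k *\<^sub>C (ps (Suc k) * el (m - k)))"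
  using mixed_sum[of m 1] by (simp add: mixed_def el_def)

lemma el_vanishes: "n < m \<Longrightarrow> el m = 0"
proof -
  have "ttr 1 m 0 = 0" by (induction m) simp_all
  then show "n < m \<Longrightarrow> el m = 0" by (simp add: el_def As_vanishes)
qed

end

subsection \<open>Matrices over an algebra as operators\<close>

text \<open>An injective map compatible with the operations transfers all ring and module laws from
  a type class to a record at once; the additive inverse is multiplication by -1.\<close>

lemma calgI_embedding:
  fixes M :: "(complex, 'a) module" and \<phi> :: "'a \<Rightarrow> 'b::calgebra"
  assumes inj: "inj_on \<phi> (carrier M)"
    and closed: "\<zero>\<^bsub>M\<^esub> \<in> carrier M" "\<one>\<^bsub>M\<^esub> \<in> carrier M"
      "\<And>x y. x \<in> carrier M \<Longrightarrow> y \<in> carrier M \<Longrightarrow> x \<oplus>\<^bsub>M\<^esub> y \<in> carrier M"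
      "\<And>x y. x \<in> carrier M \<Longrightarrow> y \<in> carrier M \<Longrightarrow> x \<otimes>\<^bsub>M\<^esub> y \<in> carrier M"
      "\<And>c x. x \<in> carrier M \<Longrightarrow> c \<odot>\<^bsub>M\<^esub> x \<in> carrier M"
    and hom: "\<phi> \<zero>\<^bsub>M\<^esub> = 0"
      "\<And>x y. x \<in> carrier M \<Longrightarrow> y \<in> carrier M \<Longrightarrow> \<phi> (x \<oplus>\<^bsub>M\<^esub> y) = \<phi> x + \<phi> y"
      "\<And>x y. x \<in> carrier M \<Longrightarrow> y \<in> carrier M \<Longrightarrow> \<phi> (x \<otimes>\<^bsub>M\<^esub> y) = \<phi> x * \<phi> y"
      "\<And>c x. x \<in> carrier M \<Longrightarrow> \<phi> (c \<odot>\<^bsub>M\<^esub> x) = c *\<^sub>C \<phi> x"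
      "\<And>x. x \<in> carrier M \<Longrightarrow> \<phi> \<one>\<^bsub>M\<^esub> * \<phi> x = \<phi> x"
      "\<And>x. x \<in> carrier M \<Longrightarrow> \<phi> x * \<phi> \<one>\<^bsub>M\<^esub> = \<phi> x"
  shows "alg_map M \<phi>"
proof -
  have eq: "x = y" if "x \<in> carrier M" "y \<in> carrier M" "\<phi> x = \<phi> y" for x y
    using inj that by (auto dest: inj_onD)
  have "ring M"
  proof (rule ringI)
    show "abelian_group M"
    proof (rule abelian_groupI)
      fix x assume x: "x \<in> carrier M"
      then have "(- 1) \<odot>\<^bsub>M\<^esub> x \<oplus>\<^bsub>M\<^esub> x = \<zero>\<^bsub>M\<^esub>"
        by (intro eq) (simp_all add: closed hom)
      then show "\<exists>y\<in>carrier M. y \<oplus>\<^bsub>M\<^esub> x = \<zero>\<^bsub>M\<^esub>" using x closed by blast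
    qed (auto intro!: eq simp: closed hom algebra_simps)
    show "monoid M"
      by (rule monoidI) (auto intro!: eq simp: closed hom algebra_simps)
  qed (auto intro!: eq simp: closed hom algebra_simps)
  then interpret ring M .
  show ?thesis
    by unfold_locales (auto intro!: eq simp: closed hom cscale_distribs algebra_simps)
qed

text \<open>Local operators return \<open>0\<close> at sequences outside this range, so the common
  unit of the operators below is a projection and not the identity.\<close>

definition in_range :: "nat \<Rightarrow> (nat \<Rightarrow> nat) \<Rightarrow> bool" where
  "in_range n s \<longleftrightarrow> (\<forall>k. s k \<in> {1..n})"

text \<open>
  Vectors in an infinite tensor power are functions on sequences of indices in \<open>{1..n}\<close>;
  \<open>local_op n J X g\<close> maps \<open>v\<close> to \<open>s \<mapsto> \<Sum>\<^sub>j X s j (v (g s j))\<close>.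
\<close>

definition local_op :: "nat \<Rightarrow> 'j set \<Rightarrow> ((nat \<Rightarrow> nat) \<Rightarrow> 'j \<Rightarrow> 'k::complex_module endo) \<Rightarrow>
    ((nat \<Rightarrow> nat) \<Rightarrow> 'j \<Rightarrow> nat \<Rightarrow> nat) \<Rightarrow> ((nat \<Rightarrow> nat) \<Rightarrow> 'k) endo" where
  "local_op n J X g = Endo (\<lambda>v s. if in_range n s then \<Sum>j\<in>J. app (X s j) (v (g s j)) else 0)"

lemma app_local_op:
  "app (local_op n J X g) v s = (if in_range n s then \<Sum>j\<in>J. app (X s j) (v (g s j)) else 0)"
  unfolding local_op_def
  by (subst app_Endo) (auto simp: fun_eq_iff app_add_right sum.distrib cscale_sum_right)

definition get_idx :: "nat \<Rightarrow> (nat \<Rightarrow> nat) \<Rightarrow> nat list" where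
  "get_idx m s = map s [1..<Suc m]"

definition put_idx :: "nat \<Rightarrow> (nat \<Rightarrow> nat) \<Rightarrow> nat list \<Rightarrow> nat \<Rightarrow> nat" where
  "put_idx m s j = (\<lambda>k. if 1 \<le> k \<and> k \<le> m then j ! (k - 1) else s k)"

lemma length_multi_idx: "j \<in> multi_idx n m \<Longrightarrow> length j = m"
  by (simp add: multi_idx_def)

lemma multi_idx_nth: "i \<in> multi_idx n m \<Longrightarrow> k < m \<Longrightarrow> i ! k \<in> {1..n}"
  unfolding multi_idx_def using nth_mem by blast

lemma finite_multi_idx [simp]: "finite (multi_idx n m)"
proof -
  have "multi_idx n m = {is. set is \<subseteq> {1..n} \<and> length is = m}" by (auto simp: multi_idx_def)
  then show ?thesis using finite_lists_length_eq[of "{1..n}" m] by simp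
qed

lemma get_multi_idx [simp]: "in_range n s \<Longrightarrow> get_idx m s \<in> multi_idx n m"
  by (auto simp: get_idx_def multi_idx_def in_range_def)

lemma length_get [simp]: "length (get_idx m s) = m"
  by (simp add: get_idx_def)

lemma get_nth: "k < m \<Longrightarrow> get_idx m s ! k = s (Suc k)"
  by (simp add: get_idx_def del: upt_Suc)

lemma in_range_put [simp]: "in_range n s \<Longrightarrow> j \<in> multi_idx n m \<Longrightarrow> in_range n (put_idx m s j)"
  using multi_idx_nth[of j n m] by (auto simp: in_range_def put_idx_def)

lemma in_range_upd [simp]: "in_range n s \<Longrightarrow> 1 \<le> b \<Longrightarrow> b \<le> n \<Longrightarrow> in_range n (s(k := b))"
  by (auto simp: in_range_def)

lemma in_rangeD [simp]: "in_range n s \<Longrightarrow> 1 \<le> s k" "in_range n s \<Longrightarrow> Suc 0 \<le> s k" "in_range n s \<Longrightarrow> s k \<le> n"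
  by (auto simp: in_range_def)

lemma get_put_multi_idx [simp]: "j \<in> multi_idx n m \<Longrightarrow> get_idx m (put_idx m s j) = j"
  by (rule nth_equalityI) (auto simp: get_nth put_idx_def length_multi_idx)

lemma put_put [simp]: "put_idx m (put_idx m s j) l = put_idx m s l"
  by (rule ext) (auto simp: put_idx_def)

lemma put_get [simp]: "put_idx m s (get_idx m s) = s"
  by (rule ext) (auto simp: put_idx_def get_nth)

locale tensor_algebra = generic_parameter q + calg A
  for q and A :: "(complex, 'a) module" (structure) +
  fixes n :: nat
  assumes n_ge_1: "n \<ge> 1"
begin

abbreviation "em \<equiv> emb A"
abbreviation "idx \<equiv> multi_idx n"

sublocale em: alg_map A em by (rule emb_alg_map)

text \<open>The matrix acts on the first \<open>m\<close> arguments of a function, its entries act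
  through \<open>em\<close>, and the other factors are left alone. The matrix algebras for all
  \<open>m\<close> thus share one operator type.\<close>

definition opm :: "nat \<Rightarrow> 'a tmat \<Rightarrow> ((nat \<Rightarrow> nat) \<Rightarrow> 'a algprod) endo" where
  "opm m X = local_op n (idx m) (\<lambda>s j. em (X (get_idx m s, j))) (put_idx m)"

lemma app_opm: "app (opm m X) v s =
    (if in_range n s then \<Sum>j\<in>idx m. app (em (X (get_idx m s, j))) (v (put_idx m s j)) else 0)"
  by (simp add: opm_def app_local_op)

lemma tens_simps:
  "carrier (tens n m A) = (idx m \<times> idx m) \<rightarrow>\<^sub>E carrier A"
  "X \<otimes>\<^bsub>tens n m A\<^esub> Y = (\<lambda>(i, j) \<in> idx m \<times> idx m. \<Oplus>k \<in> idx m. X (i, k) \<otimes> Y (k, j))"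
  "\<one>\<^bsub>tens n m A\<^esub> = (\<lambda>(i, j) \<in> idx m \<times> idx m. if i = j then \<one> else \<zero>)"
  "\<zero>\<^bsub>tens n m A\<^esub> = (\<lambda>p \<in> idx m \<times> idx m. \<zero>)"
  "X \<oplus>\<^bsub>tens n m A\<^esub> Y = (\<lambda>p \<in> idx m \<times> idx m. X p \<oplus> Y p)"
  "c \<odot>\<^bsub>tens n m A\<^esub> X = (\<lambda>p \<in> idx m \<times> idx m. c \<odot> X p)"
  by (simp_all add: tens_def Let_def)

lemma tens_entry: "X \<in> carrier (tens n m A) \<Longrightarrow> i \<in> idx m \<Longrightarrow> j \<in> idx m \<Longrightarrow> X (i, j) \<in> carrier A"
  by (auto simp: tens_simps)

lemma tens_mult_closed: "\<lbrakk>X \<in> carrier (tens n m A); Y \<in> carrier (tens n m A)\<rbrakk> \<Longrightarrow>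
    X \<otimes>\<^bsub>tens n m A\<^esub> Y \<in> carrier (tens n m A)"
  using tens_entry[of X m] tens_entry[of Y m]
  by (auto simp: tens_simps intro!: restrict_PiE finsum_closed)

lemma em_mult_entry:
  assumes "X \<in> carrier (tens n m A)" "Y \<in> carrier (tens n m A)" "i \<in> idx m" "j \<in> idx m"
  shows "em ((X \<otimes>\<^bsub>tens n m A\<^esub> Y) (i, j)) = (\<Sum>k\<in>idx m. em (X (i, k)) * em (Y (k, j)))"
  using assms tens_entry[OF assms(1)] tens_entry[OF assms(2)]
  by (simp add: tens_simps(2) em.map_finsum em.map_mult)

lemma opm_inj: "inj_on (opm m) (carrier (tens n m A))"
proof (rule inj_onI)
  fix X Y assume X: "X \<in> carrier (tens n m A)" and Y: "Y \<in> carrier (tens n m A)" and eq: "opm m X = opm m Y"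
  \<comment> \<open>Vectors concentrated at a single sequence recover single entries. The positions
    beyond \<open>m\<close> are filled with 1, which is in range as n is at least 1.\<close>
  let ?s = "put_idx m (\<lambda>_. 1)"
  have range: "in_range n (?s i)" if "i \<in> idx m" for i
    using that n_ge_1 by (intro in_range_put) (simp_all add: in_range_def del: in_rangeD)
  have app: "app (opm m Z) (\<lambda>s. if s = ?s j then k else 0) (?s i) = app (em (Z (i, j))) k"
    if "i \<in> idx m" "j \<in> idx m" for i j k Z
  proof -
    have "put_idx m (?s i) l = ?s j \<longleftrightarrow> l = j" if "l \<in> idx m" for l
    proof
      assume "put_idx m (?s i) l = ?s j"
      then have "get_idx m (put_idx m (?s i) l) = get_idx m (?s j)" by (rule arg_cong)
      then show "l = j" using that \<open>j \<in> idx m\<close> by (metis get_put_multi_idx)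
    qed simp
    then have "app (opm m Z) (\<lambda>s. if s = ?s j then k else 0) (?s i)
        = (\<Sum>l\<in>idx m. if l = j then app (em (Z (i, j))) k else 0)"
      unfolding app_opm if_P[OF range[OF that(1)]] using that by (intro sum.cong refl) auto
    then show ?thesis using that by simp
  qed
  have "X (i, j) = Y (i, j)" if ij: "i \<in> idx m" "j \<in> idx m" for i j
  proof (rule emb_inj)
    show "em (X (i, j)) = em (Y (i, j))"
      using app[OF ij, of X] app[OF ij, of Y] eq by (intro endo_eqI) metis
  qed (use ij X Y tens_entry in auto)
  then show "X = Y"
    using X Y by (intro PiE_ext[of X _ _ Y]) (auto simp: tens_simps)
qed

lemma em_one_one [simp]: "app (em \<one>) (app (em \<one>) k) = app (em \<one>) k"
  using em.map_one_left[of \<one>] by (metis app_times one_closed)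

lemma em_one_left: "x \<in> carrier A \<Longrightarrow> app (em \<one>) (app (em x) k) = app (em x) k"
  and em_one_right: "x \<in> carrier A \<Longrightarrow> app (em x) (app (em \<one>) k) = app (em x) k"
  using em.map_one_left[of x] em.map_one_right[of x] by (metis app_times)+

lemma app_opm_one: "app (opm m \<one>\<^bsub>tens n m A\<^esub>) v s = (if in_range n s then app (em \<one>) (v s) else 0)"
proof (cases "in_range n s")
  case True
  have "app (opm m \<one>\<^bsub>tens n m A\<^esub>) v s
    = (\<Sum>j\<in>idx m. if get_idx m s = j then app (em \<one>) (v (put_idx m s j)) else 0)"
    unfolding app_opm if_P[OF True] by (intro sum.cong refl) (use True in \<open>auto simp: tens_simps(3)\<close>)
  then show ?thesis using True by simp
qed (simp add: app_opm)

text \<open>Through \<open>calgI_embedding\<close> this also establishes that the matrices form an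
  algebra.\<close>

lemma opm_alg_map: "alg_map (tens n m A) (opm m)"
proof (rule calgI_embedding[OF opm_inj])
  fix X Y :: "'a tmat" and c
  assume X: "X \<in> carrier (tens n m A)"
  note X' = tens_entry[OF X]
  show "opm m (c \<odot>\<^bsub>tens n m A\<^esub> X) = c *\<^sub>C opm m X"
    by (intro endo_eqI ext) (auto simp: app_opm tens_simps(6) em.map_smult X' cscale_sum_right)
  show "opm m \<one>\<^bsub>tens n m A\<^esub> * opm m X = opm m X"
    using X' by (intro endo_eqI ext)
      (simp add: app_opm_one app_opm[of m X] app_sum_right em_one_left)
  show "opm m X * opm m \<one>\<^bsub>tens n m A\<^esub> = opm m X"
    using X' by (intro endo_eqI ext)
      (simp add: app_opm_one app_opm[of m X] em_one_right)
  assume Y: "Y \<in> carrier (tens n m A)"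
  note Y' = tens_entry[OF Y]
  show "X \<otimes>\<^bsub>tens n m A\<^esub> Y \<in> carrier (tens n m A)"
    by (rule tens_mult_closed[OF X Y])
  show "opm m (X \<oplus>\<^bsub>tens n m A\<^esub> Y) = opm m X + opm m Y"
    by (intro endo_eqI ext) (auto simp: app_opm tens_simps(5) em.map_add X' Y' sum.distrib)
  show "opm m (X \<otimes>\<^bsub>tens n m A\<^esub> Y) = opm m X * opm m Y"
  proof (intro endo_eqI ext)
    fix v s
    show "app (opm m (X \<otimes>\<^bsub>tens n m A\<^esub> Y)) v s = app (opm m X * opm m Y) v s"
    proof (cases "in_range n s")
      case True
      have "app (opm m (X \<otimes>\<^bsub>tens n m A\<^esub> Y)) v s
        = (\<Sum>j\<in>idx m. \<Sum>k\<in>idx m. app (em (X (get_idx m s, k))) (app (em (Y (k, j))) (v (put_idx m s j))))"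
        using True by (simp add: app_opm em_mult_entry[OF X Y] app_sum)
      also have "\<dots> = (\<Sum>k\<in>idx m. \<Sum>j\<in>idx m. app (em (X (get_idx m s, k))) (app (em (Y (k, j))) (v (put_idx m s j))))"
        by (rule sum.swap)
      also have "\<dots> = app (opm m X * opm m Y) v s"
        using True by (simp add: app_opm app_sum_right)
      finally show ?thesis .
    qed (simp add: app_opm)
  qed
qed (auto simp: tens_simps app_opm fun_eq_iff intro!: endo_eqI)

lemma tens_calg: "calg (tens n m A)"
  using opm_alg_map alg_map.axioms(1) by blast

section \<open>The infinite tensor power as a system of matrix units\<close>

definition Eop :: "nat \<Rightarrow> nat \<Rightarrow> nat \<Rightarrow> ((nat \<Rightarrow> nat) \<Rightarrow> 'a algprod) endo" where
  "Eop k a b = local_op n {()} (\<lambda>s _. if s k = a \<and> a \<in> {1..n} \<and> b \<in> {1..n} then em \<one> else 0) (\<lambda>s _. s(k := b))"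

text \<open>An element of \<open>A\<close> as a scalar operator; complete traces take values of this
  form.\<close>

definition lam :: "'a \<Rightarrow> ((nat \<Rightarrow> nat) \<Rightarrow> 'a algprod) endo" where
  "lam x = local_op n {()} (\<lambda>_ _. em x) (\<lambda>s _. s)"

lemma app_Eop: "app (Eop k a b) v s
    = (if in_range n s \<and> s k = a \<and> b \<in> {1..n} then app (em \<one>) (v (s(k := b))) else 0)"
  by (auto simp: Eop_def app_local_op)

lemma app_lam: "app (lam x) v s = (if in_range n s then app (em x) (v s) else 0)"
  by (simp add: lam_def app_local_op)

lemma tensor_units_Eop: "tensor_units q n Eop (lam \<one>)"
proof unfold_locales
  show "lam \<one> * lam \<one> = lam \<one>"
    by (intro endo_eqI ext) (simp add: app_lam)
  show "lam \<one> * Eop k a b = Eop k a b" "Eop k a b * lam \<one> = Eop k a b" for k a b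
    by (intro endo_eqI ext; auto simp: app_lam app_Eop)+
  show "Eop k a b * Eop k c d = (if b = c \<and> b \<in> {1..n} then Eop k a d else 0)" for k a b c d
    by (intro endo_eqI ext) (auto simp: app_Eop)
  show "Eop k a b = 0" if "a \<notin> {1..n} \<or> b \<notin> {1..n}" for k a b
    using that by (intro endo_eqI ext) (auto simp: app_Eop)
  show "Eop k a b * Eop l c d = Eop l c d * Eop k a b" if "k \<noteq> l" for k l a b c d
    using that by (intro endo_eqI ext) (auto simp: app_Eop fun_upd_twist)
  show "(\<Sum>a\<in>{1..n}. Eop k a a) = lam \<one>" for k
  proof (intro endo_eqI ext)
    fix v s
    show "app (\<Sum>a\<in>{1..n}. Eop k a a) v s = app (lam \<one>) v s"
    proof (cases "in_range n s")
      case True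
      have "app (\<Sum>a\<in>{1..n}. Eop k a a) v s = (\<Sum>a\<in>{1..n}. if s k = a then app (em \<one>) (v s) else 0)"
        unfolding app_sum sum_fun_apply using True by (intro sum.cong refl) (auto simp: app_Eop)
      then show ?thesis using True by (simp add: app_lam)
    qed (simp add: app_sum sum_fun_apply app_Eop app_lam)
  qed
qed (rule n_ge_1)

sublocale tensor_units q n Eop "lam \<one>" by (rule tensor_units_Eop)

end

subsection \<open>R-matrices and copies as operators\<close>

lemma in_multi_idx_2: "i \<in> multi_idx n 2 \<longleftrightarrow> (\<exists>x\<in>{1..n}. \<exists>y\<in>{1..n}. i = [x, y])"
  by (auto simp: multi_idx_def length_Suc_conv eval_nat_numeral)

lemma in_multi_idx_1: "i \<in> multi_idx n (Suc 0) \<longleftrightarrow> (\<exists>x\<in>{1..n}. i = [x])"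
  by (auto simp: multi_idx_def length_Suc_conv)

lemma in_multi_idx_pair: "[x, y] \<in> multi_idx n 2 \<longleftrightarrow> x \<in> {1..n} \<and> y \<in> {1..n}"
  by (auto simp: multi_idx_def)

lemma complex_alg_simps [simp]:
  "carrier complex_alg = UNIV" "monoid.mult complex_alg = (*)" "one complex_alg = 1"
  "zero complex_alg = 0" "add complex_alg = (+)" "smult complex_alg = (*)"
  by (simp_all add: complex_alg_def)

lemma complex_alg_map: "alg_map complex_alg (\<lambda>x. x)"
  by (rule calgI_embedding) (auto simp: cscale_complex_def)

interpretation complex_alg: alg_map complex_alg "\<lambda>x. x"
  by (rule complex_alg_map)

lemma finsum_complex_alg: "finite S \<Longrightarrow> finsum complex_alg f S = sum f S"
  using complex_alg.map_finsum[of S f] by simp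

lemma P_mat_entry:
  assumes "x \<in> {1..n}" "y \<in> {1..n}" "z \<in> {1..n}" "t \<in> {1..n}"
  shows "P_mat n ([x, y], [z, t]) = (if z = y \<and> t = x then 1 else 0)"
proof -
  have "P_mat n ([x, y], [z, t]) = (\<Sum>i\<in>{1..n}. \<Sum>j\<in>{1..n}. unit_tensor i j j i ([x, y], [z, t]))"
    unfolding P_mat_def using assms by (simp only: restrict_apply mem_Sigma_iff in_multi_idx_pair simp_thms if_True)
  also have "\<dots> = (\<Sum>i\<in>{1..n}. \<Sum>j\<in>{1..n}. if i = x \<and> j = y then (if z = y \<and> t = x then 1 else 0) else 0)"
    by (intro sum.cong refl) (auto simp: unit_tensor_def)
  also have "\<dots> = (if z = y \<and> t = x then 1 else 0)"
    by (rule sum_sum_delta) (use assms in auto)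
  finally show ?thesis .
qed

context generic_parameter
begin

definition "R_diag x y = (if x = y then q else 1)" for x y :: nat
definition "R_off x y = (if y < x then q - inverse q else 0)" for x y :: nat

lemma R_mat_entry:
  assumes "x \<in> {1..n}" "y \<in> {1..n}" "z \<in> {1..n}" "t \<in> {1..n}"
  shows "R_mat n q ([x, y], [z, t]) = (if z = x \<and> t = y then R_diag x y else 0) + (if z = y \<and> t = x then R_off y x else 0)"
proof -
  let ?p = "([x, y], [z, t])"
  have 1: "(\<Sum>i\<in>{1..n}. unit_tensor i i i i ?p) = (if x = y \<and> z = x \<and> t = y then 1 else 0)"
  proof -
    have "(\<Sum>i\<in>{1..n}. unit_tensor i i i i ?p) = (\<Sum>i\<in>{1..n}. if i = x then (if x = y \<and> z = x \<and> t = y then 1 else 0) else 0)"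
      by (intro sum.cong refl) (auto simp: unit_tensor_def)
    then show ?thesis using assms by simp
  qed
  have 2: "(\<Sum>i\<in>{1..n}. \<Sum>j\<in>{1..n} - {i}. unit_tensor i i j j ?p) = (if x \<noteq> y \<and> z = x \<and> t = y then 1 else 0)"
  proof -
    have "(\<Sum>j\<in>{1..n} - {i}. unit_tensor i i j j ?p) = (\<Sum>j\<in>{1..n}. if i = x \<and> j = y then (if x \<noteq> y \<and> z = x \<and> t = y then 1 else 0) else 0)" for i
      by (intro sum.mono_neutral_cong_left) (auto simp: unit_tensor_def)
    then show ?thesis using assms by (simp only: sum_sum_delta finite_atLeastAtMost)
  qed
  have 3: "(\<Sum>i\<in>{1..n}. \<Sum>j\<in>{i<..n}. unit_tensor i j j i ?p) = (if x < y \<and> z = y \<and> t = x then 1 else 0)"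
  proof -
    have "(\<Sum>j\<in>{i<..n}. unit_tensor i j j i ?p) = (\<Sum>j\<in>{1..n}. if i = x \<and> j = y then (if x < y \<and> z = y \<and> t = x then 1 else 0) else 0)"
      if "i \<in> {1..n}" for i
      using that by (intro sum.mono_neutral_cong_left) (auto simp: unit_tensor_def)
    then show ?thesis using assms by (simp only: sum_sum_delta finite_atLeastAtMost cong: sum.cong)
  qed
  have R: "R_mat n q ?p = q * (\<Sum>i\<in>{1..n}. unit_tensor i i i i ?p)
     + (\<Sum>i\<in>{1..n}. \<Sum>j\<in>{1..n} - {i}. unit_tensor i i j j ?p)
     + (q - inverse q) * (\<Sum>i\<in>{1..n}. \<Sum>j\<in>{i<..n}. unit_tensor i j j i ?p)"
    unfolding R_mat_def using assms by (simp only: restrict_apply mem_Sigma_iff in_multi_idx_pair simp_thms if_True)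
  show ?thesis
    unfolding R 1 2 3 R_diag_def R_off_def
    by (smt (verit) less_irrefl mult.right_neutral mult_zero_right add.right_neutral add.left_neutral)
qed

lemma R_check_entry:
  assumes "x \<in> {1..n}" "y \<in> {1..n}" "z \<in> {1..n}" "t \<in> {1..n}"
  shows "R_check n q ([x, y], [z, t]) = (if z = x \<and> t = y then R_off x y else 0) + (if z = y \<and> t = x then R_diag y x else 0)"
proof -
  have "R_check n q ([x, y], [z, t]) = (\<Sum>k\<in>multi_idx n 2. P_mat n ([x, y], k) * R_mat n q (k, [z, t]))"
    using assms by (simp add: R_check_def tens_def Let_def in_multi_idx_pair finsum_complex_alg)
  also have "\<dots> = (\<Sum>k\<in>multi_idx n 2. if k = [y, x] then R_mat n q ([y, x], [z, t]) else 0)"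
    using assms by (intro sum.cong refl) (auto simp: in_multi_idx_2 P_mat_entry simp del: atLeastAtMost_iff split: if_splits)
  also have "\<dots> = R_mat n q ([y, x], [z, t])"
    using assms by (simp add: in_multi_idx_pair)
  also have "\<dots> = (if z = x \<and> t = y then R_off x y else 0) + (if z = y \<and> t = x then R_diag y x else 0)"
    using assms by (subst R_mat_entry) auto
  finally show ?thesis .
qed

end

lemma get_idx_eq_iff:
  assumes "l \<in> multi_idx n m" "ps \<subseteq> {1..m}" "\<And>p. p \<notin> ps \<Longrightarrow> s' p = s p"
  shows "get_idx m s' = l \<longleftrightarrow> (\<forall>p\<in>{1..m} - ps. get_idx m s ! (p - 1) = l ! (p - 1)) \<and> (\<forall>p\<in>ps. s' p = l ! (p - 1))"
proof -
  have "get_idx m s' = l \<longleftrightarrow> (\<forall>p\<in>{1..m}. s' p = l ! (p - 1))"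
  proof
    assume "\<forall>p\<in>{1..m}. s' p = l ! (p - 1)"
    then show "get_idx m s' = l"
      using length_multi_idx[OF assms(1)] by (intro nth_equalityI) (auto simp: get_nth)
  next
    assume "get_idx m s' = l"
    then have "l ! (p - 1) = s' p" if "p \<in> {1..m}" for p
      using that get_nth[of "p - 1" m s'] by auto
    then show "\<forall>p\<in>{1..m}. s' p = l ! (p - 1)" by simp
  qed
  also have "\<dots> \<longleftrightarrow> (\<forall>p\<in>{1..m} - ps. s' p = l ! (p - 1)) \<and> (\<forall>p\<in>ps. s' p = l ! (p - 1))"
    using assms(2) by blast
  also have "(\<forall>p\<in>{1..m} - ps. s' p = l ! (p - 1)) \<longleftrightarrow> (\<forall>p\<in>{1..m} - ps. get_idx m s ! (p - 1) = l ! (p - 1))"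
    by (intro ball_cong refl) (auto simp: get_nth assms(3))
  finally show ?thesis .
qed

lemma put_get_upd:
  assumes "\<And>p. \<not> (1 \<le> p \<and> p \<le> m) \<Longrightarrow> s' p = s p"
  shows "put_idx m s (get_idx m s') = s'"
  using assms by (intro ext) (auto simp: put_idx_def get_nth)

context tensor_algebra
begin

text \<open>Functions are coordinate vectors, so the value at \<open>s\<close> is fetched from the
  swapped sequence; this explains the transposed arguments of \<open>d\<close>.\<close>

lemma app_Smat: "app (Smat k c d) v s = (if in_range n s then
    app (em \<one>) (c (s k) (s (Suc k)) *\<^sub>C v s + d (s (Suc k)) (s k) *\<^sub>C v (s(k := s (Suc k), Suc k := s k))) else 0)"
proof (cases "in_range n s")
  case True
  have I: "s k \<in> I" "s (Suc k) \<in> I" using True by (auto simp: I_def)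
  have EE: "app (Eop k a b * Eop (Suc k) a' b') v s = (if a = s k \<and> a' = s (Suc k) then app (em \<one>) (v (s(k := b, Suc k := b'))) else 0)"
    if "b \<in> I" "b' \<in> I" for a b a' b'
    using that True by (simp add: app_Eop I_def)
  have "app (Smat k c d) v s = (\<Sum>i\<in>I. \<Sum>j\<in>I. (if i = s k \<and> j = s (Suc k) then c (s k) (s (Suc k)) *\<^sub>C app (em \<one>) (v s) else 0)
    + (if i = s (Suc k) \<and> j = s k then d (s (Suc k)) (s k) *\<^sub>C app (em \<one>) (v (s(k := s (Suc k), Suc k := s k))) else 0))"
    unfolding Smat_def app_sum sum_fun_apply
  proof (intro sum.cong refl)
    fix i j assume ij: "i \<in> I" "j \<in> I"
    have 1: "app (Eop k i i * Eop (Suc k) j j) v s = (if i = s k \<and> j = s (Suc k) then app (em \<one>) (v s) else 0)"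
      unfolding EE[OF ij] by (cases "i = s k \<and> j = s (Suc k)") auto
    have 2: "app (Eop k j i * Eop (Suc k) i j) v s
        = (if i = s (Suc k) \<and> j = s k then app (em \<one>) (v (s(k := s (Suc k), Suc k := s k))) else 0)"
      unfolding EE[OF ij] by (cases "i = s (Suc k) \<and> j = s k") auto
    show "app (c i j *\<^sub>C (Eop k i i * Eop (Suc k) j j) + d i j *\<^sub>C (Eop k j i * Eop (Suc k) i j)) v s
        = (if i = s k \<and> j = s (Suc k) then c (s k) (s (Suc k)) *\<^sub>C app (em \<one>) (v s) else 0)
        + (if i = s (Suc k) \<and> j = s k then d (s (Suc k)) (s k) *\<^sub>C app (em \<one>) (v (s(k := s (Suc k), Suc k := s k))) else 0)"
      unfolding app_plus app_cscale plus_fun_apply cscale_fun_apply 1 2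
      by (intro arg_cong2[where f = "(+)"]) simp_all
  qed
  then show ?thesis using True I
    by (simp add: sum.distrib sum_sum_delta app_add_right)
next
  case False
  then show ?thesis
    by (simp add: Smat_def app_sum sum_fun_apply app_Eop)
qed

lemma extend_closed: "extend_scalars n m A X \<in> carrier (tens n m A)"
  by (auto simp: extend_scalars_def tens_simps intro!: restrict_PiE)

lemma em_extend: "i \<in> idx m \<Longrightarrow> j \<in> idx m \<Longrightarrow> em (extend_scalars n m A X (i, j)) = X (i, j) *\<^sub>C em \<one>"
  by (simp add: extend_scalars_def em.map_smult)

lemma opm_extend_pair:
  assumes k: "1 \<le> k" "k < m"
    and Z: "\<And>x y z t. \<lbrakk>x \<in> {1..n}; y \<in> {1..n}; z \<in> {1..n}; t \<in> {1..n}\<rbrakk> \<Longrightarrow>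
      Z ([x, y], [z, t]) = (if z = x \<and> t = y then c x y else 0) + (if z = y \<and> t = x then d y x else 0)"
  shows "opm m (extend_scalars n m A (at_copies n m complex_alg [k, k + 1] Z)) = Smat k c d"
proof (intro endo_eqI ext)
  fix v and s :: "nat \<Rightarrow> nat"
  let ?Z = "extend_scalars n m A (at_copies n m complex_alg [k, k + 1] Z)"
  let ?s = "s(k := s (Suc k), Suc k := s k)"
  show "app (opm m ?Z) v s = app (Smat k c d) v s"
  proof (cases "in_range n s")
    case True
    then have s': "in_range n ?s" by simp
    have "app (em (?Z (get_idx m s, l))) (v (put_idx m s l))
      = (if get_idx m s = l then c (s k) (s (Suc k)) *\<^sub>C app (em \<one>) (v s) else 0)
      + (if get_idx m ?s = l then d (s (Suc k)) (s k) *\<^sub>C app (em \<one>) (v ?s) else 0)"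
      if l: "l \<in> idx m" for l
    proof -
      have 1: "get_idx m s = l \<longleftrightarrow> (\<forall>p\<in>{1..m} - {k, Suc k}. get_idx m s ! (p - 1) = l ! (p - 1)) \<and>
          l ! (k - 1) = s k \<and> l ! k = s (Suc k)"
        using get_idx_eq_iff[OF l, of "{k, Suc k}" s s] k by auto
      have 2: "get_idx m ?s = l \<longleftrightarrow> (\<forall>p\<in>{1..m} - {k, Suc k}. get_idx m s ! (p - 1) = l ! (p - 1)) \<and>
          l ! (k - 1) = s (Suc k) \<and> l ! k = s k"
        using get_idx_eq_iff[OF l, of "{k, Suc k}" ?s s] k by auto
      have "put_idx m s (get_idx m ?s) = ?s" by (rule put_get_upd) (use k in auto)
      then have put: "get_idx m ?s = l \<Longrightarrow> put_idx m s l = ?s" "get_idx m s = l \<Longrightarrow> put_idx m s l = s"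
        by auto
      have lk: "l ! (k - 1) \<in> {1..n}" "l ! k \<in> {1..n}" using multi_idx_nth[OF l] k by auto
      have nth: "get_idx m s ! (k - Suc 0) = s k" "get_idx m s ! k = s (Suc k)"
        using k by (auto simp: get_nth)
      have sk: "s k \<in> {1..n}" "s (Suc k) \<in> {1..n}" using True by auto
      have "at_copies n m complex_alg [k, k + 1] Z (get_idx m s, l)
        = (if \<forall>p\<in>{1..m} - {k, Suc k}. get_idx m s ! (p - 1) = l ! (p - 1)
          then Z ([s k, s (Suc k)], [l ! (k - 1), l ! k]) else 0)"
        using l True by (simp add: at_copies_def nth)
      also have "\<dots> = (if get_idx m s = l then c (s k) (s (Suc k)) else 0) + (if get_idx m ?s = l then d (s (Suc k)) (s k) else 0)"
        unfolding 1 2 Z[OF sk lk] by auto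
      finally have "at_copies n m complex_alg [k, k + 1] Z (get_idx m s, l)
        = (if get_idx m s = l then c (s k) (s (Suc k)) else 0) + (if get_idx m ?s = l then d (s (Suc k)) (s k) else 0)" .
      moreover have "v ?s = v s" if "get_idx m s = l" "get_idx m ?s = l"
        using put that by metis
      ultimately show ?thesis
        using l True put by (simp add: em_extend cscale_add_left)
    qed
    then have "app (opm m ?Z) v s = (\<Sum>l\<in>idx m.
        (if get_idx m s = l then c (s k) (s (Suc k)) *\<^sub>C app (em \<one>) (v s) else 0)
      + (if get_idx m ?s = l then d (s (Suc k)) (s k) *\<^sub>C app (em \<one>) (v ?s) else 0))"
      unfolding app_opm if_P[OF True] by (rule sum.cong[OF refl])
    then show ?thesis using True s' by (simp add: sum.distrib app_Smat app_add_right)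
  qed (simp add: app_opm app_Smat)
qed

lemma R_diag_eq: "R_diag = Td" and R_off_eq: "R_off = Tc"
  by (simp_all add: fun_eq_iff R_diag_def R_off_def Td_def Tc_def)

lemma opm_R_check: "1 \<le> k \<Longrightarrow> k < m \<Longrightarrow> opm m (extend_scalars n m A (R_check_at n q m k)) = T k"
  unfolding R_check_at_def T_def
  by (rule opm_extend_pair) (simp_all only: R_check_entry R_diag_eq R_off_eq)

text \<open>R has the coefficients of the braid operator with the diagonal and the swapping ones
  exchanged, which is the effect of multiplying by the permutation.\<close>

lemma opm_R_mat: "opm 2 (extend_scalars n 2 A (R_mat n q)) = Pm 1 * T 1"
proof -
  have "at_copies n 2 complex_alg [1, 1 + 1] (R_mat n q) = R_mat n q"
  proof
    fix p :: "nat list \<times> nat list"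
    show "at_copies n 2 complex_alg [1, 1 + 1] (R_mat n q) p = R_mat n q p"
    proof (cases "p \<in> multi_idx n 2 \<times> multi_idx n 2")
      case True
      then obtain x y z t where "p = ([x, y], [z, t])" by (auto simp: in_multi_idx_2)
      moreover have "{1..2} - set [1, 1 + 1 :: nat] = {}" by auto
      ultimately show ?thesis using True by (simp add: at_copies_def)
    next
      case False
      then show ?thesis by (auto simp: at_copies_def R_mat_def)
    qed
  qed
  moreover have "opm 2 (extend_scalars n 2 A (at_copies n 2 complex_alg [1, 1 + 1] (R_mat n q))) = Smat 1 Td Tc"
  proof (rule opm_extend_pair)
    fix x y z t assume "x \<in> {1..n}" "y \<in> {1..n}" "z \<in> {1..n}" "t \<in> {1..n}"
    from R_mat_entry[OF this] show "R_mat n q ([x, y], [z, t])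
        = (if z = x \<and> t = y then Td x y else 0) + (if z = y \<and> t = x then Tc y x else 0)"
      by (simp only: R_diag_eq R_off_eq)
  qed simp_all
  ultimately have "opm 2 (extend_scalars n 2 A (R_mat n q)) = Smat 1 Td Tc" by (simp only:)
  also have "\<dots> = Pm 1 * T 1"
    unfolding Pm_def T_def
    by (intro endo_eqI ext) (auto simp: app_Smat add.commute app_add_right fun_upd_twist)
  finally show ?thesis .
qed

text \<open>The operator of \<open>X\<close> in the factor \<open>k\<close>, in a form independent
  of the number of copies.\<close>

definition copy :: "nat \<Rightarrow> 'a tmat \<Rightarrow> ((nat \<Rightarrow> nat) \<Rightarrow> 'a algprod) endo" where
  "copy k X = local_op n I (\<lambda>s b. em (X ([s k], [b]))) (\<lambda>s b. s(k := b))"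

lemma app_copy: "app (copy k X) v s = (if in_range n s then \<Sum>b\<in>I. app (em (X ([s k], [b]))) (v (s(k := b))) else 0)"
  by (simp add: copy_def app_local_op)

text \<open>Nonzero entries occur only at multi-indices that agree with that of \<open>s\<close>
  outside the position \<open>k\<close>; these are parametrized by their \<open>k\<close>-th
  entry.\<close>

lemma opm_copy:
  assumes k: "1 \<le> k" "k \<le> m"
  shows "opm m (at_copies n m A [k] X) = copy k X"
proof (intro endo_eqI ext)
  fix v s
  show "app (opm m (at_copies n m A [k] X)) v s = app (copy k X) v s"
  proof (cases "in_range n s")
    case True
    let ?l = "\<lambda>b. get_idx m (s(k := b))"
    have inj: "inj_on ?l I"
      using k by (intro inj_onI) (auto dest!: arg_cong[of _ _ "\<lambda>l. l ! (k - 1)"] simp: get_nth)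
    have sub: "?l ` I \<subseteq> idx m" using True by (auto simp: I_def)
    have "app (opm m (at_copies n m A [k] X)) v s
      = (\<Sum>l\<in>idx m. app (em (at_copies n m A [k] X (get_idx m s, l))) (v (put_idx m s l)))"
      using True by (simp add: app_opm)
    also have "\<dots> = (\<Sum>l\<in>?l ` I. app (em (at_copies n m A [k] X (get_idx m s, l))) (v (put_idx m s l)))"
    proof (rule sum.mono_neutral_right)
      show "\<forall>l\<in>idx m - ?l ` I. app (em (at_copies n m A [k] X (get_idx m s, l))) (v (put_idx m s l)) = 0"
      proof
        fix l assume l: "l \<in> idx m - ?l ` I"
        have "l ! (k - 1) \<in> I" using l k multi_idx_nth[of l n m "k - 1"] by (auto simp: I_def)
        then have "get_idx m (s(k := l ! (k - 1))) \<noteq> l" using l image_eqI[of l ?l "l ! (k - 1)" I] by auto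
        then have "\<not> (\<forall>p\<in>{1..m} - {k}. get_idx m s ! (p - 1) = l ! (p - 1))"
          using get_idx_eq_iff[of l n m "{k}" "s(k := l ! (k - 1))" s] l k by auto
        then have "at_copies n m A [k] X (get_idx m s, l) = \<zero>"
          using l True by (auto simp: at_copies_def)
        then show "app (em (at_copies n m A [k] X (get_idx m s, l))) (v (put_idx m s l)) = 0" by simp
      qed
    qed (use sub in auto)
    also have "\<dots> = (\<Sum>b\<in>I. app (em (at_copies n m A [k] X (get_idx m s, ?l b))) (v (put_idx m s (?l b))))"
      using inj by (simp add: sum.reindex)
    also have "\<dots> = app (copy k X) v s"
      unfolding app_copy if_P[OF True]
    proof (intro sum.cong refl)
      fix b assume b: "b \<in> I"
      have "\<forall>p\<in>{1..m} - {k}. get_idx m s ! (p - 1) = ?l b ! (p - 1)"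
        by (auto simp: get_nth split: if_splits)
      then have "at_copies n m A [k] X (get_idx m s, ?l b) = X ([s k], [b])"
        using b True k by (auto simp: at_copies_def get_nth I_def)
      moreover have "put_idx m s (?l b) = s(k := b)" using k by (intro put_get_upd) auto
      ultimately show "app (em (at_copies n m A [k] X (get_idx m s, ?l b))) (v (put_idx m s (?l b)))
          = app (em (X ([s k], [b]))) (v (s(k := b)))" by simp
    qed
    finally show ?thesis .
  qed (simp add: app_opm app_copy)
qed

lemma at_copies_single:
  assumes X: "X \<in> carrier (tens n 1 A)"
  shows "at_copies n 1 A [1] X = X"
proof -
  have "X ([x], [y]) \<in> carrier A" if "x \<in> {1..n}" "y \<in> {1..n}" for x y
    using that by (intro tens_entry[OF X]) (auto simp: in_multi_idx_1)
  then show ?thesis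
    by (intro PiE_ext[of _ "idx 1 \<times> idx 1" "\<lambda>_. carrier A"])
      (use X in \<open>auto simp: at_copies_def tens_simps in_multi_idx_1 intro!: restrict_PiE\<close>)
qed

lemma opm_1: "X \<in> carrier (tens n 1 A) \<Longrightarrow> opm 1 X = copy 1 X"
  using opm_copy[of 1 1 X] at_copies_single[of X] by (simp only: order_refl)

lemma at_copies_closed:
  assumes X: "X \<in> carrier (tens n 1 A)" and k: "1 \<le> k" "k \<le> m"
  shows "at_copies n m A [k] X \<in> carrier (tens n m A)"
proof -
  have "X ([i ! (k - 1)], [j ! (k - 1)]) \<in> carrier A" if "i \<in> idx m" "j \<in> idx m" for i j
    using multi_idx_nth[OF that(1), of "k - 1"] multi_idx_nth[OF that(2), of "k - 1"] k
    by (intro tens_entry[OF X]) (auto simp: in_multi_idx_1)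
  then show ?thesis
    unfolding tens_simps(1) at_copies_def restrict_PiE_iff by auto
qed

lemma copy_entry: "X \<in> carrier (tens n 1 A) \<Longrightarrow> in_range n s \<Longrightarrow> b \<in> I \<Longrightarrow> X ([s k], [b]) \<in> carrier A"
  by (intro tens_entry[of X 1]) (auto simp: in_multi_idx_1 I_def)

lemma cor_copy: "X \<in> carrier (tens n 1 A) \<Longrightarrow> cor (copy k X)"
  by (intro corI endo_eqI ext; auto simp: app_lam app_copy app_sum_right em_one_left em_one_right copy_entry I_def intro!: sum.cong)

lemma free_copy:
  assumes "X \<in> carrier (tens n 1 A)" "j \<noteq> k"
  shows "free j (copy k X)"
  unfolding free_def commutes_def
proof (intro allI endo_eqI ext)
  fix a b v s
  show "app (Eop j a b * copy k X) v s = app (copy k X * Eop j a b) v s"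
  proof (cases "in_range n s \<and> s j = a \<and> b \<in> {1..n}")
    case True
    then show ?thesis
      using assms by (auto simp: app_Eop app_copy app_sum_right em_one_left em_one_right copy_entry I_def fun_upd_twist
        intro!: sum.cong)
  next
    case False
    then show ?thesis using assms(2) by (auto simp: app_Eop app_copy I_def intro!: sum.neutral)
  qed
qed

lemma swap_copy:
  assumes "X \<in> carrier (tens n 1 A)"
  shows "Pm 1 * copy 1 X * Pm 1 = copy 2 X"
proof (intro endo_eqI ext)
  fix v s
  show "app (Pm 1 * copy 1 X * Pm 1) v s = app (copy 2 X) v s"
    using assms by (auto simp: Pm_def app_Smat app_copy app_sum_right em_one_left em_one_right copy_entry I_def fun_upd_twist
        eval_nat_numeral intro!: sum.cong)
qed

subsection \<open>Partial traces of matrices\<close>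

definition weights :: "nat list \<Rightarrow> complex" where
  "weights i = (\<Prod>x\<leftarrow>i. weight x)"

text \<open>As \<open>opm\<close>, but with operators as entries. This form is preserved by partial
  traces, which makes them accessible to induction.\<close>

definition lop :: "nat \<Rightarrow> (nat list \<Rightarrow> nat list \<Rightarrow> 'a algprod endo) \<Rightarrow> ((nat \<Rightarrow> nat) \<Rightarrow> 'a algprod) endo" where
  "lop m X = local_op n (idx m) (\<lambda>s j. X (get_idx m s) j) (put_idx m)"

lemma app_lop: "app (lop m X) v s = (if in_range n s then \<Sum>j\<in>idx m. app (X (get_idx m s) j) (v (put_idx m s j)) else 0)"
  by (simp add: lop_def app_local_op)

lemma sum_multi_idx_Suc: "(\<Sum>j\<in>idx (Suc m). f j) = (\<Sum>j\<in>idx m. \<Sum>b\<in>I. f (j @ [b]))"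
  for f :: "nat list \<Rightarrow> 'b::comm_monoid_add"
proof -
  have "bij_betw (\<lambda>(j, b). j @ [b]) (idx m \<times> I) (idx (Suc m))"
  proof (rule bij_betwI[where g = "\<lambda>l. (butlast l, last l)"])
    show "(\<lambda>l. (butlast l, last l)) \<in> idx (Suc m) \<rightarrow> idx m \<times> I"
    proof
      fix l assume l: "l \<in> idx (Suc m)"
      then have "l \<noteq> []" by (auto simp: multi_idx_def)
      then have "last l \<in> set l" "set (butlast l) \<subseteq> set l" by (auto dest: in_set_butlastD)
      with l show "(butlast l, last l) \<in> idx m \<times> I" by (auto simp: multi_idx_def I_def)
    qed
  qed (auto simp: multi_idx_def I_def intro!: append_butlast_last_id)
  then have "(\<Sum>j\<in>idx (Suc m). f j) = (\<Sum>(j, b)\<in>idx m \<times> I. f (j @ [b]))"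
    by (subst sum.reindex_bij_betw[symmetric]) (auto simp: case_prod_unfold)
  then show ?thesis by (simp add: sum.cartesian_product)
qed

lemma get_idx_Suc: "get_idx (Suc m) s = get_idx m s @ [s (Suc m)]"
  by (simp add: get_idx_def)

lemma put_idx_snoc: "j \<in> idx m \<Longrightarrow> put_idx (Suc m) s (j @ [b]) = (put_idx m s j)(Suc m := b)"
  using length_multi_idx[of j n m] by (auto simp: fun_eq_iff put_idx_def nth_append le_Suc_eq)

lemma put_idx_upd: "put_idx m (s(Suc m := b)) j = (put_idx m s j)(Suc m := b)"
  by (auto simp: fun_eq_iff put_idx_def)

lemma get_idx_upd: "get_idx m (s(Suc m := b)) = get_idx m s"
  by (auto simp: get_idx_def)

text \<open>The surrounding matrix units force the row and the column index both to end in
  \<open>b\<close>, while the last argument of the function is left as it was.\<close>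

lemma ptr_lop:
  assumes X: "\<And>i j. em \<one> * X i j = X i j" "\<And>i j. X i j * em \<one> = X i j"
  shows "ptr (Suc m) (lop (Suc m) X) = lop m (\<lambda>i j. \<Sum>b\<in>I. weight b *\<^sub>C X (i @ [b]) (j @ [b]))"
proof (intro endo_eqI ext)
  fix v s
  have X': "app (em \<one>) (app (X i j) k) = app (X i j) k" "app (X i j) (app (em \<one>) k) = app (X i j) k" for i j k
    using X[of i j] by (metis app_times)+
  show "app (ptr (Suc m) (lop (Suc m) X)) v s = app (lop m (\<lambda>i j. \<Sum>b\<in>I. weight b *\<^sub>C X (i @ [b]) (j @ [b]))) v s"
  proof (cases "in_range n s")
    case True
    have summand: "app (Eop (Suc m) a b * lop (Suc m) X * Eop (Suc m) b a) v s
      = (if a = s (Suc m) then \<Sum>j\<in>idx m. app (X (get_idx m s @ [b]) (j @ [b])) (v (put_idx m s j)) else 0)"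
      if ab: "a \<in> I" "b \<in> I" for a b
    proof (cases "a = s (Suc m)")
      case a: True
      have s': "in_range n (s(Suc m := b))" using True ab by (auto simp: I_def)
      have "app (Eop (Suc m) a b * lop (Suc m) X * Eop (Suc m) b a) v s
        = (\<Sum>j\<in>idx (Suc m). app (X (get_idx m s @ [b]) j) (app (Eop (Suc m) b a) v (put_idx (Suc m) (s(Suc m := b)) j)))"
        using True ab a s' by (simp add: app_Eop app_lop I_def app_sum_right X' get_idx_Suc get_idx_upd)
      also have "\<dots> = (\<Sum>j\<in>idx m. \<Sum>c\<in>I. if c = b then app (X (get_idx m s @ [b]) (j @ [b])) (v (put_idx m s j)) else 0)"
        unfolding sum_multi_idx_Suc
      proof (intro sum.cong refl)
        fix j c assume j: "j \<in> idx m" and c: "c \<in> I"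
        have "in_range n ((put_idx m s j)(Suc m := c))"
          using True j c by (auto simp: I_def)
        moreover have "(put_idx m s j) (Suc m) = s (Suc m)" by (simp add: put_idx_def)
        then have "(put_idx m s j)(Suc m := a) = put_idx m s j" using a by auto
        ultimately show "app (X (get_idx m s @ [b]) (j @ [c])) (app (Eop (Suc m) b a) v (put_idx (Suc m) (s(Suc m := b)) (j @ [c])))
            = (if c = b then app (X (get_idx m s @ [b]) (j @ [b])) (v (put_idx m s j)) else 0)"
          using j ab by (auto simp: put_idx_snoc put_idx_upd app_Eop X' I_def)
      qed
      also have "\<dots> = (\<Sum>j\<in>idx m. app (X (get_idx m s @ [b]) (j @ [b])) (v (put_idx m s j)))"
        using ab by simp
      finally show ?thesis using a by simp
    qed (simp add: app_Eop)
    have "app (ptr (Suc m) (lop (Suc m) X)) v s = (\<Sum>a\<in>I. \<Sum>b\<in>I. if a = s (Suc m) then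
        weight b *\<^sub>C (\<Sum>j\<in>idx m. app (X (get_idx m s @ [b]) (j @ [b])) (v (put_idx m s j))) else 0)"
      unfolding ptr_def app_sum sum_fun_apply
      by (intro sum.cong refl) (simp add: summand del: app_times)
    also have "\<dots> = (\<Sum>a\<in>I. if a = s (Suc m) then \<Sum>b\<in>I.
        weight b *\<^sub>C (\<Sum>j\<in>idx m. app (X (get_idx m s @ [b]) (j @ [b])) (v (put_idx m s j))) else 0)"
      by (intro sum.cong refl) simp
    also have "\<dots> = (\<Sum>b\<in>I. weight b *\<^sub>C (\<Sum>j\<in>idx m. app (X (get_idx m s @ [b]) (j @ [b])) (v (put_idx m s j))))"
      using True by (simp add: I_def)
    also have "\<dots> = (\<Sum>j\<in>idx m. \<Sum>b\<in>I. weight b *\<^sub>C app (X (get_idx m s @ [b]) (j @ [b])) (v (put_idx m s j)))"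
      by (simp only: cscale_sum_right) (rule sum.swap)
    finally show ?thesis using True by (simp add: app_lop app_sum)
  qed (simp add: ptr_def app_sum sum_fun_apply app_Eop app_lop)
qed

lemma ttr_lop:
  assumes "\<And>i j. em \<one> * X i j = X i j" "\<And>i j. X i j * em \<one> = X i j"
  shows "ttr 1 m (lop m X) = lop 0 (\<lambda>_ _. \<Sum>i\<in>idx m. weights i *\<^sub>C X i i)"
  using assms
proof (induction m arbitrary: X)
  case 0
  have "idx 0 = {[]}" by (auto simp: multi_idx_def)
  then show ?case by (intro endo_eqI ext) (auto simp: app_lop weights_def get_idx_def)
next
  case (Suc m)
  have "ttr 1 (Suc m) (lop (Suc m) X) = ttr 1 m (lop m (\<lambda>i j. \<Sum>b\<in>I. weight b *\<^sub>C X (i @ [b]) (j @ [b])))"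
    using ptr_lop[OF Suc.prems] by simp
  also have "\<dots> = lop 0 (\<lambda>_ _. \<Sum>i\<in>idx m. weights i *\<^sub>C (\<Sum>b\<in>I. weight b *\<^sub>C X (i @ [b]) (i @ [b])))"
    by (rule Suc.IH) (simp_all add: sum_distrib_left sum_distrib_right Suc.prems)
  also have "\<dots> = lop 0 (\<lambda>_ _. \<Sum>i\<in>idx (Suc m). weights i *\<^sub>C X i i)"
    by (simp add: sum_multi_idx_Suc cscale_sum_right weights_def)
  finally show ?case .
qed

text \<open>The factors are diagonal. The list of copies is arbitrary because the tail of the list
  1, ..., m is not of the same form.\<close>

lemma list_prod_weights:
  assumes "set ks \<subseteq> {1..m}" "i \<in> idx m" "j \<in> idx m"
  shows "list_prod (tens n m complex_alg) (map (\<lambda>k. at_copies n m complex_alg [k] (D_mat n q)) ks) (i, j)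
    = (if i = j then \<Prod>k\<leftarrow>ks. weight (i ! (k - 1)) else 0)"
  using assms
proof (induction ks arbitrary: i)
  case Nil
  then show ?case by (simp add: list_prod_def tens_def Let_def)
next
  case (Cons k ks)
  have D: "at_copies n m complex_alg [k] (D_mat n q) (i, l) = (if i = l then weight (i ! (k - 1)) else 0)"
    if l: "l \<in> idx m" for l
  proof -
    have "i ! (k - 1) \<in> {1..n}" "l ! (k - 1) \<in> {1..n}"
      using multi_idx_nth[of i n m "k - 1"] multi_idx_nth[of l n m "k - 1"] Cons.prems l by auto
    then have "D_mat n q ([i ! (k - 1)], [l ! (k - 1)]) = (if i ! (k - 1) = l ! (k - 1) then weight (i ! (k - 1)) else 0)"
      by (simp add: D_mat_def in_multi_idx_1 weight_def)
    moreover have "i = l \<longleftrightarrow> (\<forall>p\<in>{1..m} - {k}. i ! (p - 1) = l ! (p - 1)) \<and> i ! (k - 1) = l ! (k - 1)"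
    proof
      assume *: "(\<forall>p\<in>{1..m} - {k}. i ! (p - 1) = l ! (p - 1)) \<and> i ! (k - 1) = l ! (k - 1)"
      show "i = l"
      proof (rule nth_equalityI)
        show "i ! p = l ! p" if "p < length i" for p
          using * that length_multi_idx[OF Cons.prems(2)] by (cases "Suc p = k") (auto dest!: bspec[of _ _ "Suc p"])
      qed (use length_multi_idx Cons.prems l in metis)
    qed auto
    ultimately show ?thesis
      using Cons.prems l by (auto simp: at_copies_def)
  qed
  have "list_prod (tens n m complex_alg) (map (\<lambda>k. at_copies n m complex_alg [k] (D_mat n q)) (k # ks)) (i, j)
    = (\<Sum>l\<in>idx m. at_copies n m complex_alg [k] (D_mat n q) (i, l) *
        list_prod (tens n m complex_alg) (map (\<lambda>k. at_copies n m complex_alg [k] (D_mat n q)) ks) (l, j))"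
    using Cons.prems by (simp add: list_prod_def tens_def Let_def finsum_complex_alg)
  also have "\<dots> = (\<Sum>l\<in>idx m. if i = l then weight (i ! (k - 1)) *
        (if l = j then \<Prod>k\<leftarrow>ks. weight (l ! (k - 1)) else 0) else 0)"
    using Cons by (intro sum.cong refl) (auto simp: D)
  also have "\<dots> = (if i = j then \<Prod>k\<leftarrow>k # ks. weight (i ! (k - 1)) else 0)"
    using Cons.prems by simp
  finally show ?case .
qed

lemma weights_eq: "i \<in> idx m \<Longrightarrow> (\<Prod>k\<leftarrow>[1..<m + 1]. weight (i ! (k - 1))) = weights i"
proof -
  assume "i \<in> idx m"
  then have "map (\<lambda>k. weight (i ! (k - 1))) [1..<m + 1] = map weight i"
    by (intro nth_equalityI) (auto simp: length_multi_idx simp del: upt_Suc)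
  then show ?thesis by (simp only: weights_def)
qed

lemma q_trace_closed: "Y \<in> carrier (tens n m A) \<Longrightarrow> q_trace n q m A Y \<in> carrier A"
  unfolding q_trace_def tens_trace_def
  by (intro finsum_closed) (auto intro!: tens_entry tens_mult_closed extend_closed)

text \<open>The link between the trace in the definitions and the iterated partial traces: as D_1
  ... D_m is diagonal, it just puts weights on the diagonal entries of \<open>Y\<close>.\<close>

theorem lam_q_trace:
  assumes Y: "Y \<in> carrier (tens n m A)"
  shows "lam (q_trace n q m A Y) = ttr 1 m (opm m Y)"
proof -
  define Dm where "Dm = list_prod (tens n m complex_alg) (map (\<lambda>k. at_copies n m complex_alg [k] (D_mat n q)) [1..<m + 1])"
  \<comment> \<open>Cutting off to \<open>0\<close> outside the index set makes
    \<open>em \<one>\<close> neutral for all indices, as \<open>ttr_lop\<close> requires.\<close>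
  let ?X = "\<lambda>i j. if i \<in> idx m \<and> j \<in> idx m then em (Y (i, j)) else 0"
  have D: "Dm (i, j) = (if i = j then weights i else 0)" if "i \<in> idx m" "j \<in> idx m" for i j
  proof -
    have sub: "set [1..<m + 1] \<subseteq> {1..m}" by auto
    show ?thesis by (simp only: Dm_def list_prod_weights[OF sub that] weights_eq[OF that(1)])
  qed
  have "em (q_trace n q m A Y) = (\<Sum>i\<in>idx m. \<Sum>k\<in>idx m. em (extend_scalars n m A Dm (i, k)) * em (Y (k, i)))"
    unfolding q_trace_def tens_trace_def Dm_def[symmetric]
    by (subst em.map_finsum) (auto simp: em_mult_entry[OF extend_closed Y] intro!: tens_entry tens_mult_closed extend_closed Y)
  also have "\<dots> = (\<Sum>i\<in>idx m. \<Sum>k\<in>idx m. if i = k then weights i *\<^sub>C em (Y (i, i)) else 0)"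
    by (intro sum.cong refl) (auto simp: em_extend D em.map_one_left tens_entry[OF Y] simp del: upt_Suc)
  also have "\<dots> = (\<Sum>i\<in>idx m. weights i *\<^sub>C ?X i i)" by simp
  finally have q: "em (q_trace n q m A Y) = (\<Sum>i\<in>idx m. weights i *\<^sub>C ?X i i)" .
  have "opm m Y = lop m ?X"
    by (intro endo_eqI ext) (simp add: app_opm app_lop)
  then have "ttr 1 m (opm m Y) = lop 0 (\<lambda>_ _. \<Sum>i\<in>idx m. weights i *\<^sub>C ?X i i)"
    using Y by (simp only:) (rule ttr_lop; auto simp: em.map_one_left em.map_one_right tens_entry)
  also have "\<dots> = lop 0 (\<lambda>_ _. em (q_trace n q m A Y))" by (simp only: q)
  also have "\<dots> = lam (q_trace n q m A Y)"
  proof -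
    have "idx 0 = {[]}" by (auto simp: multi_idx_def)
    moreover have "put_idx 0 s j = s" for s j by (rule ext) (simp add: put_idx_def)
    ultimately show ?thesis by (intro endo_eqI ext) (simp add: app_lop app_lam)
  qed
  finally show ?thesis by simp
qed

end

subsection \<open>The relations of the quantized enveloping algebra\<close>

lemma free_alg_calg: "calg (free_alg S)"
proof -
  interpret ring "free_alg S" by (rule free_alg_ring)
  show ?thesis
  proof unfold_locales
    show "x \<otimes>\<^bsub>free_alg S\<^esub> (c \<odot>\<^bsub>free_alg S\<^esub> y) = c \<odot>\<^bsub>free_alg S\<^esub> (x \<otimes>\<^bsub>free_alg S\<^esub> y)" for c x y
      by (simp only: free_alg_simps mult.assoc[symmetric] nc_const_commute)
  qed (simp_all add: distrib_left distrib_right nc_const_add nc_const_mult mult.assoc)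
qed

text \<open>The geometric series: a \<open>w\<close> with w (1 - z) = 1 - z^k is extended by z^k at
  each step.\<close>

lemma (in ring) one_minus_nilpotent_unit:
  assumes z: "z \<in> carrier R" and nil: "z [^] (k :: nat) = \<zero>"
  shows "\<one> \<ominus> z \<in> Units R"
proof -
  have "\<exists>w\<in>carrier R. w \<otimes> (\<one> \<ominus> z) = \<one> \<ominus> z [^] k \<and> (\<one> \<ominus> z) \<otimes> w = \<one> \<ominus> z [^] k" for k :: nat
  proof (induction k)
    case 0
    then show ?case using z by (intro bexI[of _ \<zero>]) (auto simp: minus_eq r_neg)
  next
    case (Suc k)
    then obtain w where w: "w \<in> carrier R" "w \<otimes> (\<one> \<ominus> z) = \<one> \<ominus> z [^] k" "(\<one> \<ominus> z) \<otimes> w = \<one> \<ominus> z [^] k"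
      by auto
    have p: "z [^] k \<in> carrier R" using z by simp
    have comm: "z \<otimes> z [^] k = z [^] Suc k" using z by (simp only: nat_pow_Suc2)
    have "(w \<oplus> z [^] k) \<otimes> (\<one> \<ominus> z) = (w \<otimes> (\<one> \<ominus> z)) \<oplus> (z [^] k \<ominus> z [^] k \<otimes> z)"
      using w(1) z p by (simp add: minus_eq l_distr r_distr r_minus l_minus minus_add a_ac)
    also have "\<dots> = \<one> \<ominus> z [^] Suc k"
      unfolding w(2) nat_pow_Suc using z p by algebra
    finally have 1: "(w \<oplus> z [^] k) \<otimes> (\<one> \<ominus> z) = \<one> \<ominus> z [^] Suc k" .
    have "(\<one> \<ominus> z) \<otimes> (w \<oplus> z [^] k) = ((\<one> \<ominus> z) \<otimes> w) \<oplus> (z [^] k \<ominus> z \<otimes> z [^] k)"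
      using w(1) z p by (simp add: minus_eq l_distr r_distr r_minus l_minus minus_add a_ac)
    also have "\<dots> = \<one> \<ominus> z [^] Suc k"
      unfolding w(3) comm nat_pow_Suc using z p by algebra
    finally show ?case using 1 w(1) p by blast
  qed
  from this[of k] obtain w where "w \<in> carrier R" "w \<otimes> (\<one> \<ominus> z) = \<one>" "(\<one> \<ominus> z) \<otimes> w = \<one>"
    unfolding nil by (auto simp: minus_eq)
  then show ?thesis using z by (auto simp: Units_def)
qed

text \<open>The two units supply a left and a right inverse of \<open>x\<close>, and these
  coincide.\<close>

lemma (in monoid) unit_if_one_sided_units:
  assumes x: "x \<in> carrier G" "y \<in> carrier G" "y' \<in> carrier G"
    and units: "y \<otimes> x \<in> Units G" "x \<otimes> y' \<in> Units G"
  shows "x \<in> Units G"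
proof -
  let ?l = "inv (y \<otimes> x) \<otimes> y" and ?r = "y' \<otimes> inv (x \<otimes> y')"
  have l: "?l \<otimes> x = \<one>" using x units by (simp add: m_assoc)
  have r: "x \<otimes> ?r = \<one>" using x units by (simp add: m_assoc[symmetric])
  have "?l = ?r" using l r x units by (intro inv_unique[of ?l x ?r]) auto
  then have "?r \<otimes> x = \<one>" using l by simp
  moreover have "?r \<in> carrier G" using x units by simp
  ultimately show ?thesis using r x(1) unfolding Units_def by blast
qed

locale quantum_gl = generic_parameter q for q +
  fixes n :: nat
  assumes n_ge_one: "n \<ge> 1"
begin

abbreviation "gens \<equiv> uq_gens n"
abbreviation "rls \<equiv> uq_rels n q"
abbreviation "FA \<equiv> free_alg gens"
abbreviation "U \<equiv> Uq_gl n q"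

sublocale F: tensor_algebra q FA n
  by (intro tensor_algebra.intro generic_parameter_axioms free_alg_calg tensor_algebra_axioms.intro n_ge_one)

lemma gens_iff [simp]: "Lplus a b \<in> gens \<longleftrightarrow> a \<in> {1..n} \<and> b \<in> {1..n}"
  "Lminus a b \<in> gens \<longleftrightarrow> a \<in> {1..n} \<and> b \<in> {1..n}"
  by (auto simp: uq_gens_def)

lemma gen_closed: "a \<in> {1..n} \<Longrightarrow> b \<in> {1..n} \<Longrightarrow> nc_gen (Lplus a b) \<in> carrier FA"
  "a \<in> {1..n} \<Longrightarrow> b \<in> {1..n} \<Longrightarrow> nc_gen (Lminus a b) \<in> carrier FA"
  by (auto intro!: free_alg_closed(4))

lemma free_mat_closed: "free_mat n Lplus \<in> carrier (tens n 1 FA)" "free_mat n Lminus \<in> carrier (tens n 1 FA)"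
  by (auto simp: free_mat_def F.tens_simps restrict_PiE_iff in_multi_idx_1 gen_closed simp del: restrict_PiE)

lemma RLL_rels_closed:
  assumes X: "X \<in> carrier (tens n 1 FA)" and Y: "Y \<in> carrier (tens n 1 FA)"
  shows "RLL_rels n q X Y \<subseteq> carrier FA"
proof -
  interpret T: calg "tens n 2 FA" by (rule F.tens_calg)
  have c: "at_copies n 2 FA [1] X \<in> carrier (tens n 2 FA)" "at_copies n 2 FA [2] Y \<in> carrier (tens n 2 FA)"
    using X Y by (auto intro: F.at_copies_closed)
  show ?thesis
    using c F.extend_closed[of 2 "R_mat n q"]
    by (auto simp: RLL_rels_def Let_def intro!: free_alg_diff F.tens_entry[of _ 2] T.m_closed)
qed

sublocale pr: presentation gens rls
proof
  show "rls \<subseteq> carrier FA"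
    unfolding uq_rels_def
    using RLL_rels_closed[OF free_mat_closed(1) free_mat_closed(1)]
      RLL_rels_closed[OF free_mat_closed(2) free_mat_closed(2)]
      RLL_rels_closed[OF free_mat_closed(1) free_mat_closed(2)]
    by (auto intro!: gen_closed free_alg_diff free_alg_closed)
qed

lemma U_eq: "pr.Q = U" by (simp add: Uq_gl_def)

lemma U_calg: "calg U" using pr.calg_axioms by (simp only: U_eq)

sublocale U: tensor_algebra q U n
  by (intro tensor_algebra.intro generic_parameter_axioms U_calg tensor_algebra_axioms.intro n_ge_one)

lemma cls_closed: "x \<in> carrier FA \<Longrightarrow> pr.cls x \<in> carrier U"
  using pr.cls_closed[of x] by (simp only: U_eq)

lemma cls_map: "alg_map FA (\<lambda>x. U.em (pr.cls x))"
proof (intro alg_map.intro free_alg_calg alg_map_axioms.intro)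
  show "U.em (pr.cls (c \<odot>\<^bsub>FA\<^esub> x)) = c *\<^sub>C U.em (pr.cls x)" if "x \<in> carrier FA" for c x
    using that by (simp add: cls_closed pr.cls_smult U_eq U.em.map_smult)
qed (simp_all add: cls_closed pr.cls_mult pr.cls_add U_eq U.em.map_mult U.em.map_add)

lemma uq_mat_entry: "a \<in> {1..n} \<Longrightarrow> b \<in> {1..n} \<Longrightarrow> uq_mat n q G ([a], [b]) = pr.cls (nc_gen (G a b))"
  by (simp add: uq_mat_def in_multi_idx_1)

lemma uq_mat_closed: "uq_mat n q Lplus \<in> carrier (tens n 1 U)" "uq_mat n q Lminus \<in> carrier (tens n 1 U)"
  by (auto simp: uq_mat_def U.tens_simps restrict_PiE_iff in_multi_idx_1 gen_closed cls_closed simp del: restrict_PiE)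

lemma cls_at_copies:
  assumes "i \<in> multi_idx n 2" "j \<in> multi_idx n 2" "k \<in> {1, 2}"
  shows "pr.cls (at_copies n 2 FA [k] (free_mat n G) (i, j)) = at_copies n 2 U [k] (uq_mat n q G) (i, j)"
  using assms multi_idx_nth[OF assms(1), of "k - 1"] multi_idx_nth[OF assms(2), of "k - 1"]
  by (auto simp: at_copies_def free_mat_def uq_mat_def in_multi_idx_1 pr.cls_zero U_eq)

text \<open>The relations are entries over the free algebra. They are carried entry by entry to
  matrices over \<open>U\<close> and then to operators, where R becomes the permutation times the
  braid operator.\<close>

lemma RLL_relation:
  assumes G: "(G, H) \<in> {(Lplus, Lplus), (Lminus, Lminus), (Lplus, Lminus)}"
  shows "U.T 1 * U.opm 1 (uq_mat n q G) * (U.Pm 1 * U.opm 1 (uq_mat n q H) * U.Pm 1)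
    = U.opm 1 (uq_mat n q H) * (U.Pm 1 * U.opm 1 (uq_mat n q G) * U.Pm 1) * U.T 1"
proof -
  interpret TF: calg "tens n 2 FA" by (rule F.tens_calg)
  interpret TU: alg_map "tens n 2 U" "U.opm 2" by (rule U.opm_alg_map)
  interpret c: alg_map FA "\<lambda>x. U.em (pr.cls x)" by (rule cls_map)
  let ?RF = "extend_scalars n 2 FA (R_mat n q)" and ?RU = "extend_scalars n 2 U (R_mat n q)"
  let ?XF = "at_copies n 2 FA [1] (free_mat n G)" and ?YF = "at_copies n 2 FA [2] (free_mat n H)"
  let ?XU = "at_copies n 2 U [1] (uq_mat n q G)" and ?YU = "at_copies n 2 U [2] (uq_mat n q H)"
  have free: "free_mat n G \<in> carrier (tens n 1 FA)" "free_mat n H \<in> carrier (tens n 1 FA)"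
    and uq: "uq_mat n q G \<in> carrier (tens n 1 U)" "uq_mat n q H \<in> carrier (tens n 1 U)"
    using G free_mat_closed uq_mat_closed by auto
  have F: "?RF \<in> carrier (tens n 2 FA)" "?XF \<in> carrier (tens n 2 FA)" "?YF \<in> carrier (tens n 2 FA)"
    using free by (auto intro: F.at_copies_closed F.extend_closed)
  have U: "?RU \<in> carrier (tens n 2 U)" "?XU \<in> carrier (tens n 2 U)" "?YU \<in> carrier (tens n 2 U)"
    using uq by (auto intro: U.at_copies_closed U.extend_closed)
  have mult: "U.em (pr.cls ((A \<otimes>\<^bsub>tens n 2 FA\<^esub> B) (i, j))) = U.em ((A' \<otimes>\<^bsub>tens n 2 U\<^esub> B') (i, j))"
    if A: "A \<in> carrier (tens n 2 FA)" "A' \<in> carrier (tens n 2 U)"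
        "\<And>i j. i \<in> multi_idx n 2 \<Longrightarrow> j \<in> multi_idx n 2 \<Longrightarrow> U.em (pr.cls (A (i, j))) = U.em (A' (i, j))"
      and B: "B \<in> carrier (tens n 2 FA)" "B' \<in> carrier (tens n 2 U)"
        "\<And>i j. i \<in> multi_idx n 2 \<Longrightarrow> j \<in> multi_idx n 2 \<Longrightarrow> U.em (pr.cls (B (i, j))) = U.em (B' (i, j))"
      and ij: "i \<in> multi_idx n 2" "j \<in> multi_idx n 2" for A B A' B' i j
  proof -
    have e: "A (i, k) \<in> carrier FA" "B (k, j) \<in> carrier FA" if "k \<in> multi_idx n 2" for k
      using F.tens_entry[OF A(1)] F.tens_entry[OF B(1)] that ij by auto
    have "(A \<otimes>\<^bsub>tens n 2 FA\<^esub> B) (i, j) = (\<Oplus>\<^bsub>FA\<^esub>k\<in>multi_idx n 2. A (i, k) \<otimes>\<^bsub>FA\<^esub> B (k, j))"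
      using ij by (simp add: F.tens_simps(2))
    then have "U.em (pr.cls ((A \<otimes>\<^bsub>tens n 2 FA\<^esub> B) (i, j)))
        = (\<Sum>k\<in>multi_idx n 2. U.em (pr.cls (A (i, k) \<otimes>\<^bsub>FA\<^esub> B (k, j))))"
      using e by (simp only:) (rule c.map_finsum; auto simp del: free_alg_simps)
    also have "\<dots> = (\<Sum>k\<in>multi_idx n 2. U.em (A' (i, k)) * U.em (B' (k, j)))"
      using e ij A(3) B(3) by (intro sum.cong refl) (simp only: c.map_mult)
    finally show ?thesis by (simp only: U.em_mult_entry[OF A(2) B(2) ij])
  qed
  have R: "U.em (pr.cls (?RF (i, j))) = U.em (?RU (i, j))" if "i \<in> multi_idx n 2" "j \<in> multi_idx n 2" for i j
    using that by (simp add: extend_scalars_def pr.cls_smult[of 1, simplified] U_eq pr.cls_one)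
  have X: "U.em (pr.cls (?XF (i, j))) = U.em (?XU (i, j))" "U.em (pr.cls (?YF (i, j))) = U.em (?YU (i, j))"
    if "i \<in> multi_idx n 2" "j \<in> multi_idx n 2" for i j
    using cls_at_copies[OF that, of 1] cls_at_copies[OF that, of 2] by simp_all
  have RX: "U.em (pr.cls ((?RF \<otimes>\<^bsub>tens n 2 FA\<^esub> ?XF) (i, j))) = U.em ((?RU \<otimes>\<^bsub>tens n 2 U\<^esub> ?XU) (i, j))"
    if "i \<in> multi_idx n 2" "j \<in> multi_idx n 2" for i j
    by (rule mult[OF F(1) U(1) _ F(2) U(2)]) (simp_all only: R X that)
  have YX: "U.em (pr.cls ((?YF \<otimes>\<^bsub>tens n 2 FA\<^esub> ?XF) (i, j))) = U.em ((?YU \<otimes>\<^bsub>tens n 2 U\<^esub> ?XU) (i, j))"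
    if "i \<in> multi_idx n 2" "j \<in> multi_idx n 2" for i j
    by (rule mult[OF F(3) U(3) _ F(2) U(2)]) (simp_all only: X that)
  have "?RU \<otimes>\<^bsub>tens n 2 U\<^esub> ?XU \<otimes>\<^bsub>tens n 2 U\<^esub> ?YU = ?YU \<otimes>\<^bsub>tens n 2 U\<^esub> ?XU \<otimes>\<^bsub>tens n 2 U\<^esub> ?RU" (is "?l = ?r")
  proof -
    have cl: "?l \<in> carrier (tens n 2 U)" "?r \<in> carrier (tens n 2 U)" using U by auto
    have "?l (i, j) = ?r (i, j)" if ij: "i \<in> multi_idx n 2" "j \<in> multi_idx n 2" for i j
    proof (rule U.emb_inj)
      let ?lF = "?RF \<otimes>\<^bsub>tens n 2 FA\<^esub> ?XF \<otimes>\<^bsub>tens n 2 FA\<^esub> ?YF" and ?rF = "?YF \<otimes>\<^bsub>tens n 2 FA\<^esub> ?XF \<otimes>\<^bsub>tens n 2 FA\<^esub> ?RF"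
      have "?lF (i, j) - ?rF (i, j) \<in> rls"
        using G ij unfolding uq_rels_def RLL_rels_def Let_def by blast
      then have "pr.cls (?lF (i, j) - ?rF (i, j)) = \<zero>\<^bsub>U\<^esub>" using pr.cls_rel by (simp add: U_eq)
      moreover have "?lF (i, j) \<in> carrier FA" "?rF (i, j) \<in> carrier FA"
        using ij F by (auto intro!: F.tens_entry[of _ 2])
      ultimately have "U.em (pr.cls (?lF (i, j))) = U.em (pr.cls (?rF (i, j)))"
        using pr.cls_add[of "?lF (i, j) - ?rF (i, j)" "?rF (i, j)"] cls_closed
        by (simp add: U_eq free_alg_diff)
      then show "U.em (?l (i, j)) = U.em (?r (i, j))"
        using mult[OF TF.m_closed[OF F(1,2)] TU.m_closed[OF U(1,2)] RX F(3) U(3) X(2) ij]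
          mult[OF TF.m_closed[OF F(3,2)] TU.m_closed[OF U(3,2)] YX F(1) U(1) R ij] by simp
    qed (use U.tens_entry[OF cl(1) ij] U.tens_entry[OF cl(2) ij] in auto)
    then show ?thesis
      using cl by (intro PiE_ext[of ?l _ _ ?r]) (auto simp: U.tens_simps(1))
  qed
  then have "U.opm 2 ?l = U.opm 2 ?r" by (simp only:)
  then have "U.Pm 1 * U.T 1 * U.copy 1 (uq_mat n q G) * U.copy 2 (uq_mat n q H)
      = U.copy 2 (uq_mat n q H) * U.copy 1 (uq_mat n q G) * (U.Pm 1 * U.T 1)"
    using U by (simp add: TU.map_mult U.opm_R_mat U.opm_copy)
  \<comment> \<open>The extra permutation cancels the one in front of the braid operator and turns
    the second copy of the matrix for \<open>H\<close> into the first.\<close>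
  then have *: "U.Pm 1 * (U.Pm 1 * U.T 1 * U.copy 1 (uq_mat n q G) * U.copy 2 (uq_mat n q H))
      = U.Pm 1 * (U.copy 2 (uq_mat n q H) * U.copy 1 (uq_mat n q G) * (U.Pm 1 * U.T 1))"
    by (simp only:)
  let ?P = "U.Pm 1" and ?X = "U.copy 1 (uq_mat n q G)" and ?Y = "U.copy 1 (uq_mat n q H)"
  have "U.T 1 * ?X * (?P * ?Y * ?P) = (?P * ?P) * U.T 1 * ?X * (?P * ?Y * ?P)"
    by (simp only: U.Pm_square U.corD U.cor_T)
  also have "\<dots> = ?P * ((?P * ?Y * ?P) * ?X * (?P * U.T 1))"
    using * unfolding U.swap_copy[OF uq(2), symmetric] by (simp only: mult.assoc)
  also have "\<dots> = (?P * ?P) * ?Y * (?P * ?X * ?P) * U.T 1"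
    by (simp only: mult.assoc)
  also have "\<dots> = ?Y * (?P * ?X * ?P) * U.T 1"
    by (simp only: U.Pm_square U.corD U.cor_copy[OF uq(2)])
  finally show ?thesis
    using U.opm_1[OF uq(1)] U.opm_1[OF uq(2)] by (simp only:)
qed

subsection \<open>Invertibility of the lower triangular generator matrix\<close>

lemma diag_inverse: "a \<in> {1..n} \<Longrightarrow> pr.cls (nc_gen (Lplus a a)) \<otimes>\<^bsub>U\<^esub> pr.cls (nc_gen (Lminus a a)) = \<one>\<^bsub>U\<^esub>"
  "a \<in> {1..n} \<Longrightarrow> pr.cls (nc_gen (Lminus a a)) \<otimes>\<^bsub>U\<^esub> pr.cls (nc_gen (Lplus a a)) = \<one>\<^bsub>U\<^esub>"
proof -
  assume a: "a \<in> {1..n}"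
  have *: "pr.cls x \<otimes>\<^bsub>U\<^esub> pr.cls y = \<one>\<^bsub>U\<^esub>" if "x * y - 1 \<in> rls" "x \<in> carrier FA" "y \<in> carrier FA" for x y
  proof -
    have "pr.cls (x * y - 1) = \<zero>\<^bsub>U\<^esub>" using pr.cls_rel[OF that(1)] by (simp add: U_eq)
    then have "pr.cls (x * y) = \<one>\<^bsub>U\<^esub>"
      using pr.cls_add[of "x * y - 1" 1] that cls_closed[of 1] by (simp add: U_eq pr.cls_one free_alg_diff)
    then show ?thesis using that by (simp add: pr.cls_mult U_eq)
  qed
  have "nc_gen (Lplus a a) * nc_gen (Lminus a a) - 1 \<in> rls" "nc_gen (Lminus a a) * nc_gen (Lplus a a) - 1 \<in> rls"
    unfolding uq_rels_def using a by blast+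
  then show "pr.cls (nc_gen (Lplus a a)) \<otimes>\<^bsub>U\<^esub> pr.cls (nc_gen (Lminus a a)) = \<one>\<^bsub>U\<^esub>"
    "pr.cls (nc_gen (Lminus a a)) \<otimes>\<^bsub>U\<^esub> pr.cls (nc_gen (Lplus a a)) = \<one>\<^bsub>U\<^esub>"
    using a by (simp_all add: * gen_closed)
qed

lemma lower_triangular: "a \<in> {1..n} \<Longrightarrow> b \<in> {1..n} \<Longrightarrow> a < b \<Longrightarrow> pr.cls (nc_gen (Lminus a b)) = \<zero>\<^bsub>U\<^esub>"
proof -
  assume "a \<in> {1..n}" "b \<in> {1..n}" "a < b"
  then have "nc_gen (Lminus a b) \<in> rls" unfolding uq_rels_def by blast
  then show ?thesis using pr.cls_rel by (simp only: U_eq)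
qed

text \<open>A filtration by the distance below the diagonal. At level n all entries vanish, since a
  < b + n for all indices.\<close>

definition low :: "nat \<Rightarrow> uq_gen ncpoly set tmat \<Rightarrow> bool" where
  "low k X \<longleftrightarrow> (\<forall>a\<in>{1..n}. \<forall>b\<in>{1..n}. a < b + k \<longrightarrow> U.em (X ([a], [b])) = 0)"

lemma low_mult:
  assumes "low k X" "low l Y" "X \<in> carrier (tens n 1 U)" "Y \<in> carrier (tens n 1 U)"
  shows "low (k + l) (X \<otimes>\<^bsub>tens n 1 U\<^esub> Y)"
  unfolding low_def
proof (intro ballI impI)
  fix a b assume ab: "a \<in> {1..n}" "b \<in> {1..n}" "a < b + (k + l)"
  have "U.em ((X \<otimes>\<^bsub>tens n 1 U\<^esub> Y) ([a], [b])) = (\<Sum>c\<in>multi_idx n 1. U.em (X ([a], c)) * U.em (Y (c, [b])))"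
    by (rule U.em_mult_entry[OF assms(3,4)]) (use ab in \<open>auto simp: in_multi_idx_1\<close>)
  also have "\<dots> = 0"
  proof (intro sum.neutral ballI)
    fix c assume "c \<in> multi_idx n 1"
    then obtain d where d: "c = [d]" "d \<in> {1..n}" by (auto simp: in_multi_idx_1)
    then show "U.em (X ([a], c)) * U.em (Y (c, [b])) = 0"
      using assms(1,2) ab unfolding low_def by (cases "a < d + k") auto
  qed
  finally show "U.em ((X \<otimes>\<^bsub>tens n 1 U\<^esub> Y) ([a], [b])) = 0" .
qed

text \<open>Levels add up in products, so z^n has level n and is zero.\<close>

lemma strictly_lower_unit:
  assumes z: "z \<in> carrier (tens n 1 U)" "low 1 z"
  shows "\<one>\<^bsub>tens n 1 U\<^esub> \<ominus>\<^bsub>tens n 1 U\<^esub> z \<in> Units (tens n 1 U)"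
proof -
  interpret T: calg "tens n 1 U" by (rule U.tens_calg)
  have pow: "low (Suc k) (z [^]\<^bsub>tens n 1 U\<^esub> Suc k)" for k
  proof (induction k)
    case 0
    then show ?case using z T.l_one[OF z(1)] by simp
  next
    case (Suc k)
    have "low (Suc k + 1) (z [^]\<^bsub>tens n 1 U\<^esub> Suc k \<otimes>\<^bsub>tens n 1 U\<^esub> z)"
      by (rule low_mult[OF Suc.IH z(2) T.nat_pow_closed[OF z(1)] z(1)])
    then show ?case by simp
  qed
  obtain p where p: "n = Suc p" using n_ge_one by (cases n) auto
  have zn: "z [^]\<^bsub>tens n 1 U\<^esub> n \<in> carrier (tens n 1 U)" using z(1) by (rule T.nat_pow_closed)
  have "z [^]\<^bsub>tens n 1 U\<^esub> n = \<zero>\<^bsub>tens n 1 U\<^esub>"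
  proof (rule inj_onD[OF U.opm_inj _ zn])
    have "U.em ((z [^]\<^bsub>tens n 1 U\<^esub> n) (i, j)) = 0" if "i \<in> multi_idx n 1" "j \<in> multi_idx n 1" for i j
      using pow[of p] that p unfolding low_def by (auto simp: in_multi_idx_1)
    then show "U.opm 1 (z [^]\<^bsub>tens n 1 U\<^esub> n) = U.opm 1 \<zero>\<^bsub>tens n 1 U\<^esub>"
      by (intro endo_eqI ext) (auto simp: U.app_opm U.tens_simps intro!: sum.cong)
  qed (rule T.zero_closed)
  then show ?thesis by (rule T.one_minus_nilpotent_unit[OF z(1)])
qed

text \<open>By the relations for the diagonal generators this is the inverse of the diagonal part of
  L^-.\<close>

definition diag_mat :: "uq_gen ncpoly set tmat" where
  "diag_mat = (\<lambda>(i, j) \<in> multi_idx n 1 \<times> multi_idx n 1. if i = j then pr.cls (nc_gen (Lplus (hd i) (hd i))) else \<zero>\<^bsub>U\<^esub>)"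

lemma diag_mat_closed: "diag_mat \<in> carrier (tens n 1 U)"
  by (auto simp: diag_mat_def U.tens_simps restrict_PiE_iff in_multi_idx_1 gen_closed cls_closed simp del: restrict_PiE)

text \<open>Multiplied by \<open>diag_mat\<close> on either side, L^- becomes 1 - z with z strictly
  lower triangular, hence a unit. The two products give a left and a right inverse of L^-.\<close>

lemma Lminus_unit: "uq_mat n q Lminus \<in> Units (tens n 1 U)"
proof -
  interpret T: calg "tens n 1 U" by (rule U.tens_calg)
  interpret opm: alg_map "tens n 1 U" "U.opm 1" by (rule U.opm_alg_map)
  let ?L = "uq_mat n q Lminus"
  note L = uq_mat_closed(2) and D = diag_mat_closed
  have D_entry: "U.em (diag_mat ([a], [b])) = (if a = b then U.em (pr.cls (nc_gen (Lplus a a))) else 0)"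
    if "a \<in> {1..n}" "b \<in> {1..n}" for a b
    using that by (simp add: diag_mat_def in_multi_idx_1)
  have sum1: "(\<Sum>c\<in>multi_idx n 1. f c) = (\<Sum>d\<in>{1..n}. f [d])" for f :: "nat list \<Rightarrow> uq_gen ncpoly set algprod endo"
  proof -
    have "multi_idx n 1 = (\<lambda>d. [d]) ` {1..n}" by (auto simp: in_multi_idx_1)
    then show ?thesis by (simp add: sum.reindex inj_on_def)
  qed
  have unit: "X \<in> Units (tens n 1 U)"
    if X: "X \<in> carrier (tens n 1 U)"
      and low: "\<And>a b. a \<in> {1..n} \<Longrightarrow> b \<in> {1..n} \<Longrightarrow> a \<le> b \<Longrightarrow> U.em (X ([a], [b])) = (if a = b then U.em \<one>\<^bsub>U\<^esub> else 0)" for X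
  proof -
    let ?z = "\<one>\<^bsub>tens n 1 U\<^esub> \<ominus>\<^bsub>tens n 1 U\<^esub> X"
    have z: "?z \<in> carrier (tens n 1 U)" by (intro T.minus_closed T.one_closed X)
    have add: "?z \<oplus>\<^bsub>tens n 1 U\<^esub> X = \<one>\<^bsub>tens n 1 U\<^esub>"
      unfolding T.minus_eq
      by (simp only: T.a_assoc[OF T.one_closed T.a_inv_closed[OF X] X] T.l_neg[OF X] T.r_zero[OF T.one_closed])
    have "low 1 ?z"
      unfolding low_def
    proof (intro ballI impI)
      fix a b assume ab: "a \<in> {1..n}" "b \<in> {1..n}" "a < b + 1"
      have "(?z \<oplus>\<^bsub>tens n 1 U\<^esub> X) ([a], [b]) = ?z ([a], [b]) \<oplus>\<^bsub>U\<^esub> X ([a], [b])"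
        using ab by (simp add: U.tens_simps(5) in_multi_idx_1)
      then have "U.em (\<one>\<^bsub>tens n 1 U\<^esub> ([a], [b])) = U.em (?z ([a], [b])) + U.em (X ([a], [b]))"
        unfolding add using U.tens_entry[OF z] U.tens_entry[OF X] ab
        by (simp add: U.em.map_add in_multi_idx_1)
      moreover have "U.em (\<one>\<^bsub>tens n 1 U\<^esub> ([a], [b])) = (if a = b then U.em \<one>\<^bsub>U\<^esub> else 0)"
        using ab by (simp add: U.tens_simps(3) in_multi_idx_1)
      ultimately show "U.em (?z ([a], [b])) = 0" using low[of a b] ab by simp
    qed
    from strictly_lower_unit[OF z this]
    have "\<one>\<^bsub>tens n 1 U\<^esub> \<ominus>\<^bsub>tens n 1 U\<^esub> ?z \<in> Units (tens n 1 U)" .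
    moreover have "\<one>\<^bsub>tens n 1 U\<^esub> \<ominus>\<^bsub>tens n 1 U\<^esub> ?z = X"
      by (rule inj_onD[OF U.opm_inj[of 1] _ T.minus_closed[OF T.one_closed z] X])
        (simp only: opm.map_diff[OF T.one_closed z] opm.map_diff[OF T.one_closed X] diff_diff_eq2 add_diff_cancel_left')
    ultimately show ?thesis by (simp only:)
  qed
  have lm: "U.em (?L ([a], [b])) = (if a < b then 0 else U.em (pr.cls (nc_gen (Lminus a b))))"
    if "a \<in> {1..n}" "b \<in> {1..n}" for a b
    using that lower_triangular[OF that] by (simp add: uq_mat_entry)
  have inv: "U.em (pr.cls (nc_gen (Lplus a a))) * U.em (pr.cls (nc_gen (Lminus a a))) = U.em \<one>\<^bsub>U\<^esub>"
    "U.em (pr.cls (nc_gen (Lminus a a))) * U.em (pr.cls (nc_gen (Lplus a a))) = U.em \<one>\<^bsub>U\<^esub>" if "a \<in> {1..n}" for a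
    using that by (simp_all add: U.em.map_mult[symmetric] cls_closed gen_closed diag_inverse)
  have "diag_mat \<otimes>\<^bsub>tens n 1 U\<^esub> ?L \<in> Units (tens n 1 U)"
  proof (rule unit)
    fix a b assume ab: "a \<in> {1..n}" "b \<in> {1..n}" "a \<le> b"
    have "U.em ((diag_mat \<otimes>\<^bsub>tens n 1 U\<^esub> ?L) ([a], [b])) = (\<Sum>d\<in>{1..n}. U.em (diag_mat ([a], [d])) * U.em (?L ([d], [b])))"
      using ab by (subst U.em_mult_entry[OF D L]) (auto simp: in_multi_idx_1 sum1[unfolded One_nat_def])
    also have "\<dots> = (\<Sum>d\<in>{1..n}. if d = a then (if a = b then U.em \<one>\<^bsub>U\<^esub> else 0) else 0)"
      using ab inv by (intro sum.cong refl) (auto simp: D_entry lm)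
    finally show "U.em ((diag_mat \<otimes>\<^bsub>tens n 1 U\<^esub> ?L) ([a], [b])) = (if a = b then U.em \<one>\<^bsub>U\<^esub> else 0)"
      using ab by simp
  qed (rule T.m_closed[OF D L])
  moreover have "?L \<otimes>\<^bsub>tens n 1 U\<^esub> diag_mat \<in> Units (tens n 1 U)"
  proof (rule unit)
    fix a b assume ab: "a \<in> {1..n}" "b \<in> {1..n}" "a \<le> b"
    have "U.em ((?L \<otimes>\<^bsub>tens n 1 U\<^esub> diag_mat) ([a], [b])) = (\<Sum>d\<in>{1..n}. U.em (?L ([a], [d])) * U.em (diag_mat ([d], [b])))"
      using ab by (subst U.em_mult_entry[OF L D]) (auto simp: in_multi_idx_1 sum1[unfolded One_nat_def])
    also have "\<dots> = (\<Sum>d\<in>{1..n}. if d = b then (if a = b then U.em \<one>\<^bsub>U\<^esub> else 0) else 0)"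
      using ab inv by (intro sum.cong refl) (auto simp: D_entry lm)
    finally show "U.em ((?L \<otimes>\<^bsub>tens n 1 U\<^esub> diag_mat) ([a], [b])) = (if a = b then U.em \<one>\<^bsub>U\<^esub> else 0)"
      using ab by simp
  qed (rule T.m_closed[OF L D])
  ultimately show ?thesis
    by (rule T.unit_if_one_sided_units[OF L D D])
qed

end

subsection \<open>The generating series\<close>

text \<open>The values at 0 may differ, as their coefficient is [0] = 0.\<close>

lemma anti_cong:
  assumes "\<And>i. 1 \<le> i \<Longrightarrow> i < m \<Longrightarrow> t i = t' i"
  shows "anti e t q m = anti e t' q m"
  using assms
proof (induction m)
  case (Suc m)
  have "qint q m *\<^sub>C t m = qint q m *\<^sub>C t' m"
    using Suc.prems[of m] by (cases "m = 0") (simp_all add: qint_def)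
  with Suc show ?case by simp
qed simp

context tensor_algebra
begin

lemma lam_alg_map: "alg_map A lam"
  by (intro alg_map.intro calg_axioms alg_map_axioms.intro endo_eqI ext)
    (auto simp: app_lam em.map_mult em.map_add em.map_smult)

sublocale lam: alg_map A lam by (rule lam_alg_map)

lemma lam_inj:
  assumes "x \<in> carrier A" "y \<in> carrier A" "lam x = lam y"
  shows "x = y"
proof (rule emb_inj)
  show "em x = em y"
  proof (rule endo_eqI)
    fix k
    have "in_range n (\<lambda>_. 1)" using n_ge_1 by (simp add: in_range_def del: in_rangeD)
    moreover have "app (lam x) (\<lambda>_. k) (\<lambda>_. 1) = app (lam y) (\<lambda>_. k) (\<lambda>_. 1)" using assms(3) by simp
    ultimately show "app (em x) k = app (em y) k" by (simp add: app_lam)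
  qed
qed (use assms in auto)

lemma opm_one: "opm m \<one>\<^bsub>tens n m A\<^esub> = lam \<one>"
  by (intro endo_eqI ext) (simp add: app_opm_one app_lam)

text \<open>Multiplying all entries by \<open>c\<close> from one side is composition with
  \<open>lam c\<close> on that side, and \<open>opm\<close> is injective.\<close>

lemma commutes_lam_entry:
  assumes c: "c \<in> carrier A" and X: "X \<in> carrier (tens n m A)" and comm: "commutes (lam c) (opm m X)"
    and ij: "i \<in> idx m" "j \<in> idx m"
  shows "c \<otimes> X (i, j) = X (i, j) \<otimes> c"
proof -
  let ?l = "\<lambda>p \<in> idx m \<times> idx m. c \<otimes> X p" and ?r = "\<lambda>p \<in> idx m \<times> idx m. X p \<otimes> c"
  have X': "X (k, l) \<in> carrier A" if "k \<in> idx m" "l \<in> idx m" for k l using tens_entry[OF X that] .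
  have "opm m ?l = lam c * opm m X"
    using X' c by (intro endo_eqI ext) (simp add: app_opm app_lam app_sum_right em.map_mult)
  also have "\<dots> = opm m X * lam c" using comm by (simp add: commutes_def)
  also have "\<dots> = opm m ?r"
    using X' c by (intro endo_eqI ext) (simp add: app_opm app_lam em.map_mult)
  finally have "?l = ?r"
    by (rule inj_onD[OF opm_inj]) (use X' c in \<open>auto simp: tens_simps(1) restrict_PiE_iff simp del: restrict_PiE\<close>)
  then have "?l (i, j) = ?r (i, j)" by (rule fun_cong)
  then show ?thesis using ij by simp
qed

lemma opm_extend_alg_map: "alg_map (tens n m complex_alg) (\<lambda>X. opm m (extend_scalars n m A X))"
proof -
  interpret C: tensor_algebra q complex_alg n
    by unfold_locales (rule n_ge_1)
  have entry: "em (extend_scalars n m A Z (get_idx m s, j)) = Z (get_idx m s, j) *\<^sub>C em \<one>"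
    if "in_range n s" "j \<in> idx m" for Z s j
    using that by (simp add: em_extend)
  show ?thesis
  proof (intro alg_map.intro C.tens_calg alg_map_axioms.intro endo_eqI ext)
    fix X Y and v :: "(nat \<Rightarrow> nat) \<Rightarrow> 'a algprod" and s c
    show "app (opm m (extend_scalars n m A (X \<oplus>\<^bsub>tens n m complex_alg\<^esub> Y))) v s
      = app (opm m (extend_scalars n m A X) + opm m (extend_scalars n m A Y)) v s"
      by (simp add: app_opm entry C.tens_simps cscale_add_left sum.distrib)
    show "app (opm m (extend_scalars n m A (c \<odot>\<^bsub>tens n m complex_alg\<^esub> X))) v s
      = app (c *\<^sub>C opm m (extend_scalars n m A X)) v s"
      by (simp add: app_opm entry C.tens_simps cscale_sum_right)
    show "app (opm m (extend_scalars n m A (X \<otimes>\<^bsub>tens n m complex_alg\<^esub> Y))) v s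
      = app (opm m (extend_scalars n m A X) * opm m (extend_scalars n m A Y)) v s"
    proof (cases "in_range n s")
      case True
      have "app (opm m (extend_scalars n m A (X \<otimes>\<^bsub>tens n m complex_alg\<^esub> Y))) v s
        = (\<Sum>j\<in>idx m. \<Sum>k\<in>idx m. (X (get_idx m s, k) * Y (k, j)) *\<^sub>C app (em \<one>) (v (put_idx m s j)))"
        using True by (simp add: app_opm entry C.tens_simps finsum_complex_alg cscale_sum_left app_sum)
      also have "\<dots> = (\<Sum>k\<in>idx m. \<Sum>j\<in>idx m. (X (get_idx m s, k) * Y (k, j)) *\<^sub>C app (em \<one>) (v (put_idx m s j)))"
        by (rule sum.swap)
      also have "\<dots> = app (opm m (extend_scalars n m A X) * opm m (extend_scalars n m A Y)) v s"
        using True by (simp add: app_opm entry em_extend app_sum_right cscale_sum_right mult.commute)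
      finally show ?thesis .
    qed (simp add: app_opm)
  qed
qed

text \<open>The idempotent is replaced by its explicit polynomial. Over the complex numbers
  \<open>C.opm\<close> is injective and the braid operators form a Hecke family, which justifies
  evaluating the class at that polynomial; the result is then pushed through the extension of
  scalars.\<close>

theorem opm_antisymmetrizer: "opm m (extend_scalars n m A (antisymmetrizer n q m)) = As m"
proof -
  interpret C: tensor_algebra q complex_alg n
    by unfold_locales (rule n_ge_1)
  define S where "S = {1..<m}"
  interpret H: presentation S "hecke_rels m q" unfolding S_def by (rule hecke_rels_closed)
  interpret ext: alg_map "tens n m complex_alg" "\<lambda>X. opm m (extend_scalars n m A X)"
    by (rule opm_extend_alg_map)
  let ?M = "tens n m complex_alg" and ?h = "R_check_at n q m"
  have h: "?h g \<in> carrier ?M" for g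
    by (simp add: R_check_at_def at_copies_def C.tens_simps)
  \<comment> \<open>Extending scalars from the complex numbers to themselves changes nothing, so
    \<open>C.opm_R_check\<close> describes the matrices themselves.\<close>
  have "extend_scalars n m complex_alg (?h g) = ?h g" for g
    by (auto simp: fun_eq_iff extend_scalars_def R_check_at_def at_copies_def)
  then have Ch: "C.opm m (?h g) = C.T g" if "g \<in> S" for g
    using C.opm_R_check[of g m] that by (simp add: S_def)
  have poly: "anti_poly q m \<in> carrier H.F" unfolding S_def by (rule anti_poly_closed) simp
  have "antisymmetrizer n q m = pres_hom ?M ?h (H.cls (anti_poly q m))"
    by (simp only: antisymmetrizer_def column_idem_eq S_def)
  also have "\<dots> = nc_eval ?M ?h (anti_poly q m)"
  proof (rule H.pres_hom_cls[OF C.opm_alg_map C.opm_inj h _ poly])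
    fix r assume r: "r \<in> hecke_rels m q"
    let ?t = "\<lambda>g. if g \<in> S then C.opm m (?h g) else 0"
    have unit: "C.lam 1 * C.T i = C.T i" "C.T i * C.lam 1 = C.T i" for i
      using C.corD[OF C.cor_T(1), of i] by simp_all
    have "hecke_family q (C.lam 1) ?t m"
    proof
      fix i j
      show "?t i * ?t i = C.lam 1 + (q - inverse q) *\<^sub>C ?t i" if "i \<in> {1..<m}"
        using C.hecke.quad[of i m] that by (simp add: Ch[unfolded S_def] S_def)
      show "?t i * ?t (Suc i) * ?t i = ?t (Suc i) * ?t i * ?t (Suc i)" if "1 \<le> i" "Suc i < m"
        using C.hecke.braid[of i m] that by (simp add: Ch[unfolded S_def] S_def)
      show "?t i * ?t j = ?t j * ?t i" if "1 \<le> i" "Suc i < j" "j < m"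
        using C.hecke.far_commute[of i j m] that by (simp add: Ch[unfolded S_def] S_def)
    qed (use C.e_idem in \<open>simp_all add: Ch[unfolded S_def] S_def unit\<close>)
    then show "ev (C.opm m \<one>\<^bsub>?M\<^esub>) ?t r = 0"
      using r C.e_idem by (simp only: C.opm_one complex_alg_simps) (rule hecke_family_ev_rel, auto simp: Ch unit)
  qed
  finally have "opm m (extend_scalars n m A (antisymmetrizer n q m))
      = ev (opm m (extend_scalars n m A \<one>\<^bsub>?M\<^esub>)) (\<lambda>g. if g \<in> S then opm m (extend_scalars n m A (?h g)) else 0) (anti_poly q m)"
    using H.map_nc_eval(2)[OF ext.alg_map_axioms h poly] by (simp only:)
  also have "opm m (extend_scalars n m A \<one>\<^bsub>?M\<^esub>) = lam \<one>"
  proof -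
    have "extend_scalars n m A \<one>\<^bsub>?M\<^esub> = \<one>\<^bsub>tens n m A\<^esub>"
      by (auto simp: fun_eq_iff extend_scalars_def C.tens_simps tens_simps)
    then show ?thesis by (simp add: opm_one)
  qed
  also have "ev (lam \<one>) (\<lambda>g. if g \<in> S then opm m (extend_scalars n m A (?h g)) else 0) (anti_poly q m)
      = anti (lam \<one>) (\<lambda>g. if g \<in> S then opm m (extend_scalars n m A (?h g)) else 0) q m"
    using opm_R_check[of _ m] by (intro ev_anti_poly) (auto simp: S_def)
  also have "\<dots> = As m"
    by (rule anti_cong) (auto simp: S_def opm_R_check)
  finally show ?thesis .
qed

end

subsection \<open>Formal power series over an algebra\<close>

context calg
begin

lemma series_simps:
  "carrier (series_alg A) = UNIV \<rightarrow> carrier A"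
  "f \<otimes>\<^bsub>series_alg A\<^esub> g = (\<lambda>m. \<Oplus>k \<in> {..m}. f k \<otimes> g (m - k))"
  "\<one>\<^bsub>series_alg A\<^esub> = (\<lambda>m. if m = 0 then \<one> else \<zero>)"
  by (simp_all add: series_alg_def)

text \<open>Coefficientwise embedding into type-class power series, from which associativity is
  inherited.\<close>

definition emb_series :: "(nat \<Rightarrow> 'a) \<Rightarrow> 'a algprod endo fps" where
  "emb_series f = Abs_fps (\<lambda>m. emb A (f m))"

lemma series_mult_closed:
  "\<lbrakk>f \<in> carrier (series_alg A); g \<in> carrier (series_alg A)\<rbrakk> \<Longrightarrow> f \<otimes>\<^bsub>series_alg A\<^esub> g \<in> carrier (series_alg A)"
  by (auto simp: series_simps Pi_iff intro!: finsum_closed)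

lemma emb_series_mult:
  assumes "f \<in> carrier (series_alg A)" "g \<in> carrier (series_alg A)"
  shows "emb_series (f \<otimes>\<^bsub>series_alg A\<^esub> g) = emb_series f * emb_series g"
proof -
  interpret em: alg_map A "emb A" by (rule emb_alg_map)
  show ?thesis
    using assms
    by (intro fps_ext) (simp add: emb_series_def series_simps fps_mult_nth em.map_finsum em.map_mult Pi_iff atLeast0AtMost)
qed

lemma emb_series_inj:
  assumes "f \<in> carrier (series_alg A)" "g \<in> carrier (series_alg A)" "emb_series f = emb_series g"
  shows "f = g"
proof
  fix m
  show "f m = g m"
    using assms by (intro emb_inj) (auto simp: emb_series_def series_simps fps_eq_iff)
qed

lemma series_monoid: "monoid (series_alg A)"
proof (rule monoidI)
  interpret em: alg_map A "emb A" by (rule emb_alg_map)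
  show one: "\<one>\<^bsub>series_alg A\<^esub> \<in> carrier (series_alg A)"
    by (simp add: series_simps)
  fix f g h assume f: "f \<in> carrier (series_alg A)"
  have f': "f m \<in> carrier A" for m using f by (auto simp: series_simps)
  show "\<one>\<^bsub>series_alg A\<^esub> \<otimes>\<^bsub>series_alg A\<^esub> f = f"
  proof (rule emb_series_inj[OF series_mult_closed[OF one f] f])
    have "(\<Sum>k\<in>{0..m}. emb A (if k = 0 then \<one> else \<zero>) * emb A (f (m - k)))
        = (\<Sum>k\<in>{0..m}. if k = 0 then emb A (f m) else 0)" for m
      by (intro sum.cong refl) (simp add: em.map_one_left f')
    then show "emb_series (\<one>\<^bsub>series_alg A\<^esub> \<otimes>\<^bsub>series_alg A\<^esub> f) = emb_series f"
      unfolding emb_series_mult[OF one f]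
      by (intro fps_ext) (simp add: emb_series_def series_simps fps_mult_nth)
  qed
  show "f \<otimes>\<^bsub>series_alg A\<^esub> \<one>\<^bsub>series_alg A\<^esub> = f"
  proof (rule emb_series_inj[OF series_mult_closed[OF f one] f])
    have "(\<Sum>k\<in>{0..m}. emb A (f k) * emb A (if m - k = 0 then \<one> else \<zero>))
        = (\<Sum>k\<in>{0..m}. if k = m then emb A (f m) else 0)" for m
      by (intro sum.cong refl) (auto simp add: em.map_one_right f')
    then show "emb_series (f \<otimes>\<^bsub>series_alg A\<^esub> \<one>\<^bsub>series_alg A\<^esub>) = emb_series f"
      unfolding emb_series_mult[OF f one]
      by (intro fps_ext) (simp add: emb_series_def series_simps fps_mult_nth)
  qed
  assume g: "g \<in> carrier (series_alg A)"
  show "f \<otimes>\<^bsub>series_alg A\<^esub> g \<in> carrier (series_alg A)" by (rule series_mult_closed[OF f g])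
  assume h: "h \<in> carrier (series_alg A)"
  show "f \<otimes>\<^bsub>series_alg A\<^esub> g \<otimes>\<^bsub>series_alg A\<^esub> h = f \<otimes>\<^bsub>series_alg A\<^esub> (g \<otimes>\<^bsub>series_alg A\<^esub> h)"
    using f g h by (intro emb_series_inj) (simp_all add: series_mult_closed emb_series_mult mult.assoc)
qed

end

text \<open>The recursion g_m = -(g_0 f_m + ... + g_(m-1) f_1) for a left inverse of a series with
  constant term 1. The fold over \<open>[0..<m]\<close> shows the bound k < m to the termination
  proof.\<close>

fun series_inverse :: "(complex, 'a) module \<Rightarrow> (nat \<Rightarrow> 'a) \<Rightarrow> nat \<Rightarrow> 'a" where
  "series_inverse A f m = (if m = 0 then \<one>\<^bsub>A\<^esub>
     else \<ominus>\<^bsub>A\<^esub> (foldr (\<lambda>k y. series_inverse A f k \<otimes>\<^bsub>A\<^esub> f (m - k) \<oplus>\<^bsub>A\<^esub> y) [0..<m] \<zero>\<^bsub>A\<^esub>))"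

declare series_inverse.simps [simp del]

text \<open>The recursion provides a left inverse; centrality of the coefficients of
  \<open>f\<close> makes the two convolutions agree, so the inverse is two-sided.\<close>

lemma (in calg) central_series_unit:
  assumes f: "f \<in> carrier (series_alg A)" "f 0 = \<one>"
    and central: "\<And>m x. x \<in> carrier A \<Longrightarrow> f m \<otimes> x = x \<otimes> f m"
  shows "f \<in> Units (series_alg A)"
proof -
  interpret em: alg_map A "emb A" by (rule emb_alg_map)
  let ?g = "series_inverse A f"
  have f': "f m \<in> carrier A" for m using f by (auto simp: series_simps)
  have fold: "foldr (\<lambda>k y. ?g k \<otimes> f (m - k) \<oplus> y) ks \<zero> \<in> carrier A \<and>
      emb A (foldr (\<lambda>k y. ?g k \<otimes> f (m - k) \<oplus> y) ks \<zero>) = (\<Sum>k\<leftarrow>ks. emb A (?g k) * emb A (f (m - k)))"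
    if "\<And>k. k \<in> set ks \<Longrightarrow> ?g k \<in> carrier A" for ks m
    using that by (induction ks) (simp_all add: f' em.map_add em.map_mult)
  have g: "?g m \<in> carrier A" for m
  proof (induction m rule: less_induct)
    case (less m)
    then show ?case using fold[of "[0..<m]" m] by (subst series_inverse.simps) auto
  qed
  have gS: "?g \<in> carrier (series_alg A)" using g by (simp add: series_simps)
  have "(?g \<otimes>\<^bsub>series_alg A\<^esub> f) m = \<one>\<^bsub>series_alg A\<^esub> m" for m
  proof (rule emb_inj)
    have em: "emb A ((?g \<otimes>\<^bsub>series_alg A\<^esub> f) m) = (\<Sum>k\<in>{..m}. emb A (?g k) * emb A (f (m - k)))"
      by (simp add: series_simps em.map_finsum em.map_mult g f')
    show "emb A ((?g \<otimes>\<^bsub>series_alg A\<^esub> f) m) = emb A (\<one>\<^bsub>series_alg A\<^esub> m)"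
    proof (cases m)
      case 0
      then show ?thesis unfolding em
        by (simp add: series_simps series_inverse.simps[of _ _ 0] f(2) em.map_one_left)
    next
      case (Suc p)
      have "emb A (?g m) = - (\<Sum>k\<leftarrow>[0..<m]. emb A (?g k) * emb A (f (m - k)))"
        using fold[of "[0..<m]" m] g Suc by (subst series_inverse.simps) (simp add: em.map_minus)
      also have "(\<Sum>k\<leftarrow>[0..<m]. emb A (?g k) * emb A (f (m - k))) = (\<Sum>k\<in>{..<m}. emb A (?g k) * emb A (f (m - k)))"
        by (simp add: interv_sum_list_conv_sum_set_nat atLeast0LessThan)
      finally have "emb A (?g m) = - (\<Sum>k\<in>{..<m}. emb A (?g k) * emb A (f (m - k)))" .
      moreover have "emb A (?g m) * emb A (f 0) = emb A (?g m)"
        by (simp add: f(2) em.map_one_right g)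
      moreover have "(\<Sum>k\<in>{..m}. emb A (?g k) * emb A (f (m - k)))
          = emb A (?g m) * emb A (f 0) + (\<Sum>k\<in>{..<m}. emb A (?g k) * emb A (f (m - k)))"
      proof -
        have "{..m} = insert m {..<m}" by auto
        then show ?thesis by simp
      qed
      ultimately have "emb A ((?g \<otimes>\<^bsub>series_alg A\<^esub> f) m) = 0"
        unfolding em by (simp only: left_minus)
      then show ?thesis using Suc by (simp add: series_simps)
    qed
  qed (use series_mult_closed[OF gS f(1)] in \<open>auto simp: series_simps\<close>)
  then have 1: "?g \<otimes>\<^bsub>series_alg A\<^esub> f = \<one>\<^bsub>series_alg A\<^esub>" by (rule ext)
  have "f \<otimes>\<^bsub>series_alg A\<^esub> ?g = ?g \<otimes>\<^bsub>series_alg A\<^esub> f"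
  proof (rule emb_series_inj[OF series_mult_closed[OF f(1) gS] series_mult_closed[OF gS f(1)]], rule fps_ext)
    fix m
    have "(\<Sum>k\<in>{0..m}. emb A (f k) * emb A (?g (m - k))) = (\<Sum>k\<in>{0..m}. emb A (?g (m - k)) * emb A (f k))"
      by (intro sum.cong refl) (simp add: em.map_mult[symmetric] f' g central)
    also have "\<dots> = (\<Sum>k\<in>{0..m}. emb A (?g k) * emb A (f (m - k)))"
      by (rule sum.reindex_bij_witness[where i = "\<lambda>k. m - k" and j = "\<lambda>k. m - k"]) auto
    finally show "fps_nth (emb_series (f \<otimes>\<^bsub>series_alg A\<^esub> ?g)) m = fps_nth (emb_series (?g \<otimes>\<^bsub>series_alg A\<^esub> f)) m"
      unfolding emb_series_mult[OF f(1) gS] emb_series_mult[OF gS f(1)]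
      by (simp add: emb_series_def fps_mult_nth)
  qed
  with 1 f(1) gS show ?thesis unfolding Units_def by auto
qed

subsection \<open>The generating series of the quantized enveloping algebra\<close>

context quantum_gl
begin

lemma Lminus_inverse:
  "inv\<^bsub>tens n 1 U\<^esub> (uq_mat n q Lminus) \<in> carrier (tens n 1 U)"
  "uq_mat n q Lminus \<otimes>\<^bsub>tens n 1 U\<^esub> inv\<^bsub>tens n 1 U\<^esub> (uq_mat n q Lminus) = \<one>\<^bsub>tens n 1 U\<^esub>"
  "inv\<^bsub>tens n 1 U\<^esub> (uq_mat n q Lminus) \<otimes>\<^bsub>tens n 1 U\<^esub> uq_mat n q Lminus = \<one>\<^bsub>tens n 1 U\<^esub>"
proof -
  interpret T: calg "tens n 1 U" by (rule U.tens_calg)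
  show "inv\<^bsub>tens n 1 U\<^esub> (uq_mat n q Lminus) \<in> carrier (tens n 1 U)"
    "uq_mat n q Lminus \<otimes>\<^bsub>tens n 1 U\<^esub> inv\<^bsub>tens n 1 U\<^esub> (uq_mat n q Lminus) = \<one>\<^bsub>tens n 1 U\<^esub>"
    "inv\<^bsub>tens n 1 U\<^esub> (uq_mat n q Lminus) \<otimes>\<^bsub>tens n 1 U\<^esub> uq_mat n q Lminus = \<one>\<^bsub>tens n 1 U\<^esub>"
    using Lminus_unit by (rule T.Units_inv_closed T.Units_r_inv T.Units_l_inv)+
qed

lemma opm_1_properties:
  assumes "X \<in> carrier (tens n 1 U)"
  shows "U.cor (U.opm 1 X)" "2 \<le> k \<Longrightarrow> U.free k (U.opm 1 X)"
  unfolding U.opm_1[OF assms] by (auto intro: U.cor_copy U.free_copy assms)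

definition "Lpl = U.opm 1 (uq_mat n q Lplus)"
definition "Lmi = U.opm 1 (uq_mat n q Lminus)"
definition "Lmi' = U.opm 1 (inv\<^bsub>tens n 1 U\<^esub> (uq_mat n q Lminus))"

sublocale qm: quantum_matrices q n U.Eop "U.lam \<one>\<^bsub>U\<^esub>" Lpl Lmi Lmi'
proof -
  interpret opm: alg_map "tens n 1 U" "U.opm 1" by (rule U.opm_alg_map)
  note cl = uq_mat_closed Lminus_inverse(1)
  have inv: "U.opm 1 (uq_mat n q Lminus) * U.opm 1 (inv\<^bsub>tens n 1 U\<^esub> (uq_mat n q Lminus)) = U.lam \<one>\<^bsub>U\<^esub>"
    "U.opm 1 (inv\<^bsub>tens n 1 U\<^esub> (uq_mat n q Lminus)) * U.opm 1 (uq_mat n q Lminus) = U.lam \<one>\<^bsub>U\<^esub>"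
    using opm.map_mult[OF cl(2,3)] opm.map_mult[OF cl(3,2)] Lminus_inverse(2,3) U.opm_one[of 1] by (simp_all only:)
  show "quantum_matrices q n U.Eop (U.lam \<one>\<^bsub>U\<^esub>) Lpl Lmi Lmi'"
    unfolding Lpl_def Lmi_def Lmi'_def
    by (intro quantum_matrices.intro U.tensor_units_Eop quantum_matrices_axioms.intro)
      (rule opm_1_properties cl inv RLL_relation | assumption | blast)+
qed

lemma L_mat: "L_mat n q \<in> carrier (tens n 1 U)" "U.opm 1 (L_mat n q) = qm.L"
proof -
  interpret opm: alg_map "tens n 1 U" "U.opm 1" by (rule U.opm_alg_map)
  note cl = uq_mat_closed(1) Lminus_inverse(1)
  show "L_mat n q \<in> carrier (tens n 1 U)" "U.opm 1 (L_mat n q) = qm.L"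
    unfolding L_mat_def qm.L_def unfolding Lpl_def Lmi'_def by (rule opm.m_closed[OF cl] opm.map_mult[OF cl])+
qed

lemma copy_L_mat: "U.copy 1 (L_mat n q) = qm.L"
  using U.opm_1[OF L_mat(1)] L_mat(2) by (rule trans[OF sym])

text \<open>By the quadratic relation the inverse is the braid matrix minus q - 1/q. This is
  verified on operators and identified with \<open>inv\<close> by uniqueness of inverses.\<close>

lemma R_check_inverse:
  assumes "1 \<le> k" "k < m"
  defines "R \<equiv> extend_scalars n m U (R_check_at n q m k)"
  shows "inv\<^bsub>tens n m U\<^esub> R \<in> carrier (tens n m U)" "U.opm m (inv\<^bsub>tens n m U\<^esub> R) = U.T' k"
proof -
  interpret opm: alg_map "tens n m U" "U.opm m" by (rule U.opm_alg_map)
  let ?R' = "R \<ominus>\<^bsub>tens n m U\<^esub> (U.w \<odot>\<^bsub>tens n m U\<^esub> \<one>\<^bsub>tens n m U\<^esub>)"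
  have R: "R \<in> carrier (tens n m U)" "U.opm m R = U.T k"
    using assms U.opm_R_check[of k m] by (simp_all add: U.extend_closed)
  have R': "?R' \<in> carrier (tens n m U)" "U.opm m ?R' = U.T' k"
    using R by (simp_all add: opm.map_diff opm.map_smult U.opm_one U.T'_eq)
  have "?R' = inv\<^bsub>tens n m U\<^esub> R"
  proof (rule opm.inv_unique'[OF R(1) R'(1)])
    show "R \<otimes>\<^bsub>tens n m U\<^esub> ?R' = \<one>\<^bsub>tens n m U\<^esub>"
      by (rule inj_onD[OF U.opm_inj[of m]])
        (simp_all only: opm.map_mult R R' U.T_inverse U.opm_one opm.m_closed opm.one_closed)
    show "?R' \<otimes>\<^bsub>tens n m U\<^esub> R = \<one>\<^bsub>tens n m U\<^esub>"
      by (rule inj_onD[OF U.opm_inj[of m]])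
        (simp_all only: opm.map_mult R R' U.T_inverse U.opm_one opm.m_closed opm.one_closed)
  qed
  then show "inv\<^bsub>tens n m U\<^esub> R \<in> carrier (tens n m U)" "U.opm m (inv\<^bsub>tens n m U\<^esub> R) = U.T' k"
    using R' by (simp_all only:)
qed

lemma L_over: "k < m \<Longrightarrow> L_over n q m k \<in> carrier (tens n m U) \<and> U.opm m (L_over n q m k) = qm.Lb k"
proof (induction k)
  case 0
  have "U.opm m (at_copies n m U [1] (L_mat n q)) = qm.L"
    using U.opm_copy[of 1 m "L_mat n q"] 0 by (simp add: copy_L_mat[unfolded One_nat_def])
  then show ?case
    using 0 U.at_copies_closed[OF L_mat(1), of 1 m] by simp
next
  case (Suc k)
  interpret opm: alg_map "tens n m U" "U.opm m" by (rule U.opm_alg_map)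
  have k: "1 \<le> Suc k" "Suc k < m" using Suc.prems by auto
  have IH: "L_over n q m k \<in> carrier (tens n m U)" "U.opm m (L_over n q m k) = qm.Lb k"
    using Suc by auto
  note R = U.extend_closed[of m "R_check_at n q m (Suc k)"] U.opm_R_check[OF k]
  note R' = R_check_inverse[OF k]
  show ?case
    by (simp only: L_over.simps Let_def qm.Lb.simps opm.m_closed opm.map_mult IH R R' simp_thms)
qed

text \<open>Splitting off the innermost factor of a right fold permits induction at the right end,
  where \<open>Lprod\<close> grows.\<close>

lemma foldr_mult: "e * z = z \<Longrightarrow> foldr (\<lambda>x y. \<phi> x * y) xs z = foldr (\<lambda>x y. \<phi> x * y) xs e * z"
  for z e :: "'r::calgebra"
  by (induction xs) (simp_all add: mult.assoc)

lemma L_over_prod: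
  "list_prod (tens n m U) (map (L_over n q m) [0..<m]) \<in> carrier (tens n m U)"
  "U.opm m (list_prod (tens n m U) (map (L_over n q m) [0..<m])) = qm.Lprod m"
proof -
  interpret opm: alg_map "tens n m U" "U.opm m" by (rule U.opm_alg_map)
  have set: "set (map (L_over n q m) [0..<m]) \<subseteq> carrier (tens n m U)" using L_over by auto
  then show "list_prod (tens n m U) (map (L_over n q m) [0..<m]) \<in> carrier (tens n m U)"
    by (rule opm.list_prod_closed)
  have "foldr (\<lambda>x y. U.opm m x * y) (map (L_over n q m) [0..<k]) (U.lam \<one>\<^bsub>U\<^esub>) = qm.Lprod k" if "k \<le> m" for k
    using that
  proof (induction k)
    case (Suc k)
    have "foldr (\<lambda>x y. U.opm m x * y) (map (L_over n q m) [0..<Suc k]) (U.lam \<one>\<^bsub>U\<^esub>)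
      = foldr (\<lambda>x y. U.opm m x * y) (map (L_over n q m) [0..<k]) (qm.Lb k)"
      using L_over[of k m] Suc.prems by simp
    also have "\<dots> = qm.Lprod k * qm.Lb k"
      using Suc by (subst foldr_mult[where e = "U.lam \<one>\<^bsub>U\<^esub>"]) simp_all
    finally show ?case by simp
  qed simp
  then show "U.opm m (list_prod (tens n m U) (map (L_over n q m) [0..<m])) = qm.Lprod m"
    unfolding opm.map_list_prod[OF set] by (simp add: U.opm_one)
qed

text \<open>The cutoff at m = n in the definition agrees with \<open>el_vanishes\<close>, and at m =
  0 the empty trace is the unit.\<close>

lemma E_series: "E_series n q m \<in> carrier U" "U.lam (E_series n q m) = (- 1) ^ m *\<^sub>C qm.el m"
proof -
  interpret opm: alg_map "tens n m U" "U.opm m" by (rule U.opm_alg_map)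
  let ?Y = "list_prod (tens n m U) (map (L_over n q m) [0..<m]) \<otimes>\<^bsub>tens n m U\<^esub>
    extend_scalars n m U (antisymmetrizer n q m)"
  have Y: "?Y \<in> carrier (tens n m U)" by (intro opm.m_closed L_over_prod U.extend_closed)
  have "U.opm m ?Y = qm.Lprod m * U.As m"
    by (simp only: opm.map_mult L_over_prod U.extend_closed U.opm_antisymmetrizer)
  then have tr: "U.lam (q_trace n q m U ?Y) = qm.el m"
    by (simp only: U.lam_q_trace[OF Y] qm.el_def)
  have E0: "qm.el 0 = U.lam \<one>\<^bsub>U\<^esub>" by (simp add: qm.el_def)
  show "E_series n q m \<in> carrier U"
    using U.q_trace_closed[OF Y] by (auto simp: E_series_def Let_def)
  show "U.lam (E_series n q m) = (- 1) ^ m *\<^sub>C qm.el m"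
    using U.q_trace_closed[OF Y] tr E0 qm.el_vanishes[of m]
    by (auto simp: E_series_def Let_def U.lam.map_smult)
qed

lemma power_trace_series:
  "power_trace_series n q m \<in> carrier U"
  "U.lam (power_trace_series n q m) = (if m = 0 then U.lam \<one>\<^bsub>U\<^esub> else (1 - q powi (- 2)) *\<^sub>C qm.ps m)"
proof -
  interpret opm: alg_map "tens n 1 U" "U.opm 1" by (rule U.opm_alg_map)
  have pow: "L_mat n q [^]\<^bsub>tens n 1 U\<^esub> m \<in> carrier (tens n 1 U)" for m :: nat
    by (rule opm.nat_pow_closed[OF L_mat(1)])
  have "U.opm 1 (L_mat n q [^]\<^bsub>tens n 1 U\<^esub> m) = U.pw qm.L m" for m :: nat
  proof (induction m)
    case 0
    then show ?case using U.opm_one[of 1] by (simp only: opm.nat_pow_0 U.pw.simps)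
  next
    case (Suc m)
    have "commutes (U.pw qm.L m) qm.L"
      by (intro commutes_sym[OF U.commutes_pw] U.commutes_e commutes_refl) simp
    moreover have "U.opm 1 (L_mat n q [^]\<^bsub>tens n 1 U\<^esub> Suc m) = U.pw qm.L m * qm.L"
      by (simp only: opm.nat_pow_Suc opm.map_mult[OF pow L_mat(1)] Suc L_mat(2))
    ultimately show ?case by (simp add: commutes_def)
  qed
  then have "U.lam (q_trace n q 1 U (L_mat n q [^]\<^bsub>tens n 1 U\<^esub> m)) = qm.ps m" for m
    using U.lam_q_trace[OF pow] by (simp add: qm.ps_def)
  then show "U.lam (power_trace_series n q m) = (if m = 0 then U.lam \<one>\<^bsub>U\<^esub> else (1 - q powi (- 2)) *\<^sub>C qm.ps m)"
    "power_trace_series n q m \<in> carrier U"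
    using U.q_trace_closed[OF pow] by (auto simp: power_trace_series_def Let_def U.lam.map_smult)
qed

text \<open>Commuting with the two matrices amounts to commuting with their entries, which are the
  generators; words and linear combinations follow through \<open>ev\<close>.\<close>

lemma commutes_generators:
  assumes c: "c \<in> carrier U" and L: "commutes (U.lam c) Lpl" "commutes (U.lam c) Lmi" and x: "x \<in> carrier U"
  shows "c \<otimes>\<^bsub>U\<^esub> x = x \<otimes>\<^bsub>U\<^esub> c"
proof -
  obtain f where f: "x = pr.cls f" "f \<in> carrier FA"
    using x unfolding U_eq[symmetric] pr.carrier_Q by blast
  have gen: "commutes (U.em c) (U.em (pr.cls (nc_gen g)))" if "g \<in> gens" for g
  proof -
    have "c \<otimes>\<^bsub>U\<^esub> pr.cls (nc_gen (G a b)) = pr.cls (nc_gen (G a b)) \<otimes>\<^bsub>U\<^esub> c"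
      if "a \<in> {1..n}" "b \<in> {1..n}" "G = Lplus \<or> G = Lminus" for G a b
    proof -
      have "[a] \<in> U.idx 1" "[b] \<in> U.idx 1" using that by (auto simp: in_multi_idx_1)
      moreover have "uq_mat n q G \<in> carrier (tens n 1 U)" "commutes (U.lam c) (U.opm 1 (uq_mat n q G))"
        using that(3) uq_mat_closed L by (auto simp only: Lpl_def Lmi_def)
      ultimately show ?thesis
        using U.commutes_lam_entry[OF c, of "uq_mat n q G" 1 "[a]" "[b]"] uq_mat_entry[OF that(1,2), of G] by simp
    qed
    moreover obtain G a b where g: "g = G a b" "a \<in> {1..n}" "b \<in> {1..n}" "G = Lplus \<or> G = Lminus"
      using \<open>g \<in> gens\<close> by (auto simp: uq_gens_def)
    ultimately have "U.em (c \<otimes>\<^bsub>U\<^esub> pr.cls (nc_gen g)) = U.em (pr.cls (nc_gen g) \<otimes>\<^bsub>U\<^esub> c)" by simp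
    then show ?thesis
      using c cls_closed[of "nc_gen g"] \<open>g \<in> gens\<close> by (simp add: U.em.map_mult commutes_def)
  qed
  have "alg_map pr.Q U.em" using U.em.alg_map_axioms by (simp only: U_eq)
  from pr.map_cls[OF this f(2)]
  have ev: "U.em x = ev (U.em \<one>\<^bsub>U\<^esub>) (\<lambda>g. if g \<in> gens then U.em (pr.cls (nc_gen g)) else 0) f"
    by (simp only: f(1) U_eq)
  have "commutes (U.em c) (word_eval (U.em \<one>\<^bsub>U\<^esub>) (\<lambda>g. if g \<in> gens then U.em (pr.cls (nc_gen g)) else 0) w)" for w
  proof (induction w)
    case Nil
    then show ?case using c by (simp add: commutes_def U.em.map_one_left U.em.map_one_right)
  next
    case (Cons g w)
    then show ?case using gen by (auto intro: commutes_mult)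
  qed
  then have "commutes (U.em c) (U.em x)"
    unfolding ev ev_def by (intro commutes_sum commutes_cscale)
  then have "U.em (c \<otimes>\<^bsub>U\<^esub> x) = U.em (x \<otimes>\<^bsub>U\<^esub> c)"
    using c x by (simp add: U.em.map_mult commutes_def)
  then show ?thesis using c x by (intro U.emb_inj) auto
qed

lemma E_series_central:
  assumes "x \<in> carrier U"
  shows "E_series n q m \<otimes>\<^bsub>U\<^esub> x = x \<otimes>\<^bsub>U\<^esub> E_series n q m"
  using E_series(1)
proof (rule commutes_generators)
  show "commutes (U.lam (E_series n q m)) Lpl" "commutes (U.lam (E_series n q m)) Lmi"
    unfolding E_series(2)
    by (intro commutes_sym[OF commutes_cscale] commutes_sym[OF qm.el_central(1)] commutes_sym[OF qm.el_central(2)])+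
qed (rule assms)

lemma E_series_closed: "E_series n q \<in> carrier (series_alg U)"
  and power_trace_series_closed: "power_trace_series n q \<in> carrier (series_alg U)"
  by (auto simp: U.series_simps E_series(1) power_trace_series(1))

lemma E_series_unit: "E_series n q \<in> Units (series_alg U)"
proof (rule U.central_series_unit[OF E_series_closed])
  show "E_series n q 0 = \<one>\<^bsub>U\<^esub>" by (simp add: E_series_def Let_def)
qed (rule E_series_central)

text \<open>The term k = 0 reproduces the coefficient of E; the other terms are, up to sign and the
  factor 1 - q^(-2), the alternating sum in \<open>newton\<close>.\<close>

lemma newton_coefficient:
  "(\<Sum>k\<in>{..m}. U.lam (power_trace_series n q k) * U.lam (E_series n q (m - k)))
    = inverse (q\<^sup>2) ^ m *\<^sub>C U.lam (E_series n q m)"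
proof (cases m)
  case 0
  then show ?thesis
    by (simp add: power_trace_series(2) U.lam.map_one_left E_series(1))
next
  case (Suc p)
  let ?r = "inverse q" and ?s = "\<Sum>k\<le>p. (- 1) ^ k *\<^sub>C (qm.ps (Suc k) * qm.el (p - k))"
  have "(\<Sum>k\<in>{..m}. U.lam (power_trace_series n q k) * U.lam (E_series n q (m - k)))
    = U.lam (E_series n q (Suc p)) + (\<Sum>k\<le>p. (1 - q powi (- 2)) *\<^sub>C qm.ps (Suc k) * U.lam (E_series n q (p - k)))"
    unfolding Suc sum.atMost_Suc_shift by (simp add: power_trace_series(2) U.lam.map_one_left E_series(1))
  also have "(\<Sum>k\<le>p. (1 - q powi (- 2)) *\<^sub>C qm.ps (Suc k) * U.lam (E_series n q (p - k)))
    = ((1 - q powi (- 2)) * (- 1) ^ p) *\<^sub>C ?s"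
    unfolding cscale_sum_right
  proof (intro sum.cong refl)
    fix k assume "k \<in> {..p}"
    then have "(- 1 :: complex) ^ (p - k) = (- 1) ^ p * (- 1) ^ k"
      by (simp add: uminus_power_if)
    then show "(1 - q powi (- 2)) *\<^sub>C qm.ps (Suc k) * U.lam (E_series n q (p - k))
      = ((1 - q powi (- 2)) * (- 1) ^ p) *\<^sub>C (- 1) ^ k *\<^sub>C (qm.ps (Suc k) * qm.el (p - k))"
      by (simp add: E_series(2) mult_ac)
  qed
  also have "?s = (?r ^ p * qint q (Suc p)) *\<^sub>C qm.el (Suc p)"
  proof -
    have "?r ^ p *\<^sub>C (qint q (Suc p) *\<^sub>C qm.el (Suc p)) = ?r ^ p *\<^sub>C (q ^ p *\<^sub>C ?s)"
      by (simp only: qm.newton)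
    then show ?thesis by (simp add: power_inverse)
  qed
  also have "U.lam (E_series n q (Suc p)) + ((1 - q powi (- 2)) * (- 1) ^ p) *\<^sub>C (?r ^ p * qint q (Suc p)) *\<^sub>C qm.el (Suc p)
    = ((- 1) ^ Suc p * (1 - (1 - q powi (- 2)) * ?r ^ p * qint q (Suc p))) *\<^sub>C qm.el (Suc p)"
    by (simp add: E_series(2) cscale_distribs algebra_simps)
  \<comment> \<open>As 1 - q^(-2) = (q - 1/q)/q, the denominator of [p+1] cancels; this explains the
    factor in front of the power sums.\<close>
  also have "1 - (1 - q powi (- 2)) * ?r ^ p * qint q (Suc p) = inverse (q\<^sup>2) ^ Suc p"
  proof -
    have "1 - q powi (- 2) = ?r * (q - ?r)"
      by (simp add: power_int_minus power2_eq_square algebra_simps)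
    moreover have "(q - ?r) * qint q (Suc p) = q ^ Suc p - ?r ^ Suc p"
      using q_diff(1) by (simp add: qint_def)
    ultimately have "(1 - q powi (- 2)) * ?r ^ p * qint q (Suc p) = ?r ^ Suc p * (q ^ Suc p - ?r ^ Suc p)"
      by (simp add: mult_ac)
    also have "\<dots> = 1 - inverse (q\<^sup>2) ^ Suc p"
    proof -
      have "?r ^ Suc p * q ^ Suc p = 1" by (simp only: power_mult_distrib[symmetric]) simp
      moreover have "?r ^ Suc p * ?r ^ Suc p = inverse (q\<^sup>2) ^ Suc p"
        by (simp only: power_mult_distrib[symmetric] power2_eq_square inverse_mult_distrib)
      ultimately show ?thesis by (simp only: right_diff_distrib)
    qed
    finally show ?thesis by simp
  qed
  finally show ?thesis by (simp add: Suc E_series(2) mult.commute)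
qed

text \<open>The identity multiplied by E(u), so that only coefficients of convolutions are
  compared.\<close>

lemma series_identity:
  "power_trace_series n q \<otimes>\<^bsub>series_alg U\<^esub> E_series n q = rescale U (q\<^sup>2) (E_series n q)"
proof
  fix m
  show "(power_trace_series n q \<otimes>\<^bsub>series_alg U\<^esub> E_series n q) m = rescale U (q\<^sup>2) (E_series n q) m"
  proof (rule U.lam_inj)
    show "(power_trace_series n q \<otimes>\<^bsub>series_alg U\<^esub> E_series n q) m \<in> carrier U"
      using U.series_mult_closed[OF power_trace_series_closed E_series_closed] by (auto simp: U.series_simps)
    show "rescale U (q\<^sup>2) (E_series n q) m \<in> carrier U"
      by (simp add: rescale_def E_series(1))
    have "U.lam ((power_trace_series n q \<otimes>\<^bsub>series_alg U\<^esub> E_series n q) m)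
      = (\<Sum>k\<in>{..m}. U.lam (power_trace_series n q k) * U.lam (E_series n q (m - k)))"
      by (simp add: U.series_simps U.lam.map_finsum U.lam.map_mult E_series(1) power_trace_series(1))
    then show "U.lam ((power_trace_series n q \<otimes>\<^bsub>series_alg U\<^esub> E_series n q) m) = U.lam (rescale U (q\<^sup>2) (E_series n q) m)"
      by (simp only: newton_coefficient rescale_def U.lam.map_smult[OF E_series(1)])
  qed
qed

end

theorem theorem5p1:
  fixes n :: nat and q :: complex
  assumes "n \<ge> 1"
    and "q \<noteq> 0"
    and "\<forall>k::nat. k \<ge> 1 \<longrightarrow> q ^ k \<noteq> 1"
  shows "(\<forall>m. E_series n q m \<in> carrier (Uq_gl n q) \<and>
              (\<forall>x \<in> carrier (Uq_gl n q).
                 E_series n q m \<otimes>\<^bsub>Uq_gl n q\<^esub> x = x \<otimes>\<^bsub>Uq_gl n q\<^esub> E_series n q m)) \<and>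
         E_series n q \<in> Units (series_alg (Uq_gl n q)) \<and>
         power_trace_series n q =
           rescale (Uq_gl n q) (q\<^sup>2) (E_series n q) \<otimes>\<^bsub>series_alg (Uq_gl n q)\<^esub>
             inv\<^bsub>series_alg (Uq_gl n q)\<^esub> (E_series n q)"
proof -
  interpret quantum_gl q n
    by unfold_locales (use assms in auto)
  interpret S: monoid "series_alg U" by (rule U.series_monoid)
  have "rescale U (q\<^sup>2) (E_series n q) \<otimes>\<^bsub>series_alg U\<^esub> inv\<^bsub>series_alg U\<^esub> (E_series n q)
    = power_trace_series n q"
    using power_trace_series_closed E_series_closed E_series_unit
    by (simp add: series_identity[symmetric] S.m_assoc)
  then show ?thesis
    using E_series(1) E_series_central E_series_unit by simp
qed

end
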